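(* Let $G/H$ be a smooth coset space with a linear decomposition $\mathfrak{g}=\mathfrak{h}+\mathfrak{m}$. Suppose that $c(t)$ is a smooth curve on $G/H$ which is defined for $t\in(a,b)$ with $a<0<b$, satisfying $c(0)=g\cdot o$ for some $g\in G$ and $\dot{c}(t)\neq0$ everywhere. Then there exists a unique smooth curve $\overline{c}(t)$ on $G$, which is defined around $t=0$, and satisfies $$\overline{c}(0)=g,\quad c(t)=\overline{c}(t)\cdot o\quad\mbox{and}\quad(L_{\overline{c}(t)^{-1}})_*(\dot{\overline{c}}(t))=(\overline{c}(t)^{-1})_*(\dot{c}(t))\in\mathfrak{m}\backslash\{0\}\quad\mbox{everywhere.}$$ Furthermore, $\overline{c}(t)$ can also be defined for all $t\in(a,b)$ if one of the following is satisfied: (1) the decomposition $\mathfrak{g}=\mathfrak{h}+\mathfrak{m}$ is reductive; (2) the subgroup $H$ is compact.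
   Context: $G$ is a Lie group, $H$ a closed subgroup, $o=eH\in G/H$, $\mathfrak{g}=\mathrm{Lie}(G)=T_eG$, $\mathfrak{h}=\mathrm{Lie}(H)$. A linear decomposition $\mathfrak{g}=\mathfrak{h}+\mathfrak{m}$ is a direct sum of vector spaces, and it is reductive if it is $\mathrm{Ad}(H)$-invariant. The subspace $\mathfrak{m}$ is identified with $T_o(G/H)$ via the differential at $e$ of the map $g\mapsto g\cdot o$; the equality $(L_{\overline{c}(t)^{-1}})_*(\dot{\overline{c}}(t))=(\overline{c}(t)^{-1})_*(\dot{c}(t))$ is understood through this identification. $L_g$ denotes left translation on $G$, and $g_*$ the tangent map of the action of $g\in G$ on $G/H$. *)

theory Defs
  imports
    "HOL-Analysis.Analysis"
    "HOL-Algebra.Coset"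
    "HOL-Library.Function_Algebras"
    "HOL-Library.Set_Algebras"
begin

section \<open>Vector space of functions\<close>

text \<open>Pointwise scaling complements the pointwise addition of \<open>Function_Algebras\<close>. Tangent
  vectors are functions below, so the library's \<^const>\<open>subspace\<close>, sums and zero apply to them.\<close>

instantiation "fun" :: (type, real_vector) real_vector
begin

definition scaleR_fun :: "real \<Rightarrow> ('a \<Rightarrow> 'b) \<Rightarrow> 'a \<Rightarrow> 'b"
  where "scaleR_fun r f = (\<lambda>x. r *\<^sub>R f x)"

instance
  by standard (simp_all add: scaleR_fun_def fun_eq_iff algebra_simps)

end

section \<open>Smooth functions on open subsets of Euclidean spaces\<close>

text \<open>\<open>C_on k S f\<close> is only meant for open \<open>S\<close>. In finite dimension, \<open>f\<close> is \<open>C\<^sup>k\<^sup>+\<^sup>1\<close> iff it is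
  differentiable and all its directional derivatives are \<open>C\<^sup>k\<close>.\<close>

primrec C_on :: "nat \<Rightarrow> 'a::euclidean_space set \<Rightarrow> ('a \<Rightarrow> 'b::euclidean_space) \<Rightarrow> bool"
  where
    "C_on 0 S f \<longleftrightarrow> continuous_on S f"
  | "C_on (Suc k) S f \<longleftrightarrow>
       (\<forall>x\<in>S. f differentiable (at x)) \<and>
       (\<forall>v. C_on k S (\<lambda>x. frechet_derivative f (at x) v))"

definition smooth_on :: "'a::euclidean_space set \<Rightarrow> ('a \<Rightarrow> 'b::euclidean_space) \<Rightarrow> bool"
  where "smooth_on S f \<longleftrightarrow> (\<forall>k. C_on k S f)"

section \<open>Smooth manifolds\<close>

text \<open>A chart is a domain together with a coordinate map, whose values outside the domain are
  irrelevant. Atlases need not be maximal.\<close>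

type_synonym ('a, 'e) chart = "'a set \<times> ('a \<Rightarrow> 'e)"

locale smooth_manifold =
  fixes X :: "'a topology" and A :: "('a, 'e::euclidean_space) chart set"
  assumes Hausdorff: "Hausdorff_space X"
    and second_countable: "second_countable X"
    and chart_openin: "\<And>U \<phi>. (U, \<phi>) \<in> A \<Longrightarrow> openin X U"
    and chart_open_image: "\<And>U \<phi>. (U, \<phi>) \<in> A \<Longrightarrow> open (\<phi> ` U)"
    and chart_homeo: "\<And>U \<phi>. (U, \<phi>) \<in> A \<Longrightarrow>
          homeomorphic_map (subtopology X U) (top_of_set (\<phi> ` U)) \<phi>"
    and charts_cover: "\<Union> (fst ` A) = topspace X"
    and charts_compatible: "\<And>U \<phi> V \<psi>. (U, \<phi>) \<in> A \<Longrightarrow> (V, \<psi>) \<in> A \<Longrightarrow>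
          smooth_on (\<phi> ` (U \<inter> V)) (\<psi> \<circ> inv_into U \<phi>)"

definition product_atlas ::
  "('a, 'e) chart set \<Rightarrow> ('b, 'f) chart set \<Rightarrow> ('a \<times> 'b, 'e \<times> 'f) chart set"
  where "product_atlas A B = {(U \<times> V, map_prod \<phi> \<psi>) | U \<phi> V \<psi>. (U, \<phi>) \<in> A \<and> (V, \<psi>) \<in> B}"

definition smooth_map ::
  "'a topology \<Rightarrow> ('a, 'e::euclidean_space) chart set \<Rightarrow>
   'b topology \<Rightarrow> ('b, 'f::euclidean_space) chart set \<Rightarrow> ('a \<Rightarrow> 'b) \<Rightarrow> bool"
  where "smooth_map X A Y B f \<longleftrightarrow>
    continuous_map X Y f \<and>
    (\<forall>(U, \<phi>)\<in>A. \<forall>(V, \<psi>)\<in>B. smooth_on (\<phi> ` {x \<in> U. f x \<in> V}) (\<psi> \<circ> f \<circ> inv_into U \<phi>))"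

text \<open>Curves are parametrised by an open set \<open>J\<close> of reals; values outside \<open>J\<close> are irrelevant.\<close>

definition smooth_curve ::
  "'a topology \<Rightarrow> ('a, 'e::euclidean_space) chart set \<Rightarrow> real set \<Rightarrow> (real \<Rightarrow> 'a) \<Rightarrow> bool"
  where "smooth_curve X A J c \<longleftrightarrow>
    continuous_map (top_of_set J) X c \<and>
    (\<forall>(U, \<phi>)\<in>A. smooth_on {t \<in> J. c t \<in> U} (\<phi> \<circ> c))"

section \<open>Tangent vectors\<close>

text \<open>A tangent vector at \<open>p\<close> is the family of its coordinate vectors in all charts around \<open>p\<close>,
  related to each other by the differentials of the chart transitions. It is set to \<open>0\<close> on all
  other pairs, so that tangent vectors are determined by their coordinates.\<close>

type_synonym ('a, 'e) tangent_vector = "('a, 'e) chart \<Rightarrow> 'e"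

definition tangent_space ::
  "('a, 'e::euclidean_space) chart set \<Rightarrow> 'a \<Rightarrow> ('a, 'e) tangent_vector set"
  where "tangent_space A p =
    {v. (\<forall>(U, \<phi>)\<in>A. \<forall>(V, \<psi>)\<in>A. p \<in> U \<longrightarrow> p \<in> V \<longrightarrow>
           v (V, \<psi>) = frechet_derivative (\<psi> \<circ> inv_into U \<phi>) (at (\<phi> p)) (v (U, \<phi>))) \<and>
        (\<forall>U \<phi>. \<not> ((U, \<phi>) \<in> A \<and> p \<in> U) \<longrightarrow> v (U, \<phi>) = 0)}"

definition velocity ::
  "('a, 'e::euclidean_space) chart set \<Rightarrow> (real \<Rightarrow> 'a) \<Rightarrow> real \<Rightarrow> ('a, 'e) tangent_vector"
  where "velocity A c t =
    (\<lambda>(U, \<phi>). if (U, \<phi>) \<in> A \<and> c t \<in> U then vector_derivative (\<phi> \<circ> c) (at t) else 0)"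

text \<open>By the chain rule, the choice of the chart \<open>(U, \<phi>)\<close> around \<open>p\<close> does not matter for smooth
  \<open>f\<close> and \<open>v\<close> in the tangent space at \<open>p\<close>.\<close>

definition tangent_map ::
  "('a, 'e::euclidean_space) chart set \<Rightarrow> ('b, 'f::euclidean_space) chart set \<Rightarrow>
   ('a \<Rightarrow> 'b) \<Rightarrow> 'a \<Rightarrow> ('a, 'e) tangent_vector \<Rightarrow> ('b, 'f) tangent_vector"
  where "tangent_map A B f p v =
    (let (U, \<phi>) = (SOME (U, \<phi>). (U, \<phi>) \<in> A \<and> p \<in> U)
     in (\<lambda>(V, \<psi>). if (V, \<psi>) \<in> B \<and> f p \<in> V
          then frechet_derivative (\<psi> \<circ> f \<circ> inv_into U \<phi>) (at (\<phi> p)) (v (U, \<phi>))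
          else 0))"

section \<open>Lie groups and their Lie algebras\<close>

locale lie_group = group G + smooth_manifold T A
  for G :: "('g, 'z) monoid_scheme" (structure)
    and T :: "'g topology" and A :: "('g, 'e::euclidean_space) chart set" +
  assumes topspace_carrier: "topspace T = carrier G"
    and smooth_mult: "smooth_map (prod_topology T T) (product_atlas A A) T A (\<lambda>(x, y). x \<otimes> y)"
    and smooth_inv: "smooth_map T A T A (\<lambda>x. inv x)"

definition Lie :: "('g, 'z) monoid_scheme \<Rightarrow> ('g, 'e::euclidean_space) chart set \<Rightarrow>
    ('g, 'e) tangent_vector set"
  where "Lie G A = tangent_space A \<one>\<^bsub>G\<^esub>"

text \<open>For a closed subgroup \<open>H\<close>, which is an embedded submanifold of \<open>G\<close>, the tangent space of \<open>H\<close>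
  at the identity inside that of \<open>G\<close>: the smooth curves of \<open>H\<close> are the smooth curves of \<open>G\<close> that
  stay in \<open>H\<close>.\<close>

definition Lie_sub :: "('g, 'z) monoid_scheme \<Rightarrow> 'g topology \<Rightarrow>
    ('g, 'e::euclidean_space) chart set \<Rightarrow> 'g set \<Rightarrow> ('g, 'e) tangent_vector set"
  where "Lie_sub G T A H =
    {velocity A \<gamma> 0 | \<gamma>. \<exists>\<epsilon>>0. smooth_curve T A {-\<epsilon><..<\<epsilon>} \<gamma> \<and>
        \<gamma> 0 = \<one>\<^bsub>G\<^esub> \<and> \<gamma> ` {-\<epsilon><..<\<epsilon>} \<subseteq> H}"

definition left_translation :: "('g, 'z) monoid_scheme \<Rightarrow> 'g \<Rightarrow> 'g \<Rightarrow> 'g"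
  where "left_translation G g = (\<lambda>x. g \<otimes>\<^bsub>G\<^esub> x)"

definition Ad :: "('g, 'z) monoid_scheme \<Rightarrow> ('g, 'e::euclidean_space) chart set \<Rightarrow>
    'g \<Rightarrow> ('g, 'e) tangent_vector \<Rightarrow> ('g, 'e) tangent_vector"
  where "Ad G A g = tangent_map A A (\<lambda>x. g \<otimes>\<^bsub>G\<^esub> x \<otimes>\<^bsub>G\<^esub> inv\<^bsub>G\<^esub> g) \<one>\<^bsub>G\<^esub>"

section \<open>Smooth coset spaces\<close>

text \<open>The points of \<open>G/H\<close> are the left cosets \<open>g <# H\<close>, and \<open>g\<close> acts by \<open>\<lambda>C. g <# C\<close>. The topology of
  \<open>G/H\<close> is the quotient topology, and its smooth structure is the unique one for which the
  projection is a smooth submersion.\<close>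

locale smooth_coset_space = lie_group G T A + subgroup H G + coset: smooth_manifold Y B
  for G :: "('g, 'z) monoid_scheme" (structure)
    and T :: "'g topology" and A :: "('g, 'e::euclidean_space) chart set"
    and H :: "'g set"
    and Y :: "'g set topology" and B :: "('g set, 'f::euclidean_space) chart set" +
  assumes closed_subgroup: "closedin T H"
    and quotient_topology: "quotient_map T Y (\<lambda>g. g <# H)"
    and smooth_projection: "smooth_map T A Y B (\<lambda>g. g <# H)"
    and submersion: "\<And>g. g \<in> carrier G \<Longrightarrow>
          tangent_map A B (\<lambda>g. g <# H) g ` tangent_space A g = tangent_space B (g <# H)"

definition origin :: "('g, 'z) monoid_scheme \<Rightarrow> 'g set \<Rightarrow> 'g set"
  where "origin G H = \<one>\<^bsub>G\<^esub> <#\<^bsub>G\<^esub> H"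

definition act :: "('g, 'z) monoid_scheme \<Rightarrow> 'g \<Rightarrow> 'g set \<Rightarrow> 'g set"
  where "act G g = (\<lambda>C. g <#\<^bsub>G\<^esub> C)"

definition linear_decomposition :: "('g, 'z) monoid_scheme \<Rightarrow> 'g topology \<Rightarrow>
    ('g, 'e::euclidean_space) chart set \<Rightarrow> 'g set \<Rightarrow> ('g, 'e) tangent_vector set \<Rightarrow> bool"
  where "linear_decomposition G T A H \<mm> \<longleftrightarrow>
    subspace \<mm> \<and> Lie G A = Lie_sub G T A H + \<mm> \<and> Lie_sub G T A H \<inter> \<mm> = {0}"

definition reductive :: "('g, 'z) monoid_scheme \<Rightarrow> 'g topology \<Rightarrow>
    ('g, 'e::euclidean_space) chart set \<Rightarrow> 'g set \<Rightarrow> ('g, 'e) tangent_vector set \<Rightarrow> bool"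
  where "reductive G T A H \<mm> \<longleftrightarrow>
    (\<forall>h\<in>H. Ad G A h ` Lie_sub G T A H \<subseteq> Lie_sub G T A H \<and> Ad G A h ` \<mm> \<subseteq> \<mm>)"

text \<open>The tangent space of \<open>G/H\<close> at the origin is related to \<open>\<mm>\<close> by the differential of
  \<open>g \<mapsto> g \<cdot> o\<close> at the identity.\<close>

definition m_lift :: "('g, 'z) monoid_scheme \<Rightarrow> 'g topology \<Rightarrow>
    ('g, 'e::euclidean_space) chart set \<Rightarrow> 'g set \<Rightarrow> ('g set, 'f::euclidean_space) chart set \<Rightarrow>
    ('g, 'e) tangent_vector set \<Rightarrow> (real \<Rightarrow> 'g set) \<Rightarrow> 'g \<Rightarrow> real set \<Rightarrow> (real \<Rightarrow> 'g) \<Rightarrow> bool"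
  where "m_lift G T A H B \<mm> c g J cb \<longleftrightarrow>
    smooth_curve T A J cb \<and> cb 0 = g \<and>
    (\<forall>t\<in>J. c t = act G (cb t) (origin G H) \<and>
      (let u = tangent_map A A (left_translation G (inv\<^bsub>G\<^esub> cb t)) (cb t) (velocity A cb t);
           w = tangent_map B B (act G (inv\<^bsub>G\<^esub> cb t)) (c t) (velocity B c t)
       in u \<in> \<mm> - {0} \<and>
          tangent_map A B (\<lambda>x. act G x (origin G H)) \<one>\<^bsub>G\<^esub> u = w))"

end

theory Submission
  imports Defs
begin

text \<open>
  Write \<open>\<pi>\<close> for the projection onto the coset space. A curve \<open>x\<close> with \<open>\<pi> (x t) = c t\<close> is a lift in the
  sense of the theorem iff its left trivialised velocity \<open>u t = (L\<^sub>x\<^sub>(\<^sub>t\<^sub>)\<^sup>-\<^sup>1)\<^sub>* (x' t)\<close> stays in the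
  complement \<open>\<mm>\<close>: the equation with the velocity of \<open>c\<close> follows from equivariance of \<open>\<pi>\<close>, and
  \<open>u t \<noteq> 0\<close> from \<open>c' t \<noteq> 0\<close> (lemma \<open>m_lift_iff_hlift\<close>).

  \<^emph>\<open>The lift is the solution of an ordinary differential equation.\<close> The kernel of the differential of
  \<open>\<pi>\<close> at the identity is the Lie algebra of \<open>H\<close>, so \<open>\<mm>\<close> is mapped isomorphically onto the tangent
  space of the quotient at the origin, and by left translation the same holds at every point. Hence
  the horizontal velocity over \<open>c' t\<close> at a point \<open>x\<close> is a smooth function of \<open>t\<close> and \<open>x\<close>
  (lemma \<open>lift_ode\<close>). Picard iteration gives local existence and uniqueness, and a solution that starts
  over \<open>c\<close> remains over \<open>c\<close>, since its projection and \<open>c\<close> have the same velocity in coordinates. The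
  inclusion of the kernel in the Lie algebra of \<open>H\<close>, whose elements are by definition velocities of
  curves in \<open>H\<close>, is itself obtained from an integral curve (lemma \<open>kernel_in_Lie_sub\<close>).

  \<^emph>\<open>Differentiability of the action.\<close> The elements of the group
  act differentiably on the quotient because the projection has local sections, by the inverse function
  theorem (lemmas \<open>local_section\<close> and \<open>mdiff_act\<close>).

  \<^emph>\<open>Global lifts.\<close> The times reached by lifts that start at \<open>g\<close> form an open subset of the interval, and
  it is to be shown that it is closed. If the decomposition is reductive, right translation by \<open>h \<in> H\<close>
  turns horizontal lifts into horizontal lifts, so a lift around a limit time can be moved to
  meet the given one. If \<open>H\<close> is compact, the given lift accumulates at a point of the fibre over the
  limit time, and lifts through all points near that one live on a common interval.

  Manifolds enter through differentiability of a map at a point, tested in charts, and the chain rule for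
  the tangent maps; a curve is treated as a map from the line.
\<close>

section \<open>Calculus of smooth functions\<close>

lemma C_on_cong_imp:
  assumes "open S" "\<And>x. x \<in> S \<Longrightarrow> f x = g x" "C_on k S f"
  shows "C_on k S g"
  using assms(2,3)
proof (induction k arbitrary: f g)
  case 0
  then show ?case using continuous_on_cong by force
next
  case (Suc k)
  have d: "f differentiable at x" if "x \<in> S" for x
    using Suc.prems that by auto
  have eq: "frechet_derivative f (at x) = frechet_derivative g (at x)" if "x \<in> S" for x
    using frechet_derivative_transform_within_open[OF d[OF that] \<open>open S\<close> that] Suc.prems(1) by auto
  have "g differentiable at x" if "x \<in> S" for x
    using d[OF that] \<open>open S\<close> that Suc.prems(1)
    by (metis differentiable_def has_derivative_transform_within_open)
  moreover have "C_on k S (\<lambda>x. frechet_derivative g (at x) v)" for v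
    by (rule Suc.IH[of "\<lambda>x. frechet_derivative f (at x) v"]) (use Suc.prems eq in auto)
  ultimately show ?case by auto
qed

lemma C_on_cong:
  assumes "open S" "\<And>x. x \<in> S \<Longrightarrow> f x = g x"
  shows "C_on k S f \<longleftrightarrow> C_on k S g"
  using C_on_cong_imp[OF assms(1), of f g] C_on_cong_imp[OF assms(1), of g f] assms(2) by metis

lemma C_on_subset: "C_on k S f \<Longrightarrow> T \<subseteq> S \<Longrightarrow> C_on k T f"
  by (induction k arbitrary: f) (auto intro: continuous_on_subset)

lemma C_on_SucI:
  assumes "open S" "\<And>x. x \<in> S \<Longrightarrow> (f has_derivative f' x) (at x)" "\<And>v. C_on k S (\<lambda>x. f' x v)"
  shows "C_on (Suc k) S f"
proof -
  have eq: "frechet_derivative f (at x) = f' x" if "x \<in> S" for x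
    using frechet_derivative_at[OF assms(2)[OF that]] by simp
  have "C_on k S (\<lambda>x. frechet_derivative f (at x) v)" for v
    by (rule C_on_cong_imp[OF assms(1) _ assms(3)[of v]]) (simp add: eq)
  moreover have "f differentiable at x" if "x \<in> S" for x
    using assms(2)[OF that] by (auto simp: differentiable_def)
  ultimately show ?thesis by auto
qed

lemma C_on_SucD:
  assumes "C_on (Suc k) S f" "x \<in> S"
  shows "(f has_derivative frechet_derivative f (at x)) (at x)"
  using assms frechet_derivative_works by auto

lemma C_on_pred: "C_on (Suc k) S f \<Longrightarrow> C_on k S f"
proof (induction k arbitrary: f)
  case 0
  then show ?case
    by (auto intro!: continuous_at_imp_continuous_on differentiable_imp_continuous_within)
next
  case (Suc k)
  then show ?case using C_on.simps(2) by blast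
qed

lemma C_on_const: "open S \<Longrightarrow> C_on k S (\<lambda>x. c)"
proof (induction k arbitrary: c)
  case (Suc k)
  show ?case by (rule C_on_SucI[where f' = "\<lambda>x v. 0"]) (use Suc in auto)
qed auto

lemma C_on_bounded_linear:
  assumes "open S" "bounded_linear L"
  shows "C_on k S L"
proof (cases k)
  case 0
  then show ?thesis using assms linear_continuous_on by auto
next
  case (Suc j)
  show ?thesis unfolding Suc
    by (rule C_on_SucI[where f' = "\<lambda>x. L"])
      (use assms C_on_const bounded_linear_imp_has_derivative in auto)
qed

lemma C_on_add:
  assumes "open S" "C_on k S f" "C_on k S g"
  shows "C_on k S (\<lambda>x. f x + g x)"
  using assms(2,3)
proof (induction k arbitrary: f g)
  case (Suc k)
  show ?case
    by (rule C_on_SucI[OF assms(1) has_derivative_add[OF C_on_SucD[OF Suc.prems(1)] C_on_SucD[OF Suc.prems(2)]]])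
      (use Suc in auto)
qed (auto intro: continuous_intros)

lemma C_on_sum:
  assumes "open S" "finite I" "\<And>i. i \<in> I \<Longrightarrow> C_on k S (f i)"
  shows "C_on k S (\<lambda>x. \<Sum>i\<in>I. f i x)"
  using assms(2,3)
  by (induction I rule: finite_induct) (auto intro: C_on_add C_on_const assms(1))

lemma C_on_linear_compose:
  assumes "open S" "bounded_linear L" "C_on k S f"
  shows "C_on k S (\<lambda>x. L (f x))"
  using assms(3)
proof (induction k arbitrary: f)
  case 0
  then show ?case using bounded_linear.continuous_on[OF assms(2)] by auto
next
  case (Suc k)
  show ?case
    by (rule C_on_SucI[OF assms(1) bounded_linear.has_derivative[OF assms(2) C_on_SucD[OF Suc.prems]]])
      (use Suc in auto)
qed

text \<open>By the product rule the directional derivatives are again of the form treated, with one order of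
  differentiability less.\<close>

lemma C_on_bilinear:
  assumes "open S" "bounded_bilinear b" "C_on k S f" "C_on k S g"
  shows "C_on k S (\<lambda>x. b (f x) (g x))"
  using assms(3,4)
proof (induction k arbitrary: f g)
  case 0
  then show ?case using bounded_bilinear.continuous_on[OF assms(2)] by auto
next
  case (Suc k)
  have "C_on k S (\<lambda>x. b (f x) (frechet_derivative g (at x) v) + b (frechet_derivative f (at x) v) (g x))" for v
    by (intro C_on_add[OF assms(1)] Suc.IH C_on_pred[OF Suc.prems(1)] C_on_pred[OF Suc.prems(2)])
      (use Suc.prems in auto)
  then show ?case
    using C_on_SucI[OF assms(1) bounded_bilinear.FDERIV[OF assms(2) C_on_SucD[OF Suc.prems(1)] C_on_SucD[OF Suc.prems(2)]]]
    by blast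
qed

lemma C_on_Pair:
  assumes "open S" "C_on k S f" "C_on k S g"
  shows "C_on k S (\<lambda>x. (f x, g x))"
proof -
  have "C_on k S (\<lambda>x. (f x, 0) + (0, g x))"
    by (intro C_on_add assms C_on_linear_compose[where L = "\<lambda>y. (y, 0)"]
        C_on_linear_compose[where L = "\<lambda>y. (0, y)"])
      (auto intro!: bounded_linear_Pair bounded_linear_ident bounded_linear_zero)
  then show ?thesis by simp
qed

lemma linear_basis_expansion:
  fixes L :: "'a::euclidean_space \<Rightarrow> 'b::real_vector"
  assumes "linear L"
  shows "L v = (\<Sum>b\<in>Basis. (v \<bullet> b) *\<^sub>R L b)"
proof -
  have "L v = L (\<Sum>b\<in>Basis. (v \<bullet> b) *\<^sub>R b)" by (simp add: euclidean_representation)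
  also have "\<dots> = (\<Sum>b\<in>Basis. (v \<bullet> b) *\<^sub>R L b)"
    using assms by (simp add: linear_sum linear_scale)
  finally show ?thesis .
qed

lemma linear_norm_le_basis:
  fixes L :: "'a::euclidean_space \<Rightarrow> 'b::real_normed_vector"
  assumes "linear L"
  shows "norm (L v) \<le> norm v * (\<Sum>b\<in>Basis. norm (L b))"
proof -
  have "norm (L v) \<le> (\<Sum>b\<in>Basis. norm v * norm (L b))"
    unfolding linear_basis_expansion[OF assms, of v]
    by (rule sum_norm_le) (simp add: Basis_le_norm mult_right_mono)
  then show ?thesis by (simp add: sum_distrib_left)
qed

text \<open>The derivative of a map is handled as a family of linear maps whose columns are regular; products of
  a family with a regular vector are reduced to scalar products by expanding the vector in the basis.\<close>

lemma C_on_apply_linear: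
  fixes L :: "'a::euclidean_space \<Rightarrow> 'b::euclidean_space \<Rightarrow> 'c::euclidean_space"
  assumes "open S" "\<And>x. x \<in> S \<Longrightarrow> linear (L x)" "\<And>v. C_on k S (\<lambda>x. L x v)" "C_on k S w"
  shows "C_on k S (\<lambda>x. L x (w x))"
proof (rule C_on_cong_imp[OF assms(1)])
  show "C_on k S (\<lambda>x. \<Sum>b\<in>Basis. (w x \<bullet> b) *\<^sub>R L x b)"
    by (intro C_on_sum C_on_bilinear[OF _ bounded_bilinear_scaleR] assms finite_Basis
        C_on_linear_compose[OF _ _ assms(4), where L = "\<lambda>y. y \<bullet> b" for b])
      (auto intro: bounded_linear_inner_left)
qed (use linear_basis_expansion[OF assms(2)] in auto)

lemma C_on_compose:
  fixes g :: "'b::euclidean_space \<Rightarrow> 'c::euclidean_space"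
  assumes "open S" "open T" "C_on k S f" "C_on k T g" "f ` S \<subseteq> T"
  shows "C_on k S (\<lambda>x. g (f x))"
  using assms(3,4)
proof (induction k arbitrary: g)
  case 0
  then show ?case using assms(5) by (auto intro: continuous_on_compose2)
next
  case (Suc k)
  have gd: "(g has_derivative frechet_derivative g (at (f x))) (at (f x))" if "x \<in> S" for x
    using C_on_SucD[OF Suc.prems(2)] that assms(5) by auto
  have "C_on k S (\<lambda>x. frechet_derivative g (at (f x)) (frechet_derivative f (at x) v))" for v
  proof (rule C_on_apply_linear[OF assms(1), where L = "\<lambda>x. frechet_derivative g (at (f x))"
        and w = "\<lambda>x. frechet_derivative f (at x) v"])
    show "linear (frechet_derivative g (at (f x)))" if "x \<in> S" for x
      using gd[OF that] has_derivative_linear by blast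
    show "C_on k S (\<lambda>x. frechet_derivative g (at (f x)) u)" for u
      by (rule Suc.IH[of "\<lambda>y. frechet_derivative g (at y) u"]) (use Suc.prems C_on_pred in auto)
  qed (use Suc.prems in auto)
  then show ?case
    by (intro C_on_SucI[OF assms(1) has_derivative_compose[OF C_on_SucD[OF Suc.prems(1)] gd]])
qed

lemma C_on_Union:
  assumes "\<And>x. x \<in> S \<Longrightarrow> \<exists>U. open U \<and> x \<in> U \<and> C_on k U f"
  shows "C_on k S f"
  using assms
proof (induction k arbitrary: f)
  case 0
  have "isCont f x" if "x \<in> S" for x
    using 0[OF that] continuous_on_eq_continuous_at by auto
  then show ?case by (simp add: continuous_at_imp_continuous_on)
next
  case (Suc k)
  have loc: "\<exists>U. open U \<and> x \<in> U \<and> C_on k U (\<lambda>x. frechet_derivative f (at x) v)" if "x \<in> S" for x v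
    using Suc.prems[OF that] unfolding C_on.simps(2) by blast
  have "f differentiable at x" if "x \<in> S" for x
    using Suc.prems[OF that] unfolding C_on.simps(2) by blast
  moreover have "C_on k S (\<lambda>x. frechet_derivative f (at x) v)" for v
    by (rule Suc.IH) (rule loc)
  ultimately show ?case by simp
qed

lemma smooth_on_cong:
  "open S \<Longrightarrow> (\<And>x. x \<in> S \<Longrightarrow> f x = g x) \<Longrightarrow> smooth_on S f \<longleftrightarrow> smooth_on S g"
  unfolding smooth_on_def using C_on_cong[of S f g] by blast

lemma smooth_on_subset: "smooth_on S f \<Longrightarrow> T \<subseteq> S \<Longrightarrow> smooth_on T f"
  unfolding smooth_on_def using C_on_subset by blast

lemma smooth_on_Union:
  assumes "\<And>x. x \<in> S \<Longrightarrow> \<exists>U. open U \<and> x \<in> U \<and> smooth_on U f"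
  shows "smooth_on S f"
  unfolding smooth_on_def
proof
  show "C_on k S f" for k
    by (rule C_on_Union) (use assms in \<open>unfold smooth_on_def, blast\<close>)
qed

lemma smooth_on_compose:
  "open S \<Longrightarrow> open T \<Longrightarrow> smooth_on S f \<Longrightarrow> smooth_on T g \<Longrightarrow> f ` S \<subseteq> T
    \<Longrightarrow> smooth_on S (\<lambda>x. g (f x))"
  unfolding smooth_on_def using C_on_compose by blast

lemma smooth_on_Pair:
  "open S \<Longrightarrow> smooth_on S f \<Longrightarrow> smooth_on S g \<Longrightarrow> smooth_on S (\<lambda>x. (f x, g x))"
  unfolding smooth_on_def using C_on_Pair by blast

lemma smooth_on_const: "open S \<Longrightarrow> smooth_on S (\<lambda>x. c)"
  unfolding smooth_on_def using C_on_const by blast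

lemma smooth_on_bounded_linear: "open S \<Longrightarrow> bounded_linear L \<Longrightarrow> smooth_on S L"
  unfolding smooth_on_def using C_on_bounded_linear by blast

lemma smooth_on_linear_compose:
  "open S \<Longrightarrow> bounded_linear L \<Longrightarrow> smooth_on S f \<Longrightarrow> smooth_on S (\<lambda>x. L (f x))"
  unfolding smooth_on_def using C_on_linear_compose by blast

lemma smooth_on_diff:
  assumes "open S" "smooth_on S f" "smooth_on S g"
  shows "smooth_on S (\<lambda>x. f x - g x)"
proof -
  have "C_on k S (\<lambda>x. f x + - g x)" for k
    using assms bounded_linear_minus[OF bounded_linear_ident]
    by (intro C_on_add C_on_linear_compose[where L = uminus]) (auto simp: smooth_on_def)
  then show ?thesis by (simp add: smooth_on_def)
qed

lemma smooth_on_apply_linear: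
  fixes L :: "'a::euclidean_space \<Rightarrow> 'b::euclidean_space \<Rightarrow> 'c::euclidean_space"
  assumes "open S" "\<And>x. x \<in> S \<Longrightarrow> linear (L x)" "\<And>v. smooth_on S (\<lambda>x. L x v)" "smooth_on S w"
  shows "smooth_on S (\<lambda>x. L x (w x))"
  using assms(3,4) unfolding smooth_on_def by (simp add: C_on_apply_linear[OF assms(1,2)])

lemma smooth_onD: "smooth_on S f \<Longrightarrow> C_on k S f"
  by (simp add: smooth_on_def)

lemma smooth_on_has_derivative:
  assumes "smooth_on S f" "x \<in> S"
  shows "(f has_derivative frechet_derivative f (at x)) (at x)"
  by (rule C_on_SucD[OF smooth_onD[OF assms(1)] assms(2)])

lemma smooth_on_differentiable:
  assumes "smooth_on S f" "x \<in> S"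
  shows "f differentiable at x"
  using smooth_on_has_derivative[OF assms] by (auto simp: differentiable_def)

lemma smooth_on_linear_derivative:
  assumes "smooth_on S f" "x \<in> S"
  shows "linear (frechet_derivative f (at x))"
  by (rule linear_frechet_derivative[OF smooth_on_differentiable[OF assms]])

lemma smooth_on_continuous_on:
  assumes "smooth_on S f"
  shows "continuous_on S f"
  using smooth_onD[OF assms, of 0] by simp

lemma smooth_on_derivative:
  assumes "smooth_on S f"
  shows "smooth_on S (\<lambda>x. frechet_derivative f (at x) v)"
  unfolding smooth_on_def
proof
  show "C_on k S (\<lambda>x. frechet_derivative f (at x) v)" for k
    using smooth_onD[OF assms, of "Suc k"] by simp
qed

lemma smooth_on_derivative_apply:
  assumes "open S" "smooth_on S f" "smooth_on S w"
  shows "smooth_on S (\<lambda>x. frechet_derivative f (at x) (w x))"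
  by (rule smooth_on_apply_linear[where L = "\<lambda>x. frechet_derivative f (at x)",
        OF assms(1) smooth_on_linear_derivative[OF assms(2)] smooth_on_derivative[OF assms(2)] assms(3)])

section \<open>Inverses of families of linear maps\<close>

text \<open>For injective \<open>Z x0\<close> the lower bound \<open>norm v * m \<le> norm (Z x v)\<close> persists near \<open>x0\<close>, because
  the columns of \<open>Z\<close> are continuous.\<close>

lemma injective_family_lower_bound:
  fixes Z :: "'a::euclidean_space \<Rightarrow> 'b::euclidean_space \<Rightarrow> 'c::euclidean_space"
  assumes "open S" "x0 \<in> S" "\<And>x. x \<in> S \<Longrightarrow> linear (Z x)"
    and cont: "\<And>v. continuous_on S (\<lambda>x. Z x v)" and "inj (Z x0)"
  obtains U m where "open U" "x0 \<in> U" "U \<subseteq> S" "m > 0" "\<And>x v. x \<in> U \<Longrightarrow> m * norm v \<le> norm (Z x v)"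
proof -
  obtain B where B: "B > 0" "\<And>v. B * norm v \<le> norm (Z x0 v)"
    using linear_inj_bounded_below_pos[OF assms(3)[OF assms(2)] assms(5)] by metis
  define d where "d = (\<lambda>x. \<Sum>b\<in>Basis. norm (Z x b - Z x0 b))"
  have dcont: "continuous_on S d"
    unfolding d_def by (intro continuous_intros cont)
  define U where "U = {x \<in> S. d x < B / 2}"
  have "open U"
  proof -
    have "U = S \<inter> d -` {..<B/2}" by (auto simp: U_def)
    then show ?thesis using continuous_open_preimage[OF dcont assms(1), of "{..<B/2}"] by simp
  qed
  moreover have "x0 \<in> U" using B(1) assms(2) by (simp add: U_def d_def)
  moreover have "B / 2 * norm v \<le> norm (Z x v)" if "x \<in> U" for x v
  proof -
    have x: "x \<in> S" using that by (simp add: U_def)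
    have "norm (Z x v - Z x0 v) \<le> norm v * d x"
      unfolding d_def
      by (rule linear_norm_le_basis[OF linear_compose_sub[OF assms(3)[OF x] assms(3)[OF assms(2)]]])
    also have "\<dots> \<le> norm v * (B / 2)"
      using that by (intro mult_left_mono) (auto simp: U_def)
    finally have "norm (Z x v - Z x0 v) \<le> norm v * (B / 2)" .
    moreover have "norm (Z x0 v) \<le> norm (Z x v) + norm (Z x v - Z x0 v)"
      using norm_triangle_ineq4[of "Z x v" "Z x v - Z x0 v"] by simp
    ultimately show ?thesis using B(2)[of v] by (simp add: algebra_simps)
  qed
  ultimately show ?thesis using that[of U "B/2"] B(1) by (auto simp: U_def)
qed

text \<open>In the presence of group structures, \<open>inv\<close> denotes the inverse in a group.\<close>

abbreviation linv :: "('a \<Rightarrow> 'b) \<Rightarrow> 'b \<Rightarrow> 'a"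
  where "linv L \<equiv> inv_into UNIV L"

lemma linear_inj_imp_inv:
  fixes L :: "'f::euclidean_space \<Rightarrow> 'f"
  assumes "linear L" "inj L"
  shows "linear (linv L)" "L (linv L v) = v" "linv L (L v) = v"
proof -
  have s: "surj L" using assms linear_injective_imp_surjective by blast
  then show "L (linv L v) = v" by (simp add: surj_f_inv_f)
  show "linv L (L v) = v" using assms by simp
  show "linear (linv L)" 
    using assms s by (simp add: inj_linear_imp_inv_linear)
qed

text \<open>With \<open>y = Z\<^sup>-\<^sup>1 w\<close> the remainder \<open>r x = w x - Z x (y x0)\<close> vanishes at \<open>x0\<close> and
  \<open>y x - y x0 = (Z x)\<^sup>-\<^sup>1 (r x)\<close>, where the inverse is uniformly bounded; so only the linear part of
  \<open>r\<close> matters.\<close>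

lemma has_derivative_inverse_family:
  fixes Z :: "'a::euclidean_space \<Rightarrow> 'f::euclidean_space \<Rightarrow> 'f"
  assumes "open S" "x0 \<in> S" and lin: "\<And>x. x \<in> S \<Longrightarrow> linear (Z x)" and inj: "\<And>x. x \<in> S \<Longrightarrow> inj (Z x)"
    and cont: "\<And>v. continuous_on S (\<lambda>x. Z x v)"
    and Z': "((\<lambda>x. Z x (linv (Z x0) (w x0))) has_derivative Z') (at x0)"
    and w': "(w has_derivative w') (at x0)"
  shows "((\<lambda>x. linv (Z x) (w x)) has_derivative (\<lambda>v. linv (Z x0) (w' v - Z' v))) (at x0)"
proof -
  obtain U m where U: "open U" "x0 \<in> U" "U \<subseteq> S" "m > 0"
    and m: "\<And>x v. x \<in> U \<Longrightarrow> m * norm v \<le> norm (Z x v)"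
    using injective_family_lower_bound[OF assms(1-3) cont inj[OF assms(2)]] by metis
  define y0 where "y0 = linv (Z x0) (w x0)"
  define r where "r = (\<lambda>x. w x - Z x y0)"
  define r' where "r' = (\<lambda>v. w' v - Z' v)"
  have r': "(r has_derivative r') (at x0)"
    unfolding r_def r'_def by (intro has_derivative_diff w' Z'[folded y0_def])
  have r0: "r x0 = 0"
    using linear_inj_imp_inv(2)[OF lin inj] assms(2) by (simp add: r_def y0_def)
  have linr': "bounded_linear r'" using r' has_derivative_bounded_linear by blast
  define Q where "Q = linv (Z x0)"
  have linQ: "bounded_linear Q"
    using linear_inj_imp_inv(1)[OF lin[OF assms(2)] inj[OF assms(2)]] by (simp add: Q_def linear_conv_bounded_linear)
  have blQr: "bounded_linear (\<lambda>v. Q (r' v))"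
    using bounded_linear_compose[OF linQ linr'] .
  obtain K where K: "K > 0" "\<And>v. norm (Q (r' v)) \<le> norm v * K"
    using bounded_linear.pos_bounded[OF blQr] by blast
  define d where "d = (\<lambda>x. \<Sum>b\<in>Basis. norm (Z x b - Z x0 b))"
  have dcont: "continuous_on S d"
    unfolding d_def by (intro continuous_intros cont)
  have d0: "d x0 = 0" by (simp add: d_def)
  have dlim: "(d \<longlongrightarrow> 0) (at x0)"
    using continuous_on_eq_continuous_at[OF assms(1)] dcont assms(2) d0 isContD by fastforce
  have dest: "norm (Z x v - Z x0 v) \<le> norm v * d x" if x: "x \<in> S" for x v
    unfolding d_def
    by (rule linear_norm_le_basis[OF linear_compose_sub[OF lin[OF x] lin[OF assms(2)]]])
  have rlim: "((\<lambda>x. norm (r x - r' (x - x0)) / norm (x - x0)) \<longlongrightarrow> 0) (at x0)"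
    using r' r0 by (simp add: has_derivative_iff_norm)
  have est: "norm (norm (linv (Z x) (w x) - y0 - Q (r' (x - x0))) / norm (x - x0))
      \<le> (norm (r x - r' (x - x0)) / norm (x - x0) + K * d x) / m" if x: "x \<in> U" "x \<noteq> x0" for x
  proof -
    have xS: "x \<in> S" using x U by auto
    let ?e = "linv (Z x) (w x) - y0 - Q (r' (x - x0))"
    have "Z x ?e = w x - Z x y0 - Z x (Q (r' (x - x0)))"
      using linear_inj_imp_inv(2)[OF lin inj] xS by (simp add: linear_diff[OF lin])
    also have "\<dots> = (r x - r' (x - x0)) - (Z x (Q (r' (x - x0))) - Z x0 (Q (r' (x - x0))))"
      using linear_inj_imp_inv(2)[OF lin inj] assms(2) by (simp add: r_def Q_def)
    finally have "norm (Z x ?e) \<le> norm (r x - r' (x - x0)) + norm (Q (r' (x - x0))) * d x"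
      using norm_triangle_ineq4[of "r x - r' (x - x0)" "Z x (Q (r' (x - x0))) - Z x0 (Q (r' (x - x0)))"]
        dest[OF xS, of "Q (r' (x - x0))"] by simp
    also have "\<dots> \<le> norm (r x - r' (x - x0)) + norm (x - x0) * K * d x"
      using K(2) by (intro add_left_mono mult_right_mono) (auto simp: d_def sum_nonneg)
    finally have "m * norm ?e \<le> norm (r x - r' (x - x0)) + norm (x - x0) * K * d x"
      using m[OF x(1), of ?e] by linarith
    then show ?thesis using U(4) x(2) by (simp add: field_simps)
  qed
  have lim: "((\<lambda>x. (norm (r x - r' (x - x0)) / norm (x - x0) + K * d x) / m) \<longlongrightarrow> 0) (at x0)"
    by (rule tendsto_eq_intros rlim dlim refl)+ (use U(4) in auto)
  have ev: "\<forall>\<^sub>F x in at x0. x \<in> U \<and> x \<noteq> x0"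
    using U(1,2) by (simp add: eventually_at_topological) blast
  have "((\<lambda>x. norm (linv (Z x) (w x) - y0 - Q (r' (x - x0))) / norm (x - x0)) \<longlongrightarrow> 0) (at x0)"
    by (rule Lim_null_comparison[OF _ lim]) (use ev est in \<open>auto elim!: eventually_mono\<close>)
  then show ?thesis
    using blQr by (simp add: has_derivative_iff_norm y0_def Q_def r'_def)
qed

lemma continuous_on_inverse_family:
  fixes Z :: "'a::euclidean_space \<Rightarrow> 'f::euclidean_space \<Rightarrow> 'f"
  assumes "open S" and lin: "\<And>x. x \<in> S \<Longrightarrow> linear (Z x)" and inj: "\<And>x. x \<in> S \<Longrightarrow> inj (Z x)"
    and cont: "\<And>v. continuous_on S (\<lambda>x. Z x v)" and w: "continuous_on S w"
  shows "continuous_on S (\<lambda>x. linv (Z x) (w x))"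
proof (rule continuous_at_imp_continuous_on, rule ballI)
  fix x0 assume x0: "x0 \<in> S"
  obtain U m where U: "open U" "x0 \<in> U" "U \<subseteq> S" "m > 0"
    and m: "\<And>x v. x \<in> U \<Longrightarrow> m * norm v \<le> norm (Z x v)"
    using injective_family_lower_bound[OF assms(1) x0 lin cont inj[OF x0]] by metis
  define y0 where "y0 = linv (Z x0) (w x0)"
  have r0: "w x0 - Z x0 y0 = 0"
    using linear_inj_imp_inv(2)[OF lin inj] x0 by (simp add: y0_def)
  have "continuous_on S (\<lambda>x. norm (w x - Z x y0) / m)"
    by (intro continuous_intros w cont) (use U(4) in auto)
  then have lim: "((\<lambda>x. norm (w x - Z x y0) / m) \<longlongrightarrow> 0) (at x0)"
    using continuous_on_eq_continuous_at[OF assms(1)] x0 r0 isContD by fastforce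
  have est: "norm (linv (Z x) (w x) - y0) \<le> norm (w x - Z x y0) / m" if x: "x \<in> U" for x
  proof -
    have xS: "x \<in> S" using x U by auto
    have "Z x (linv (Z x) (w x) - y0) = w x - Z x y0"
      using linear_inj_imp_inv(2)[OF lin inj] xS by (simp add: linear_diff[OF lin])
    then show ?thesis
      using m[OF x, of "linv (Z x) (w x) - y0"] U(4) by (simp add: pos_le_divide_eq mult.commute)
  qed
  have ev: "\<forall>\<^sub>F x in at x0. x \<in> U"
    using U(1,2) by (simp add: eventually_at_topological) blast
  have "((\<lambda>x. linv (Z x) (w x) - y0) \<longlongrightarrow> 0) (at x0)"
    by (rule Lim_null_comparison[OF _ lim]) (use ev est in \<open>auto elim!: eventually_mono\<close>)
  then show "isCont (\<lambda>x. linv (Z x) (w x)) x0"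
    unfolding isCont_def y0_def[symmetric] using LIM_zero_iff by blast
qed

text \<open>The derivative of \<open>y = Z\<^sup>-\<^sup>1 w\<close> in direction \<open>v\<close> is \<open>Z\<^sup>-\<^sup>1 (w' v - Z' v y)\<close>. This has the same form
  as \<open>y\<close>, with data as regular as \<open>w'\<close>, \<open>Z'\<close> and \<open>y\<close>; so induction on the order works with the same
  order in hypothesis and conclusion.\<close>

lemma C_on_inverse_family:
  fixes Z :: "'a::euclidean_space \<Rightarrow> 'f::euclidean_space \<Rightarrow> 'f"
  assumes "open S" and lin: "\<And>x. x \<in> S \<Longrightarrow> linear (Z x)" and inj: "\<And>x. x \<in> S \<Longrightarrow> inj (Z x)"
    and "\<And>v. C_on k S (\<lambda>x. Z x v)" and "C_on k S w"
  shows "C_on k S (\<lambda>x. linv (Z x) (w x))"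
  using assms(4,5)
proof (induction k arbitrary: w)
  case 0
  then show ?case using continuous_on_inverse_family[OF assms(1-3)] by simp
next
  case (Suc k)
  define Z' where "Z' = (\<lambda>x v u. frechet_derivative (\<lambda>x. Z x u) (at x) v)"
  have Zk: "C_on k S (\<lambda>x. Z x v)" for v
    using C_on_pred[OF Suc.prems(1)] .
  have Z0: "continuous_on S (\<lambda>x. Z x v)" for v
    using C_on_SucD[OF Suc.prems(1)] has_derivative_continuous
    by (blast intro: continuous_at_imp_continuous_on)
  have Zd: "((\<lambda>x. Z x u) has_derivative (\<lambda>v. Z' x v u)) (at x)" if "x \<in> S" for x u
    unfolding Z'_def using C_on_SucD[OF Suc.prems(1) that] .
  have Z'lin: "linear (Z' x v)" if x: "x \<in> S" for x v
  proof -
    have add: "((\<lambda>x. Z x (p + q)) has_derivative (\<lambda>v. Z' x v p + Z' x v q)) (at x)" for p q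
      by (rule has_derivative_transform_within_open[OF has_derivative_add[OF Zd[OF x] Zd[OF x]] assms(1) x])
        (simp add: linear_add[OF lin])
    have scale: "((\<lambda>x. Z x (c *\<^sub>R p)) has_derivative (\<lambda>v. c *\<^sub>R Z' x v p)) (at x)" for c p
      by (rule has_derivative_transform_within_open[OF has_derivative_scaleR_right[OF Zd[OF x]] assms(1) x])
        (simp add: linear_scale[OF lin])
    show ?thesis
      using fun_cong[OF has_derivative_unique[OF Zd[OF x] add], of v]
        fun_cong[OF has_derivative_unique[OF Zd[OF x] scale], of v]
      by (intro linearI) simp_all
  qed
  have Z'k: "C_on k S (\<lambda>x. Z' x v u)" for u v
    unfolding Z'_def using Suc.prems(1) by simp
  have yk: "C_on k S (\<lambda>x. linv (Z x) (w x))" by (rule Suc.IH[OF Zk C_on_pred[OF Suc.prems(2)]])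
  have D: "((\<lambda>x. linv (Z x) (w x)) has_derivative
      (\<lambda>v. linv (Z x) (frechet_derivative w (at x) v - Z' x v (linv (Z x) (w x))))) (at x)"
    if x: "x \<in> S" for x
    by (rule has_derivative_inverse_family[OF assms(1) x lin inj Z0 Zd[OF x] C_on_SucD[OF Suc.prems(2) x]])
  show ?case
  proof (rule C_on_SucI[OF assms(1) D])
    fix v
    have "C_on k S (\<lambda>x. frechet_derivative w (at x) v + - Z' x v (linv (Z x) (w x)))"
      by (intro C_on_add[OF assms(1)] C_on_linear_compose[OF assms(1), where L = uminus]
          C_on_apply_linear[OF assms(1) Z'lin Z'k yk] bounded_linear_minus bounded_linear_ident)
        (use Suc.prems(2) in auto)
    then show "C_on k S (\<lambda>x. linv (Z x) (frechet_derivative w (at x) v - Z' x v (linv (Z x) (w x))))"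
      using Suc.IH[OF Zk] by simp
  qed
qed

lemma smooth_on_inverse_family:
  fixes Z :: "'a::euclidean_space \<Rightarrow> 'f::euclidean_space \<Rightarrow> 'f"
  assumes "open S" "\<And>x. x \<in> S \<Longrightarrow> linear (Z x)" "\<And>x. x \<in> S \<Longrightarrow> inj (Z x)"
    and "\<And>v. smooth_on S (\<lambda>x. Z x v)" and "smooth_on S w"
  shows "smooth_on S (\<lambda>x. linv (Z x) (w x))"
  using assms(4,5) unfolding smooth_on_def by (simp add: C_on_inverse_family[OF assms(1-3)])

section \<open>Autonomous ordinary differential equations\<close>

lemma has_vector_derivative_bound:
  fixes g :: "real \<Rightarrow> 'a::euclidean_space"
  assumes "\<And>t. t \<in> {a..b} \<Longrightarrow> (g has_vector_derivative g' t) (at t within {a..b})"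
    and "\<And>t. t \<in> {a..b} \<Longrightarrow> norm (g' t) \<le> M"
    and "s \<in> {a..b}" "t \<in> {a..b}"
  shows "norm (g s - g t) \<le> M * \<bar>s - t\<bar>"
proof -
  have "onorm (\<lambda>h. h *\<^sub>R g' t) \<le> M" if "t \<in> {a..b}" for t
    using assms(2)[OF that] by (intro onorm_le) (simp, metis abs_ge_zero mult.commute mult_left_mono)
  then show ?thesis
    using differentiable_bound[of "{a..b}" g "\<lambda>t h. h *\<^sub>R g' t" M s t] assms
    by (simp add: has_vector_derivative_def)
qed

lemma smooth_locally_lipschitz:
  fixes F :: "'a::euclidean_space \<Rightarrow> 'b::euclidean_space"
  assumes "open S" "smooth_on S F" "x0 \<in> S"
  obtains r L M where "r > 0" "L > 0" "M > 0" "cball x0 r \<subseteq> S"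
    "\<And>x y. x \<in> cball x0 r \<Longrightarrow> y \<in> cball x0 r \<Longrightarrow> norm (F x - F y) \<le> L * norm (x - y)"
    "\<And>x. x \<in> cball x0 r \<Longrightarrow> norm (F x) \<le> M"
proof -
  obtain r where r: "r > 0" "cball x0 r \<subseteq> S"
    using assms(1,3) open_contains_cball by blast
  define D where "D = (\<lambda>x. \<Sum>b\<in>Basis. norm (frechet_derivative F (at x) b))"
  have "continuous_on (cball x0 r) D"
    unfolding D_def
    by (intro continuous_intros continuous_on_subset[OF smooth_on_continuous_on r(2)]
        smooth_on_derivative assms(2))
  then have "bounded (D ` cball x0 r)"
    by (intro compact_imp_bounded compact_continuous_image) auto
  then obtain L where L: "L > 0" "\<And>x. x \<in> cball x0 r \<Longrightarrow> norm (D x) \<le> L"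
    unfolding bounded_pos by auto
  have "bounded (F ` cball x0 r)"
    by (intro compact_imp_bounded compact_continuous_image
        continuous_on_subset[OF smooth_on_continuous_on[OF assms(2)] r(2)]) auto
  then obtain M where M: "M > 0" "\<And>x. x \<in> cball x0 r \<Longrightarrow> norm (F x) \<le> M"
    unfolding bounded_pos by auto
  have on: "onorm (frechet_derivative F (at x)) \<le> L" if x: "x \<in> cball x0 r" for x
  proof (rule onorm_le)
    fix v
    have "x \<in> S" using x r by auto
    have "norm (frechet_derivative F (at x) v) \<le> norm v * D x"
      unfolding D_def
      by (rule linear_norm_le_basis[OF smooth_on_linear_derivative[OF assms(2) \<open>x \<in> S\<close>]])
    also have "\<dots> \<le> norm v * L" using L(2)[OF x] by (intro mult_left_mono) auto
    finally show "norm (frechet_derivative F (at x) v) \<le> L * norm v" by (simp add: mult.commute)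
  qed
  have "norm (F x - F y) \<le> L * norm (x - y)" if "x \<in> cball x0 r" "y \<in> cball x0 r" for x y
    by (rule differentiable_bound[OF convex_cball has_derivative_at_withinI on that])
      (use smooth_on_has_derivative[OF assms(2)] r(2) in blast)
  then show ?thesis using that r L(1) M by blast
qed

text \<open>Picard iteration on the bounded continuous functions with values in a ball around \<open>x0\<close>.
  Starting values near \<open>x0\<close> share one interval of existence.\<close>

lemma ode_existence:
  fixes F :: "'a::euclidean_space \<Rightarrow> 'a"
  assumes "open S" "smooth_on S F" "x0 \<in> S"
  obtains e \<delta> where "e > 0" "\<delta> > 0"
    "\<And>x1. x1 \<in> ball x0 \<delta> \<Longrightarrow> \<exists>x. x 0 = x1 \<and>
       (\<forall>t\<in>{-e<..<e}. x t \<in> S \<and> (x has_vector_derivative F (x t)) (at t))"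
proof -
  obtain r L M where r: "r > 0" "L > 0" "M > 0" "cball x0 r \<subseteq> S"
    and lip: "\<And>x y. x \<in> cball x0 r \<Longrightarrow> y \<in> cball x0 r \<Longrightarrow> norm (F x - F y) \<le> L * norm (x - y)"
    and bd: "\<And>x. x \<in> cball x0 r \<Longrightarrow> norm (F x) \<le> M"
    using smooth_locally_lipschitz[OF assms] by blast
  define e where "e = min (r / (2 * M)) (1 / (2 * L))"
  have e: "e > 0" "M * e \<le> r / 2" "L * e \<le> 1 / 2"
    using r by (auto simp: e_def min_def field_simps)
  have Fcont: "continuous_on (cball x0 r) F"
    using smooth_on_continuous_on[OF assms(2)] r(4) continuous_on_subset by blast
  have sol: "\<exists>x. x 0 = x1 \<and> (\<forall>t\<in>{-e<..<e}. x t \<in> S \<and> (x has_vector_derivative F (x t)) (at t))"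
    if x1: "x1 \<in> ball x0 (r/2)" for x1
  proof -
    define X :: "(real \<Rightarrow>\<^sub>C 'a) set" where "X = PiC UNIV (\<lambda>_. cball x0 r)"
    \<comment> \<open>Integrals start at the left end \<open>-e\<close>; subtracting \<open>G f 0\<close> moves the initial time to \<open>0\<close>.
      Times are clamped to the interval because the functions are defined on the whole line.\<close>
    define G where "G = (\<lambda>(f :: real \<Rightarrow>\<^sub>C 'a) t. integral {-e..t} (\<lambda>s. F (f s)))"
    have X: "f t \<in> cball x0 r" if "f \<in> X" for f t
      using that by (auto simp: X_def mem_PiC_iff)
    have G': "(G f has_vector_derivative F (f t)) (at t within {-e..e})" if "f \<in> X" "t \<in> {-e..e}" for f t
      unfolding G_def using that X[OF that(1)]
      by (intro integral_has_vector_derivative continuous_on_compose2[OF Fcont]) auto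
    have ex: "\<exists>g :: real \<Rightarrow>\<^sub>C 'a. \<forall>t. g t = x1 + G f (clamp (-e) e t) - G f 0" if "f \<in> X" for f
    proof -
      have "continuous_on {-e..e} (G f)"
        using has_vector_derivative_continuous[OF G'[OF that]] 
        unfolding continuous_on_eq_continuous_within by blast
      then have "continuous_on (cbox (-e) e) (\<lambda>t. x1 + G f t - G f 0)"
        by (intro continuous_intros) simp
      then show ?thesis by (rule continuous_on_cbox_bcontfunE) blast
    qed
    define T where "T = (\<lambda>f. SOME g :: real \<Rightarrow>\<^sub>C 'a. \<forall>t. g t = x1 + G f (clamp (-e) e t) - G f 0)"
    have T: "T f t = x1 + G f (clamp (-e) e t) - G f 0" if "f \<in> X" for f t
      using someI_ex[OF ex[OF that]] by (simp add: T_def)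
    have cl: "clamp (-e) e t \<in> {-e..e}" for t :: real
      using clamp_in_interval[of "-e" e t] e(1) by simp
    have zero: "0 \<in> {-e..e}" using e by simp
    have maps: "T ` X \<subseteq> X"
    proof
      fix h assume "h \<in> T ` X"
      then obtain f where f: "f \<in> X" "h = T f" by blast
      have "dist x0 (h t) \<le> r" for t
      proof -
        let ?s = "clamp (-e) e t"
        have "norm (G f ?s - G f 0) \<le> M * \<bar>?s - 0\<bar>"
          by (rule has_vector_derivative_bound[OF G'[OF f(1)] bd[OF X[OF f(1)]] cl zero])
        also have "\<dots> \<le> M * e" using cl[of t] r by (intro mult_left_mono) auto
        finally have "norm (G f ?s - G f 0) \<le> r / 2" using e by simp
        moreover have "norm (x0 - h t) \<le> norm (x0 - x1) + norm (G f ?s - G f 0)"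
          using norm_triangle_ineq4[of "x0 - x1" "G f ?s - G f 0"] by (simp add: f T algebra_simps)
        ultimately show ?thesis using x1 by (simp add: dist_norm)
      qed
      then show "h \<in> X" by (simp add: X_def mem_PiC_iff)
    qed
    have contr: "dist (T f) (T h) \<le> 1/2 * dist f h" if fh: "f \<in> X" "h \<in> X" for f h
    proof (rule dist_bound)
      fix t
      let ?s = "clamp (-e) e t"
      have "norm ((G f ?s - G h ?s) - (G f 0 - G h 0)) \<le> (L * dist f h) * \<bar>?s - 0\<bar>"
      proof (rule has_vector_derivative_bound[OF _ _ cl zero])
        show "((\<lambda>t. G f t - G h t) has_vector_derivative F (f t) - F (h t)) (at t within {-e..e})"
          if "t \<in> {-e..e}" for t
          using G'[OF fh(1) that] G'[OF fh(2) that] by (rule has_vector_derivative_diff)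
        show "norm (F (f t) - F (h t)) \<le> L * dist f h" for t
        proof -
          have "norm (f t - h t) \<le> dist f h" using dist_bounded[of f t h] unfolding dist_norm[of "f t"] .
          then have "L * norm (f t - h t) \<le> L * dist f h" using r(2) by (intro mult_left_mono) auto
          then show ?thesis using lip[OF X[OF fh(1)] X[OF fh(2)], of t t] by linarith
        qed
      qed
      also have "\<dots> \<le> (L * dist f h) * e"
        using cl[of t] r(2) by (intro mult_left_mono) auto
      also have "\<dots> \<le> 1/2 * dist f h"
        using mult_right_mono[OF e(3), of "dist f h"] by (simp add: algebra_simps)
      finally show "dist (T f t) (T h t) \<le> 1/2 * dist f h"
        by (simp add: T fh dist_norm algebra_simps)
    qed
    have "const_bcontfun x0 \<in> X" using r(1) by (auto simp: X_def mem_PiC_iff const_bcontfun.rep_eq)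
    then have "X \<noteq> {}" by blast
    moreover have "complete X" 
      unfolding X_def complete_eq_closed by (rule closed_PiC) auto
    ultimately obtain f where f: "f \<in> X" "T f = f"
      using Banach_fix[of X "1/2" T] maps contr by auto
    have fG: "f t = x1 + G f t - G f 0" if "t \<in> {-e..e}" for t
      using T[OF f(1), of t] f(2) that by (simp add: clamp_cancel_cbox)
    have "(f has_vector_derivative F (f t)) (at t)" if t: "t \<in> {-e<..<e}" for t
    proof -
      have "(G f has_vector_derivative F (f t)) (at t)"
        using G'[OF f(1), of t] t at_within_Icc_at[of "-e" t e] by simp
      then have "((\<lambda>t. x1 + G f t - G f 0) has_vector_derivative F (f t)) (at t)"
        by (auto intro!: derivative_eq_intros)
      then show ?thesis
        by (rule has_vector_derivative_transform_within_open[OF _ open_greaterThanLessThan t])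
          (use fG in auto)
    qed
    moreover have "f 0 = x1" using fG[OF zero] by simp
    moreover have "f t \<in> S" for t using X[OF f(1), of t] r(4) by blast
    ultimately show ?thesis by (intro exI[of _ "apply_bcontfun f"]) auto
  qed
  show ?thesis by (rule that[OF e(1), of "r/2"]) (use r sol in auto)
qed

text \<open>On an interval of length less than \<open>1 / L\<close> around \<open>t1\<close> the largest distance of two
  solutions is at most half of itself.\<close>

lemma ode_local_uniqueness:
  fixes F :: "'a::euclidean_space \<Rightarrow> 'a"
  assumes "open S" "smooth_on S F" "open J" "t1 \<in> J"
    and x: "\<And>t. t \<in> J \<Longrightarrow> x t \<in> S \<and> (x has_vector_derivative F (x t)) (at t)"
    and y: "\<And>t. t \<in> J \<Longrightarrow> y t \<in> S \<and> (y has_vector_derivative F (y t)) (at t)"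
    and "x t1 = y t1"
  obtains d where "d > 0" "\<And>t. \<bar>t - t1\<bar> < d \<Longrightarrow> t \<in> J \<and> x t = y t"
proof -
  obtain r L M where r: "r > 0" "L > 0" 
    and lip: "\<And>p q. p \<in> cball (x t1) r \<Longrightarrow> q \<in> cball (x t1) r \<Longrightarrow> norm (F p - F q) \<le> L * norm (p - q)"
    using smooth_locally_lipschitz[OF assms(1,2), of "x t1"] x assms(4) by metis
  have cont: "continuous_on J x" "continuous_on J y"
    using x y has_vector_derivative_continuous by (blast intro: continuous_at_imp_continuous_on)+
  have "open (J \<inter> x -` ball (x t1) r)" "open (J \<inter> y -` ball (x t1) r)"
    using continuous_open_preimage[OF cont(1) assms(3)] continuous_open_preimage[OF cont(2) assms(3)] by auto
  then have "open ((J \<inter> x -` ball (x t1) r) \<inter> (J \<inter> y -` ball (x t1) r))" by (rule open_Int)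
  moreover have "t1 \<in> (J \<inter> x -` ball (x t1) r) \<inter> (J \<inter> y -` ball (x t1) r)"
    using assms(4,7) r by simp
  ultimately obtain d0 where d0: "d0 > 0"
    "cball t1 d0 \<subseteq> (J \<inter> x -` ball (x t1) r) \<inter> (J \<inter> y -` ball (x t1) r)"
    using open_contains_cball by metis
  define d where "d = min d0 (1 / (2 * L))"
  have d: "d > 0" "L * d \<le> 1 / 2" "d \<le> d0" using d0 r by (auto simp: d_def min_def field_simps)
  define K where "K = {t1 - d..t1 + d}"
  have K: "t \<in> J \<and> x t \<in> cball (x t1) r \<and> y t \<in> cball (x t1) r" if "t \<in> K" for t
  proof -
    have "t \<in> cball t1 d0" using that d by (auto simp: K_def dist_real_def)
    then show ?thesis using d0(2) by auto
  qed
  have "continuous_on K (\<lambda>t. norm (x t - y t))"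
    using K by (intro continuous_intros continuous_on_subset[OF cont(1)] continuous_on_subset[OF cont(2)]) auto
  moreover have "compact K" "K \<noteq> {}" using d by (auto simp: K_def)
  ultimately obtain s where s: "s \<in> K" "\<And>t. t \<in> K \<Longrightarrow> norm (x t - y t) \<le> norm (x s - y s)"
    using continuous_attains_sup[of K "\<lambda>t. norm (x t - y t)"] by blast
  have "norm ((x s - y s) - (x t1 - y t1)) \<le> (L * norm (x s - y s)) * \<bar>s - t1\<bar>"
  proof (rule has_vector_derivative_bound[where g = "\<lambda>t. x t - y t" and g' = "\<lambda>t. F (x t) - F (y t)"
        and a = "t1 - d" and b = "t1 + d"])
    fix t assume t: "t \<in> {t1 - d..t1 + d}"
    then have tK: "t \<in> K" by (simp add: K_def)
    show "((\<lambda>t. x t - y t) has_vector_derivative F (x t) - F (y t)) (at t within {t1 - d..t1 + d})"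
      by (rule has_vector_derivative_at_within[OF has_vector_derivative_diff[OF conjunct2[OF x] conjunct2[OF y]]])
        (use K[OF tK] in auto)
    have "norm (F (x t) - F (y t)) \<le> L * norm (x t - y t)" using lip K[OF tK] by blast
    also have "\<dots> \<le> L * norm (x s - y s)" using s(2)[OF tK] r by (intro mult_left_mono) auto
    finally show "norm (F (x t) - F (y t)) \<le> L * norm (x s - y s)" .
  qed (use s(1) d in \<open>auto simp: K_def\<close>)
  also have "\<dots> \<le> (L * norm (x s - y s)) * d"
    using s(1) r by (intro mult_left_mono) (auto simp: K_def)
  also have "\<dots> \<le> 1/2 * norm (x s - y s)"
    using mult_right_mono[OF d(2), of "norm (x s - y s)"] by (simp add: algebra_simps)
  finally have "norm (x s - y s) \<le> 0" using assms(7) by simp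
  then have eq: "t \<in> J \<and> x t = y t" if "t \<in> K" for t
    using s(2)[OF that] K[OF that] by (metis eq_iff_diff_eq_0 norm_le_zero_iff order_trans)
  show ?thesis by (rule that[OF d(1), OF eq]) (auto simp: K_def)
qed

text \<open>A solution of class \<open>C\<^sup>k\<close> has the derivative \<open>F \<circ> x\<close> of class \<open>C\<^sup>k\<close>, hence is of class
  \<open>C\<^sup>k\<^sup>+\<^sup>1\<close>.\<close>

lemma ode_solution_smooth:
  fixes F :: "'a::euclidean_space \<Rightarrow> 'a"
  assumes "open S" "smooth_on S F" "open J"
    and x: "\<And>t. t \<in> J \<Longrightarrow> x t \<in> S \<and> (x has_vector_derivative F (x t)) (at t)"
  shows "smooth_on J x"
  unfolding smooth_on_def
proof
  fix k show "C_on k J x"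
  proof (induction k)
    case 0
    have "isCont x t" if "t \<in> J" for t
      using x[OF that] has_vector_derivative_continuous by blast
    then show ?case by (simp add: continuous_at_imp_continuous_on)
  next
    case (Suc k)
    show ?case
    proof (rule C_on_SucI[OF assms(3)])
      show "(x has_derivative (\<lambda>h. h *\<^sub>R F (x t))) (at t)" if "t \<in> J" for t
        using x[OF that] by (simp add: has_vector_derivative_def)
      show "C_on k J (\<lambda>t. v *\<^sub>R F (x t))" for v
        using x by (intro C_on_linear_compose[OF assms(3) bounded_linear_scaleR_right]
            C_on_compose[OF assms(3,1) Suc smooth_onD[OF assms(2)]]) auto
    qed
  qed
qed

section \<open>Charts\<close>

context smooth_manifold
begin

lemma chart_subset: "(U, \<phi>) \<in> A \<Longrightarrow> U \<subseteq> topspace X"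
  using chart_openin openin_subset by blast

lemma chart_ex:
  assumes "p \<in> topspace X"
  obtains U \<phi> where "(U, \<phi>) \<in> A" "p \<in> U"
proof -
  obtain x where "x \<in> A" "p \<in> fst x" using assms unfolding charts_cover[symmetric] by blast
  then show ?thesis using that[of "fst x" "snd x"] by simp
qed

lemma chart_inj:
  assumes "(U, \<phi>) \<in> A"
  shows "inj_on \<phi> U"
  using homeomorphic_imp_injective_map[OF chart_homeo[OF assms]] chart_subset[OF assms]
  by (simp add: Int_absorb1)

lemma chart_inv: "(U, \<phi>) \<in> A \<Longrightarrow> p \<in> U \<Longrightarrow> inv_into U \<phi> (\<phi> p) = p"
  using chart_inj inv_into_f_f by metis

lemma chart_open_image_subset:
  assumes "(U, \<phi>) \<in> A" "openin X W" "W \<subseteq> U"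
  shows "open (\<phi> ` W)"
proof -
  have "openin (subtopology X U) W"
    using assms by (simp add: openin_subtopology) (use assms in blast)
  then have "openin (top_of_set (\<phi> ` U)) (\<phi> ` W)"
    using homeomorphic_imp_open_map[OF chart_homeo[OF assms(1)]] by (simp add: open_map_def)
  then show ?thesis
    using chart_open_image[OF assms(1)] openin_open_trans by blast
qed

lemma chart_openin_vimage:
  assumes "(U, \<phi>) \<in> A" "open O1"
  shows "openin X {p \<in> U. \<phi> p \<in> O1}"
proof -
  have "continuous_map (subtopology X U) (top_of_set (\<phi> ` U)) \<phi>"
    by (rule homeomorphic_imp_continuous_map[OF chart_homeo[OF assms(1)]])
  then have "continuous_map (subtopology X U) euclidean \<phi>"
    by (simp add: continuous_map_in_subtopology)
  then have "openin (subtopology X U) {p \<in> topspace (subtopology X U). \<phi> p \<in> O1}"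
    using assms(2) openin_continuous_map_preimage open_openin by blast
  then have "openin X {p \<in> topspace (subtopology X U). \<phi> p \<in> O1}"
    using chart_openin[OF assms(1)] openin_trans_full by blast
  then show ?thesis using chart_subset[OF assms(1)] by (simp add: Int_absorb1)
qed

lemma chart_open_vimage_inv:
  assumes "(U, \<phi>) \<in> A" "openin X W"
  shows "open {y \<in> \<phi> ` U. inv_into U \<phi> y \<in> W}"
proof -
  have "{y \<in> \<phi> ` U. inv_into U \<phi> y \<in> W} = \<phi> ` (U \<inter> W)"
    using chart_inv[OF assms(1)] by auto
  then show ?thesis
    using chart_open_image_subset[OF assms(1), of "U \<inter> W"] chart_openin[OF assms(1)] assms(2) by auto
qed

end

section \<open>Maps differentiable at a point\<close>

text \<open>A pointwise notion suffices for tangent maps to compose, and it is what a local section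
  differentiable at one point yields for the action on the quotient. Continuity is required
  separately: without it \<open>f\<close> may leave the chart \<open>V\<close> arbitrarily close to \<open>p\<close>, and its coordinate
  expression then says nothing about \<open>f\<close>.\<close>

definition mdiff ::
  "'a topology \<Rightarrow> ('a, 'e::euclidean_space) chart set \<Rightarrow>
   'b topology \<Rightarrow> ('b, 'f::euclidean_space) chart set \<Rightarrow> ('a \<Rightarrow> 'b) \<Rightarrow> 'a \<Rightarrow> bool"
  where "mdiff X A Y B f p \<longleftrightarrow> p \<in> topspace X \<and> f p \<in> topspace Y \<and>
    (\<forall>W. openin Y W \<and> f p \<in> W \<longrightarrow> (\<exists>N. openin X N \<and> p \<in> N \<and> f ` N \<subseteq> W)) \<and>
    (\<forall>U \<phi> V \<psi>. (U, \<phi>) \<in> A \<and> p \<in> U \<and> (V, \<psi>) \<in> B \<and> f p \<in> V \<longrightarrow>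
      (\<psi> \<circ> f \<circ> inv_into U \<phi>) differentiable at (\<phi> p))"

lemma mdiffD:
  assumes "mdiff X A Y B f p"
  shows "p \<in> topspace X" "f p \<in> topspace Y"
    "\<And>U \<phi> V \<psi>. (U, \<phi>) \<in> A \<Longrightarrow> p \<in> U \<Longrightarrow> (V, \<psi>) \<in> B \<Longrightarrow> f p \<in> V \<Longrightarrow>
      (\<psi> \<circ> f \<circ> inv_into U \<phi>) differentiable at (\<phi> p)"
  using assms unfolding mdiff_def by auto

lemma mdiff_nbhd:
  assumes "mdiff X A Y B f p" "openin Y W" "f p \<in> W"
  obtains N where "openin X N" "p \<in> N" "f ` N \<subseteq> W"
proof -
  have "\<forall>W. openin Y W \<and> f p \<in> W \<longrightarrow> (\<exists>N. openin X N \<and> p \<in> N \<and> f ` N \<subseteq> W)"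
    using assms(1) by (simp add: mdiff_def)
  then show ?thesis using assms(2,3) that by meson
qed

lemma mdiffI:
  assumes "p \<in> topspace X" "f p \<in> topspace Y"
    and "\<And>W. openin Y W \<Longrightarrow> f p \<in> W \<Longrightarrow> \<exists>N. openin X N \<and> p \<in> N \<and> f ` N \<subseteq> W"
    and "\<And>U \<phi> V \<psi>. (U, \<phi>) \<in> A \<Longrightarrow> p \<in> U \<Longrightarrow> (V, \<psi>) \<in> B \<Longrightarrow> f p \<in> V \<Longrightarrow>
      (\<psi> \<circ> f \<circ> inv_into U \<phi>) differentiable at (\<phi> p)"
  shows "mdiff X A Y B f p"
  unfolding mdiff_def using assms by (intro conjI allI impI) auto

lemma continuous_map_nbhd:
  assumes "continuous_map X Y f" "p \<in> topspace X"
  shows "f p \<in> topspace Y"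
    "openin Y W \<and> f p \<in> W \<longrightarrow> (\<exists>N. openin X N \<and> p \<in> N \<and> f ` N \<subseteq> W)"
proof -
  show "f p \<in> topspace Y" using assms by (auto simp: continuous_map_def)
  show "openin Y W \<and> f p \<in> W \<longrightarrow> (\<exists>N. openin X N \<and> p \<in> N \<and> f ` N \<subseteq> W)"
  proof
    assume W: "openin Y W \<and> f p \<in> W"
    have "openin X {x \<in> topspace X. f x \<in> W}"
      using assms W openin_continuous_map_preimage by blast
    then show "\<exists>N. openin X N \<and> p \<in> N \<and> f ` N \<subseteq> W"
      using W assms(2) by (intro exI[of _ "{x \<in> topspace X. f x \<in> W}"] conjI) auto
  qed
qed

lemma smooth_map_mdiff:
  assumes "smooth_map X A Y B f" "p \<in> topspace X"
  shows "mdiff X A Y B f p"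
proof -
  have c: "continuous_map X Y f" using assms(1) by (simp add: smooth_map_def)
  have "(\<psi> \<circ> f \<circ> inv_into U \<phi>) differentiable at (\<phi> p)"
    if "(U, \<phi>) \<in> A" "p \<in> U" "(V, \<psi>) \<in> B" "f p \<in> V" for U \<phi> V \<psi>
  proof (rule smooth_on_differentiable)
    show "smooth_on (\<phi> ` {x \<in> U. f x \<in> V}) (\<psi> \<circ> f \<circ> inv_into U \<phi>)"
      using assms(1) that unfolding smooth_map_def by blast
  qed (use that in auto)
  then show ?thesis
    using continuous_map_nbhd[OF c assms(2)] assms(2) unfolding mdiff_def by blast
qed

lemma (in smooth_manifold) mdiff_id:
  assumes "p \<in> topspace X"
  shows "mdiff X A X A id p"
proof -
  have "(\<psi> \<circ> id \<circ> inv_into U \<phi>) differentiable at (\<phi> p)"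
    if "(U, \<phi>) \<in> A" "p \<in> U" "(V, \<psi>) \<in> A" "p \<in> V" for U \<phi> V \<psi>
    using smooth_on_differentiable[OF charts_compatible[OF that(1,3)], of "\<phi> p"] that(2,4) by auto
  then show ?thesis using assms unfolding mdiff_def by auto
qed

lemma (in smooth_manifold) mdiff_cong:
  assumes "mdiff X A Y B f p" "openin X N" "p \<in> N" "\<And>x. x \<in> N \<Longrightarrow> f x = g x"
  shows "mdiff X A Y B g p"
    and "(U, \<phi>) \<in> A \<Longrightarrow> p \<in> U \<Longrightarrow> (V, \<psi>) \<in> B \<Longrightarrow> f p \<in> V \<Longrightarrow>
      frechet_derivative (\<psi> \<circ> g \<circ> inv_into U \<phi>) (at (\<phi> p)) =
      frechet_derivative (\<psi> \<circ> f \<circ> inv_into U \<phi>) (at (\<phi> p))"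
proof -
  have fg: "f p = g p" using assms by simp
  have loc: "(\<psi> \<circ> g \<circ> inv_into U \<phi>) differentiable at (\<phi> p) \<and>
      frechet_derivative (\<psi> \<circ> g \<circ> inv_into U \<phi>) (at (\<phi> p)) =
      frechet_derivative (\<psi> \<circ> f \<circ> inv_into U \<phi>) (at (\<phi> p))"
    if c: "(U, \<phi>) \<in> A" "p \<in> U" "(V, \<psi>) \<in> B" "f p \<in> V" for U \<phi> V and \<psi>
  proof -
    let ?O = "{y \<in> \<phi> ` U. inv_into U \<phi> y \<in> N}"
    have d: "(\<psi> \<circ> f \<circ> inv_into U \<phi> has_derivative frechet_derivative (\<psi> \<circ> f \<circ> inv_into U \<phi>) (at (\<phi> p))) (at (\<phi> p))"
      using mdiffD(3)[OF assms(1) c] frechet_derivative_works by blast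
    have "(\<psi> \<circ> g \<circ> inv_into U \<phi> has_derivative frechet_derivative (\<psi> \<circ> f \<circ> inv_into U \<phi>) (at (\<phi> p))) (at (\<phi> p))"
      by (rule has_derivative_transform_within_open[OF d chart_open_vimage_inv[OF c(1) assms(2)]])
        (use c chart_inv[OF c(1)] assms(3,4) in auto)
    then show ?thesis using frechet_derivative_at differentiable_def by metis
  qed
  show "(U, \<phi>) \<in> A \<Longrightarrow> p \<in> U \<Longrightarrow> (V, \<psi>) \<in> B \<Longrightarrow> f p \<in> V \<Longrightarrow>
      frechet_derivative (\<psi> \<circ> g \<circ> inv_into U \<phi>) (at (\<phi> p)) =
      frechet_derivative (\<psi> \<circ> f \<circ> inv_into U \<phi>) (at (\<phi> p))"
    using loc by blast
  have "\<exists>N'. openin X N' \<and> p \<in> N' \<and> g ` N' \<subseteq> W" if W: "openin Y W" "g p \<in> W" for W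
  proof -
    obtain N' where N': "openin X N'" "p \<in> N'" "f ` N' \<subseteq> W"
      using mdiff_nbhd[OF assms(1) W(1)] W(2) fg by auto
    show ?thesis
      using N' assms(2-4) by (intro exI[of _ "N \<inter> N'"]) (auto simp: image_subset_iff)
  qed
  then show "mdiff X A Y B g p"
    using loc mdiffD(1,2)[OF assms(1)] fg unfolding mdiff_def by metis
qed

text \<open>By continuity of \<open>f\<close> at \<open>p\<close>, the coordinate expression of the composition agrees near \<open>p\<close> with the
  composition of the coordinate expressions through the middle chart. With the identity for one of
  the maps this also gives the rules for changing charts.\<close>

lemma coord_chain_rule:
  assumes "smooth_manifold X A" "smooth_manifold Y B"
    and f: "mdiff X A Y B f p" and h: "mdiff Y B Z C h (f p)"
    and U: "(U, \<phi>) \<in> A" "p \<in> U" and V: "(V, \<psi>) \<in> B" "f p \<in> V" and W: "(W, \<omega>) \<in> C" "h (f p) \<in> W"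
  shows "(\<omega> \<circ> (h \<circ> f) \<circ> inv_into U \<phi> has_derivative
      frechet_derivative (\<omega> \<circ> h \<circ> inv_into V \<psi>) (at (\<psi> (f p))) \<circ>
      frechet_derivative (\<psi> \<circ> f \<circ> inv_into U \<phi>) (at (\<phi> p))) (at (\<phi> p))"
proof -
  interpret M: smooth_manifold X A by fact
  interpret N: smooth_manifold Y B by fact
  obtain N where N: "openin X N" "p \<in> N" "f ` N \<subseteq> V"
    using mdiff_nbhd[OF f N.chart_openin[OF V(1)] V(2)] by blast
  let ?O = "{y \<in> \<phi> ` U. inv_into U \<phi> y \<in> N}"
  have p: "inv_into U \<phi> (\<phi> p) = p" by (rule M.chart_inv[OF U])
  have df: "(\<psi> \<circ> f \<circ> inv_into U \<phi> has_derivative frechet_derivative (\<psi> \<circ> f \<circ> inv_into U \<phi>) (at (\<phi> p))) (at (\<phi> p))"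
    using mdiffD(3)[OF f U V] frechet_derivative_works by blast
  have dh: "(\<omega> \<circ> h \<circ> inv_into V \<psi> has_derivative frechet_derivative (\<omega> \<circ> h \<circ> inv_into V \<psi>) (at (\<psi> (f p)))) (at ((\<psi> \<circ> f \<circ> inv_into U \<phi>) (\<phi> p)))"
    using mdiffD(3)[OF h V W] frechet_derivative_works p by auto
  show ?thesis
    by (rule has_derivative_transform_within_open[OF diff_chain_at[OF df dh] M.chart_open_vimage_inv[OF U(1) N(1)]])
      (use U N(2,3) p N.chart_inv[OF V(1)] in auto)
qed

lemma mdiff_compose:
  assumes "smooth_manifold X A" "smooth_manifold Y B"
    and f: "mdiff X A Y B f p" and h: "mdiff Y B Z C h (f p)"
  shows "mdiff X A Z C (h \<circ> f) p"
proof -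
  interpret N: smooth_manifold Y B by fact
  obtain V \<psi> where V: "(V, \<psi>) \<in> B" "f p \<in> V" using N.chart_ex[OF mdiffD(2)[OF f]] .
  have d: "(\<omega> \<circ> (h \<circ> f) \<circ> inv_into U \<phi>) differentiable at (\<phi> p)"
    if "(U, \<phi>) \<in> A" "p \<in> U" "(W, \<omega>) \<in> C" "(h \<circ> f) p \<in> W" for U \<phi> W \<omega>
    using coord_chain_rule[OF assms(1-4) that(1,2) V that(3)] that(4) differentiableI by fastforce
  have n: "\<exists>N. openin X N \<and> p \<in> N \<and> (h \<circ> f) ` N \<subseteq> W" if W: "openin Z W" "(h \<circ> f) p \<in> W" for W
  proof -
    obtain O1 where O1: "openin Y O1" "f p \<in> O1" "h ` O1 \<subseteq> W"
      using mdiff_nbhd[OF h W(1)] W(2) by auto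
    obtain N where N: "openin X N" "p \<in> N" "f ` N \<subseteq> O1" using mdiff_nbhd[OF f O1(1,2)] .
    show ?thesis using N O1(3) by (intro exI[of _ N]) auto
  qed
  show ?thesis
    by (rule mdiffI) (use mdiffD(1)[OF f] mdiffD(2)[OF h] n d in auto)
qed

section \<open>Tangent vectors in coordinates\<close>

lemma tangent_spaceD:
  "v \<in> tangent_space A p \<Longrightarrow> (U, \<phi>) \<in> A \<Longrightarrow> p \<in> U \<Longrightarrow> (V, \<psi>) \<in> A \<Longrightarrow> p \<in> V \<Longrightarrow>
     v (V, \<psi>) = frechet_derivative (\<psi> \<circ> inv_into U \<phi>) (at (\<phi> p)) (v (U, \<phi>))"
  unfolding tangent_space_def by blast

lemma tangent_spaceI:
  assumes "\<And>U \<phi> V \<psi>. (U, \<phi>) \<in> A \<Longrightarrow> p \<in> U \<Longrightarrow> (V, \<psi>) \<in> A \<Longrightarrow> p \<in> V \<Longrightarrow>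
      v (V, \<psi>) = frechet_derivative (\<psi> \<circ> inv_into U \<phi>) (at (\<phi> p)) (v (U, \<phi>))"
    and "\<And>U \<phi>. \<not> ((U, \<phi>) \<in> A \<and> p \<in> U) \<Longrightarrow> v (U, \<phi>) = 0"
  shows "v \<in> tangent_space A p"
  unfolding tangent_space_def using assms by fast

lemma tangent_space_outside:
  "v \<in> tangent_space A p \<Longrightarrow> \<not> ((U, \<phi>) \<in> A \<and> p \<in> U) \<Longrightarrow> v (U, \<phi>) = 0"
  unfolding tangent_space_def by blast

lemma tangent_space_eqI:
  assumes "v \<in> tangent_space A p" "w \<in> tangent_space A p" "(U, \<phi>) \<in> A" "p \<in> U" "v (U, \<phi>) = w (U, \<phi>)"
  shows "v = w"
proof -
  have "v (V, \<psi>) = w (V, \<psi>)" for V \<psi>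
  proof (cases "(V, \<psi>) \<in> A \<and> p \<in> V")
    case True
    then show ?thesis using tangent_spaceD[OF assms(1,3,4)] tangent_spaceD[OF assms(2,3,4)] assms(5) by simp
  next
    case False
    then show ?thesis using tangent_space_outside[OF assms(1)] tangent_space_outside[OF assms(2)] by metis
  qed
  then show ?thesis by (simp add: fun_eq_iff)
qed

text \<open>The chart selected in the definition of the tangent map may be replaced by any other.\<close>

lemma tangent_map_coord:
  assumes "smooth_manifold X A" "mdiff X A Y B f p" "v \<in> tangent_space A p"
    and U: "(U, \<phi>) \<in> A" "p \<in> U" and V: "(V, \<psi>) \<in> B" "f p \<in> V"
  shows "tangent_map A B f p v (V, \<psi>) = frechet_derivative (\<psi> \<circ> f \<circ> inv_into U \<phi>) (at (\<phi> p)) (v (U, \<phi>))"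
proof -
  interpret M: smooth_manifold X A by fact
  have ex: "\<exists>x. case x of (U, \<phi>) \<Rightarrow> (U, \<phi>) \<in> A \<and> p \<in> U" using U by auto
  obtain U1 \<phi>1 where s: "(SOME (U, \<phi>). (U, \<phi>) \<in> A \<and> p \<in> U) = (U1, \<phi>1)" by fastforce
  then have U1: "(U1, \<phi>1) \<in> A" "p \<in> U1" using someI_ex[OF ex] by auto
  have "(\<psi> \<circ> (f \<circ> id) \<circ> inv_into U \<phi> has_derivative
      frechet_derivative (\<psi> \<circ> f \<circ> inv_into U1 \<phi>1) (at (\<phi>1 (id p))) \<circ>
      frechet_derivative (\<phi>1 \<circ> id \<circ> inv_into U \<phi>) (at (\<phi> p))) (at (\<phi> p))"
    by (rule coord_chain_rule[OF assms(1,1) M.mdiff_id]) (use mdiffD(1)[OF assms(2)] assms(2) U U1 V in auto)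
  then have "frechet_derivative (\<psi> \<circ> f \<circ> inv_into U \<phi>) (at (\<phi> p)) =
      frechet_derivative (\<psi> \<circ> f \<circ> inv_into U1 \<phi>1) (at (\<phi>1 p)) \<circ>
      frechet_derivative (\<phi>1 \<circ> inv_into U \<phi>) (at (\<phi> p))"
    using frechet_derivative_at by fastforce
  then show ?thesis
    using tangent_spaceD[OF assms(3) U U1] V by (simp add: tangent_map_def s)
qed

lemma tangent_map_outside:
  "\<not> ((V, \<psi>) \<in> B \<and> f p \<in> V) \<Longrightarrow> tangent_map A B f p v (V, \<psi>) = 0"
  by (auto simp: tangent_map_def split: prod.splits)

lemma tangent_map_in:
  assumes "smooth_manifold X A" "smooth_manifold Y B" "mdiff X A Y B f p" "v \<in> tangent_space A p"
  shows "tangent_map A B f p v \<in> tangent_space B (f p)"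
proof -
  interpret M: smooth_manifold X A by fact
  interpret N: smooth_manifold Y B by fact
  obtain U \<phi> where U: "(U, \<phi>) \<in> A" "p \<in> U" using M.chart_ex[OF mdiffD(1)[OF assms(3)]] .
  have "tangent_map A B f p v (W, \<omega>) =
      frechet_derivative (\<omega> \<circ> inv_into V \<psi>) (at (\<psi> (f p))) (tangent_map A B f p v (V, \<psi>))"
    if V: "(V, \<psi>) \<in> B" "f p \<in> V" and W: "(W, \<omega>) \<in> B" "f p \<in> W" for V \<psi> W \<omega>
  proof -
    have "(\<omega> \<circ> (id \<circ> f) \<circ> inv_into U \<phi> has_derivative
        frechet_derivative (\<omega> \<circ> id \<circ> inv_into V \<psi>) (at (\<psi> (f p))) \<circ>
        frechet_derivative (\<psi> \<circ> f \<circ> inv_into U \<phi>) (at (\<phi> p))) (at (\<phi> p))"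
      by (rule coord_chain_rule[OF assms(1-3) N.mdiff_id[OF mdiffD(2)[OF assms(3)]] U V W(1)])
        (use W(2) in simp)
    then have "frechet_derivative (\<omega> \<circ> f \<circ> inv_into U \<phi>) (at (\<phi> p)) =
      frechet_derivative (\<omega> \<circ> inv_into V \<psi>) (at (\<psi> (f p))) \<circ>
      frechet_derivative (\<psi> \<circ> f \<circ> inv_into U \<phi>) (at (\<phi> p))"
      using frechet_derivative_at by fastforce
    then show ?thesis
      by (simp add: tangent_map_coord[OF assms(1,3,4) U V] tangent_map_coord[OF assms(1,3,4) U W])
  qed
  then show ?thesis
    unfolding tangent_space_def using tangent_map_outside[of _ _ B f p A v] by auto
qed

lemma tangent_map_compose:
  assumes "smooth_manifold X A" "smooth_manifold Y B" "smooth_manifold Z C"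
    and f: "mdiff X A Y B f p" and h: "mdiff Y B Z C h (f p)" and v: "v \<in> tangent_space A p"
  shows "tangent_map A C (h \<circ> f) p v = tangent_map B C h (f p) (tangent_map A B f p v)"
proof -
  interpret M: smooth_manifold X A by fact
  interpret N: smooth_manifold Y B by fact
  interpret O: smooth_manifold Z C by fact
  obtain U \<phi> where U: "(U, \<phi>) \<in> A" "p \<in> U" using M.chart_ex[OF mdiffD(1)[OF f]] .
  obtain V \<psi> where V: "(V, \<psi>) \<in> B" "f p \<in> V" using N.chart_ex[OF mdiffD(2)[OF f]] .
  obtain W \<omega> where W: "(W, \<omega>) \<in> C" "h (f p) \<in> W" using O.chart_ex[OF mdiffD(2)[OF h]] .
  have W': "(h \<circ> f) p \<in> W" using W by simp
  have hf: "mdiff X A Z C (h \<circ> f) p" by (rule mdiff_compose[OF assms(1,2) f h])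
  have fv: "tangent_map A B f p v \<in> tangent_space B (f p)" by (rule tangent_map_in[OF assms(1,2) f v])
  show ?thesis
  proof (rule tangent_space_eqI[OF _ tangent_map_in[OF assms(2,3) h fv] W])
    show "tangent_map A C (h \<circ> f) p v \<in> tangent_space C (h (f p))"
      using tangent_map_in[OF assms(1,3) hf v] by simp
    show "tangent_map A C (h \<circ> f) p v (W, \<omega>) = tangent_map B C h (f p) (tangent_map A B f p v) (W, \<omega>)"
      unfolding tangent_map_coord[OF assms(1) hf v U W(1) W'] tangent_map_coord[OF assms(2) h fv V W]
        tangent_map_coord[OF assms(1) f v U V]
        frechet_derivative_at[OF coord_chain_rule[OF assms(1,2) f h U V W], symmetric] by simp
  qed
qed

lemma tangent_map_cong:
  assumes "smooth_manifold X A" "mdiff X A Y B f p" "v \<in> tangent_space A p"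
    and N: "openin X N" "p \<in> N" "\<And>x. x \<in> N \<Longrightarrow> f x = g x"
  shows "tangent_map A B f p v = tangent_map A B g p v"
proof -
  interpret M: smooth_manifold X A by fact
  obtain U \<phi> where U: "(U, \<phi>) \<in> A" "p \<in> U" using M.chart_ex[OF mdiffD(1)[OF assms(2)]] .
  have g: "mdiff X A Y B g p" by (rule M.mdiff_cong[OF assms(2) N])
  have fg: "f p = g p" using N by simp
  have "tangent_map A B f p v (V, \<psi>) = tangent_map A B g p v (V, \<psi>)" for V \<psi>
  proof (cases "(V, \<psi>) \<in> B \<and> f p \<in> V")
    case True
    then have V: "(V, \<psi>) \<in> B" "f p \<in> V" "g p \<in> V" using fg by auto
    show ?thesis
      using M.mdiff_cong(2)[OF assms(2) N U V(1,2)]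
      by (simp add: tangent_map_coord[OF assms(1,2,3) U V(1,2)] tangent_map_coord[OF assms(1) g assms(3) U V(1,3)])
  next
    case False
    then show ?thesis using tangent_map_outside fg by metis
  qed
  then show ?thesis by (simp add: fun_eq_iff)
qed

lemma tangent_map_zero:
  assumes "smooth_manifold X A" "smooth_manifold Y B" "mdiff X A Y B f p" "0 \<in> tangent_space A p"
  shows "tangent_map A B f p 0 = 0"
proof -
  interpret M: smooth_manifold X A by fact
  obtain U \<phi> where U: "(U, \<phi>) \<in> A" "p \<in> U" using M.chart_ex[OF mdiffD(1)[OF assms(3)]] .
  have "tangent_map A B f p 0 (V, \<psi>) = 0" for V \<psi>
  proof (cases "(V, \<psi>) \<in> B \<and> f p \<in> V")
    case True
    then have V: "(V, \<psi>) \<in> B" "f p \<in> V" by auto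
    show ?thesis
      using tangent_map_coord[OF assms(1,3,4) U V]
        linear_0[OF linear_frechet_derivative[OF mdiffD(3)[OF assms(3) U V]]] by simp
  next
    case False
    then show ?thesis by (rule tangent_map_outside)
  qed
  then show ?thesis by (simp add: fun_eq_iff)
qed

context smooth_manifold
begin

lemma chart_transition_self:
  assumes "(U, \<phi>) \<in> A" "p \<in> U"
  shows "frechet_derivative (\<phi> \<circ> inv_into U \<phi>) (at (\<phi> p)) = id"
proof -
  have "(\<phi> \<circ> inv_into U \<phi> has_derivative id) (at (\<phi> p))"
    by (rule has_derivative_transform_within_open[of id id _ _ "\<phi> ` U"])
      (use assms chart_open_image[OF assms(1)] in \<open>auto simp: f_inv_into_f has_derivative_id\<close>)
  then show ?thesis using frechet_derivative_at by metis
qed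

lemma transition_differentiable:
  assumes "(U, \<phi>) \<in> A" "p \<in> U" "(V, \<psi>) \<in> A" "p \<in> V"
  shows "(\<psi> \<circ> inv_into U \<phi>) differentiable at (\<phi> p)"
  using smooth_on_differentiable[OF charts_compatible[OF assms(1,3)], of "\<phi> p"] assms by auto

lemma tangent_space_zero: "p \<in> topspace X \<Longrightarrow> 0 \<in> tangent_space A p"
  using linear_0[OF linear_frechet_derivative[OF transition_differentiable]]
  by (auto simp: tangent_space_def)

lemma tangent_vector_ex:
  assumes "(U, \<phi>) \<in> A" "p \<in> U"
  obtains v where "v \<in> tangent_space A p" "v (U, \<phi>) = e"
proof -
  define v where "v = (\<lambda>(V, \<psi>). if (V, \<psi>) \<in> A \<and> p \<in> V
    then frechet_derivative (\<psi> \<circ> inv_into U \<phi>) (at (\<phi> p)) e else 0)"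
  have p: "p \<in> topspace X" using assms chart_subset by blast
  have "frechet_derivative (\<omega> \<circ> inv_into U \<phi>) (at (\<phi> p)) e =
      frechet_derivative (\<omega> \<circ> inv_into V \<psi>) (at (\<psi> p)) (frechet_derivative (\<psi> \<circ> inv_into U \<phi>) (at (\<phi> p)) e)"
    if "(V, \<psi>) \<in> A" "p \<in> V" "(W, \<omega>) \<in> A" "p \<in> W" for V \<psi> W \<omega>
  proof -
    have "(\<omega> \<circ> (id \<circ> id) \<circ> inv_into U \<phi> has_derivative
        frechet_derivative (\<omega> \<circ> id \<circ> inv_into V \<psi>) (at (\<psi> (id p))) \<circ>
        frechet_derivative (\<psi> \<circ> id \<circ> inv_into U \<phi>) (at (\<phi> p))) (at (\<phi> p))"
      by (rule coord_chain_rule[OF smooth_manifold_axioms smooth_manifold_axioms mdiff_id[OF p] _ assms that(1) _ that(3)])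
        (use mdiff_id[OF p] that in auto)
    then have "(\<omega> \<circ> inv_into U \<phi> has_derivative
        frechet_derivative (\<omega> \<circ> inv_into V \<psi>) (at (\<psi> p)) \<circ>
        frechet_derivative (\<psi> \<circ> inv_into U \<phi>) (at (\<phi> p))) (at (\<phi> p))" by simp
    from frechet_derivative_at[OF this, symmetric] show ?thesis by simp
  qed
  note chain = this
  have "v \<in> tangent_space A p"
  proof (rule tangent_spaceI)
    show "v (W, \<omega>) = frechet_derivative (\<omega> \<circ> inv_into V \<psi>) (at (\<psi> p)) (v (V, \<psi>))"
      if "(V, \<psi>) \<in> A" "p \<in> V" "(W, \<omega>) \<in> A" "p \<in> W" for V \<psi> W \<omega>
      using chain[OF that] that by (simp add: v_def)
  qed (auto simp: v_def)
  moreover have "v (U, \<phi>) = e" using assms chart_transition_self[OF assms] by (simp add: v_def)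
  ultimately show ?thesis using that by blast
qed

end

section \<open>Curves and velocities\<close>

abbreviation line_atlas :: "(real, real) chart set"
  where "line_atlas \<equiv> {(UNIV, id)}"

lemma inv_into_UNIV_id [simp]: "inv_into UNIV id = id"
  by (rule ext) (metis id_apply inj_on_id inv_into_f_f UNIV_I)

lemma line_manifold: "smooth_manifold euclidean line_atlas"
proof
  show "homeomorphic_map (subtopology euclidean U) (top_of_set (\<phi> ` U)) \<phi>"
    if "(U, \<phi>) \<in> line_atlas" for U \<phi>
    using that homeomorphic_map_id by simp
  show "smooth_on (\<phi> ` (U \<inter> V)) (\<psi> \<circ> inv_into U \<phi>)"
    if "(U, \<phi>) \<in> line_atlas" "(V, \<psi>) \<in> line_atlas" for U \<phi> V \<psi>
    using that smooth_on_bounded_linear[OF open_UNIV bounded_linear_ident] by (simp add: id_def o_def)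
  show "second_countable (euclidean :: real topology)"
  proof -
    obtain \<B> :: "real set set" where B: "countable \<B>" "\<And>C. C \<in> \<B> \<Longrightarrow> open C"
      "\<And>S. open S \<Longrightarrow> \<exists>U. U \<subseteq> \<B> \<and> S = \<Union>U"
      using univ_second_countable by metis
    have "\<exists>V\<in>\<B>. x \<in> V \<and> V \<subseteq> S" if "open S" "x \<in> S" for S x
      using B(3)[OF that(1)] that(2) by blast
    then show ?thesis
      using B(1,2) unfolding second_countable_def by (intro exI[of _ \<B>]) (simp add: open_openin[symmetric])
  qed
qed auto

text \<open>A curve is a map from the line, and its velocity the image of the unit tangent vector.\<close>

definition line_unit :: "(real, real) tangent_vector"
  where "line_unit = (\<lambda>(U, \<phi>). if (U, \<phi>) \<in> line_atlas then 1 else 0)"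

lemma line_unit_tangent: "line_unit \<in> tangent_space line_atlas t"
  by (auto simp: line_unit_def tangent_space_def)

abbreviation curve_mdiff :: "'a topology \<Rightarrow> ('a, 'e::euclidean_space) chart set \<Rightarrow> (real \<Rightarrow> 'a) \<Rightarrow> real \<Rightarrow> bool"
  where "curve_mdiff \<equiv> mdiff euclidean line_atlas"

lemma curve_mdiff_vector_derivative:
  assumes "curve_mdiff X A c t" "(U, \<phi>) \<in> A" "c t \<in> U"
  shows "(\<phi> \<circ> c has_vector_derivative velocity A c t (U, \<phi>)) (at t)"
  using mdiffD(3)[OF assms(1), of UNIV id U \<phi>] assms
  by (simp add: velocity_def vector_derivative_works o_assoc)

lemma velocity_tangent_map:
  assumes "curve_mdiff X A c t"
  shows "velocity A c t = tangent_map line_atlas A c t line_unit"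
proof -
  have "velocity A c t (U, \<phi>) = tangent_map line_atlas A c t line_unit (U, \<phi>)" for U \<phi>
  proof (cases "(U, \<phi>) \<in> A \<and> c t \<in> U")
    case True
    then have U: "(U, \<phi>) \<in> A" "c t \<in> U" by auto
    have "(\<phi> \<circ> c) differentiable at t" using mdiffD(3)[OF assms, of UNIV id U \<phi>] U by simp
    then have "frechet_derivative (\<phi> \<circ> c) (at t) 1 = vector_derivative (\<phi> \<circ> c) (at t)"
      using frechet_derivative_eq_vector_derivative by fastforce
    then show ?thesis
      using tangent_map_coord[OF line_manifold assms line_unit_tangent, of UNIV id U \<phi>] U
      by (simp add: velocity_def line_unit_def)
  next
    case False
    then show ?thesis using tangent_map_outside[of U \<phi> A c t] by (auto simp: velocity_def)
  qed
  then show ?thesis by (simp add: fun_eq_iff)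
qed

lemma velocity_in_tangent_space:
  assumes "smooth_manifold X A" "curve_mdiff X A c t"
  shows "velocity A c t \<in> tangent_space A (c t)"
  using tangent_map_in[OF line_manifold assms line_unit_tangent] velocity_tangent_map[OF assms(2)] by simp

lemma velocity_compose:
  assumes "smooth_manifold X A" "smooth_manifold Y B" "curve_mdiff X A c t" "mdiff X A Y B f (c t)"
  shows "curve_mdiff Y B (f \<circ> c) t" "velocity B (f \<circ> c) t = tangent_map A B f (c t) (velocity A c t)"
proof -
  show fc: "curve_mdiff Y B (f \<circ> c) t" by (rule mdiff_compose[OF line_manifold assms(1,3,4)])
  show "velocity B (f \<circ> c) t = tangent_map A B f (c t) (velocity A c t)"
    unfolding velocity_tangent_map[OF fc] velocity_tangent_map[OF assms(3)]
    by (rule tangent_map_compose[OF line_manifold assms(1-4) line_unit_tangent])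
qed

lemma velocity_cong:
  assumes "curve_mdiff X A c t" "open N" "t \<in> N" "\<And>s. s \<in> N \<Longrightarrow> c s = d s"
  shows "curve_mdiff X A d t" "velocity A c t = velocity A d t"
proof -
  have N: "openin euclidean N" by (rule open_openin[THEN iffD1, OF assms(2)])
  show d: "curve_mdiff X A d t"
    by (rule smooth_manifold.mdiff_cong[OF line_manifold assms(1) N assms(3,4)])
  show "velocity A c t = velocity A d t"
    unfolding velocity_tangent_map[OF d] velocity_tangent_map[OF assms(1)]
    by (rule tangent_map_cong[OF line_manifold assms(1) line_unit_tangent N assms(3,4)])
qed

lemma smooth_curve_chart:
  assumes "smooth_curve X A J c" "(U, \<phi>) \<in> A"
  shows "smooth_on {t \<in> J. c t \<in> U} (\<phi> \<circ> c)"
  using assms by (auto simp: smooth_curve_def)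

lemma smooth_curve_continuous: "smooth_curve X A J c \<Longrightarrow> continuous_map (top_of_set J) X c"
  by (simp add: smooth_curve_def)

context smooth_manifold
begin

lemma smooth_curve_open_vimage:
  assumes "continuous_map (top_of_set J) X c" "open J" "openin X W"
  shows "open {t \<in> J. c t \<in> W}"
  using openin_continuous_map_preimage[OF assms(1,3)] assms(2) openin_open_trans by fastforce

lemma smooth_curve_mdiff:
  assumes "smooth_curve X A J c" "open J" "t \<in> J"
  shows "curve_mdiff X A c t"
proof -
  have c: "continuous_map (top_of_set J) X c" using assms(1) by (simp add: smooth_curve_def)
  have "c t \<in> topspace X" using c assms(3) by (auto simp: continuous_map_def)
  moreover have "\<exists>N. openin euclidean N \<and> t \<in> N \<and> c ` N \<subseteq> W" if "openin X W" "c t \<in> W" for W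
    using smooth_curve_open_vimage[OF c assms(2) that(1)] that(2) assms(3)
    by (intro exI[of _ "{t \<in> J. c t \<in> W}"]) (auto simp: open_openin[symmetric])
  moreover have "(\<phi> \<circ> c) differentiable at t" if "(U, \<phi>) \<in> A" "c t \<in> U" for U \<phi>
    by (rule smooth_on_differentiable[OF smooth_curve_chart[OF assms(1) that(1)]]) (use that assms(3) in auto)
  ultimately show ?thesis by (intro mdiffI) auto
qed

lemma smooth_curve_subset:
  assumes "smooth_curve X A J c" "K \<subseteq> J"
  shows "smooth_curve X A K c"
  unfolding smooth_curve_def
proof
  show "continuous_map (top_of_set K) X c"
    by (rule continuous_map_from_subtopology_mono[OF smooth_curve_continuous[OF assms(1)] assms(2)])
  have "smooth_on {t \<in> K. c t \<in> U} (\<phi> \<circ> c)" if "(U, \<phi>) \<in> A" for U \<phi>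
    using smooth_curve_chart[OF assms(1) that] by (rule smooth_on_subset) (use assms(2) in auto)
  then show "\<forall>(U, \<phi>)\<in>A. smooth_on {t \<in> K. c t \<in> U} (\<phi> \<circ> c)" by auto
qed

text \<open>The transition maps carry smoothness in one chart over to all others.\<close>

lemma smooth_curve_locally:
  assumes "open J"
    and loc: "\<And>t. t \<in> J \<Longrightarrow> \<exists>K U \<phi> y. open K \<and> t \<in> K \<and> K \<subseteq> J \<and> (U, \<phi>) \<in> A \<and> smooth_on K y \<and>
      y ` K \<subseteq> \<phi> ` U \<and> (\<forall>s\<in>K. c s = inv_into U \<phi> (y s))"
  shows "smooth_curve X A J c"
proof -
  have inU: "c s \<in> U" if "(U, \<phi>) \<in> A" "y ` K \<subseteq> \<phi> ` U" "\<forall>s\<in>K. c s = inv_into U \<phi> (y s)" "s \<in> K" for U \<phi> y K s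
    using that inv_into_into[of "y s" \<phi> U] by auto
  have cont: "continuous_map (top_of_set J) X c"
  proof -
    have top: "c t \<in> topspace X" if "t \<in> J" for t
    proof -
      obtain K U \<phi> y where K: "t \<in> K" "(U, \<phi>) \<in> A" "y ` K \<subseteq> \<phi> ` U" "\<forall>s\<in>K. c s = inv_into U \<phi> (y s)"
        using loc[OF \<open>t \<in> J\<close>] by blast
      show ?thesis using inU[OF K(2-4,1)] chart_subset[OF K(2)] by blast
    qed
    moreover have "openin (top_of_set J) {t \<in> J. c t \<in> W}" if W: "openin X W" for W
    proof -
      have "open {t \<in> J. c t \<in> W}"
      proof (subst open_subopen, rule ballI)
        fix t assume t: "t \<in> {t \<in> J. c t \<in> W}"
        then obtain K U \<phi> y where K: "open K" "t \<in> K" "K \<subseteq> J" "(U, \<phi>) \<in> A" "smooth_on K y"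
          "y ` K \<subseteq> \<phi> ` U" "\<forall>s\<in>K. c s = inv_into U \<phi> (y s)" using loc[of t] by blast
        have "open (K \<inter> y -` {z \<in> \<phi> ` U. inv_into U \<phi> z \<in> W})"
          by (rule continuous_open_preimage[OF smooth_on_continuous_on[OF K(5)] K(1) chart_open_vimage_inv[OF K(4) W]])
        moreover have "t \<in> K \<inter> y -` {z \<in> \<phi> ` U. inv_into U \<phi> z \<in> W}" using K t by auto
        moreover have "K \<inter> y -` {z \<in> \<phi> ` U. inv_into U \<phi> z \<in> W} \<subseteq> {t \<in> J. c t \<in> W}" using K by auto
        ultimately show "\<exists>T. open T \<and> t \<in> T \<and> T \<subseteq> {t \<in> J. c t \<in> W}" by blast
      qed
      then show ?thesis by (auto simp: openin_open)
    qed
    ultimately show ?thesis by (auto simp: continuous_map_def)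
  qed
  moreover have "smooth_on {t \<in> J. c t \<in> V} (\<psi> \<circ> c)" if V: "(V, \<psi>) \<in> A" for V \<psi>
  proof (rule smooth_on_Union)
    fix t assume t: "t \<in> {t \<in> J. c t \<in> V}"
    then obtain K U \<phi> y where K: "open K" "t \<in> K" "K \<subseteq> J" "(U, \<phi>) \<in> A" "smooth_on K y"
      "y ` K \<subseteq> \<phi> ` U" "\<forall>s\<in>K. c s = inv_into U \<phi> (y s)" using loc[of t] by blast
    define K' where "K' = K \<inter> {t \<in> J. c t \<in> V}"
    have oK: "open K'" unfolding K'_def
      by (intro open_Int K smooth_curve_open_vimage[OF cont assms(1) chart_openin[OF V]])
    have sm: "smooth_on K' (\<lambda>s. (\<psi> \<circ> inv_into U \<phi>) (y s))"
    proof (rule smooth_on_compose[OF oK _ smooth_on_subset[OF K(5)] charts_compatible[OF K(4) V]])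
      show "open (\<phi> ` (U \<inter> V))"
        using chart_open_image_subset[OF K(4)] chart_openin[OF K(4)] chart_openin[OF V] by blast
      show "y ` K' \<subseteq> \<phi> ` (U \<inter> V)"
      proof
        fix z assume "z \<in> y ` K'"
        then obtain s where s: "s \<in> K'" "z = y s" by blast
        then have "c s \<in> U \<inter> V" using inU[OF K(4,6,7)] by (auto simp: K'_def)
        moreover have "\<phi> (c s) = z" using s K(6,7) by (auto simp: K'_def f_inv_into_f image_subset_iff)
        ultimately show "z \<in> \<phi> ` (U \<inter> V)" by blast
      qed
    qed (auto simp: K'_def)
    have "smooth_on K' (\<psi> \<circ> c)"
      by (rule smooth_on_cong[OF oK, THEN iffD1, OF _ sm]) (use K(7) in \<open>auto simp: K'_def\<close>)
    then show "\<exists>U. open U \<and> t \<in> U \<and> smooth_on U (\<psi> \<circ> c)" using oK K(2) t by (auto simp: K'_def)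
  qed
  ultimately show ?thesis unfolding smooth_curve_def by auto
qed

lemma smooth_curve_in_chart:
  assumes "open J" "(U, \<phi>) \<in> A" "smooth_on J y" "y ` J \<subseteq> \<phi> ` U"
  shows "smooth_curve X A J (inv_into U \<phi> \<circ> y)"
  by (rule smooth_curve_locally[OF assms(1)]) (use assms in \<open>auto intro!: exI[of _ J] exI[of _ y]\<close>)

lemma smooth_curve_Union:
  assumes "open J" "\<And>t. t \<in> J \<Longrightarrow> \<exists>K d. open K \<and> t \<in> K \<and> smooth_curve X A K d \<and> (\<forall>s\<in>K. c s = d s)"
  shows "smooth_curve X A J c"
proof (rule smooth_curve_locally[OF assms(1)])
  fix t assume t: "t \<in> J"
  then obtain K d where K: "open K" "t \<in> K" "smooth_curve X A K d" "\<forall>s\<in>K. c s = d s"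
    using assms(2) by blast
  have d: "continuous_map (top_of_set K) X d" using K(3) by (simp add: smooth_curve_def)
  have "d t \<in> topspace X" using d K(2) by (auto simp: continuous_map_def)
  then obtain U \<phi> where U: "(U, \<phi>) \<in> A" "d t \<in> U" using chart_ex by blast
  define L where "L = J \<inter> {s \<in> K. d s \<in> U}"
  have "open L" unfolding L_def
    by (intro open_Int assms(1) smooth_curve_open_vimage[OF d K(1) chart_openin[OF U(1)]])
  moreover have "smooth_on {s \<in> K. d s \<in> U} (\<phi> \<circ> d)" by (rule smooth_curve_chart[OF K(3) U(1)])
  then have "smooth_on L (\<phi> \<circ> d)" by (rule smooth_on_subset) (auto simp: L_def)
  ultimately show "\<exists>L U \<phi> y. open L \<and> t \<in> L \<and> L \<subseteq> J \<and> (U, \<phi>) \<in> A \<and> smooth_on L y \<and>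
      y ` L \<subseteq> \<phi> ` U \<and> (\<forall>s\<in>L. c s = inv_into U \<phi> (y s))"
    using t K(2,4) U chart_inv[OF U(1)]
    by (intro exI[of _ L] exI[of _ U] exI[of _ \<phi>] exI[of _ "\<phi> \<circ> d"]) (auto simp: L_def)
qed

end

lemma smooth_curve_compose:
  assumes "smooth_manifold X A" "smooth_manifold Y B" "smooth_map X A Y B f" "smooth_curve X A J c" "open J"
  shows "smooth_curve Y B J (f \<circ> c)"
proof -
  interpret M: smooth_manifold X A by fact
  interpret N: smooth_manifold Y B by fact
  have f: "continuous_map X Y f" using assms(3) by (simp add: smooth_map_def)
  have c: "continuous_map (top_of_set J) X c" using assms(4) by (simp add: smooth_curve_def)
  have fc: "continuous_map (top_of_set J) Y (f \<circ> c)" by (rule continuous_map_compose[OF c f])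
  show ?thesis
  proof (rule N.smooth_curve_locally[OF assms(5)])
    fix t assume t: "t \<in> J"
    have "c t \<in> topspace X" using c t by (auto simp: continuous_map_def)
    then obtain U \<phi> where U: "(U, \<phi>) \<in> A" "c t \<in> U" using M.chart_ex by blast
    have "f (c t) \<in> topspace Y" using fc t by (auto simp: continuous_map_def)
    then obtain V \<psi> where V: "(V, \<psi>) \<in> B" "f (c t) \<in> V" using N.chart_ex by blast
    define W where "W = {x \<in> U. f x \<in> V}"
    have "openin X {x \<in> topspace X. f x \<in> V}"
      using f N.chart_openin[OF V(1)] openin_continuous_map_preimage by blast
    moreover have "W = U \<inter> {x \<in> topspace X. f x \<in> V}" using M.chart_subset[OF U(1)] by (auto simp: W_def)
    ultimately have W: "openin X W" using M.chart_openin[OF U(1)] by auto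
    define K where "K = {s \<in> J. c s \<in> W}"
    have K: "open K" unfolding K_def by (rule M.smooth_curve_open_vimage[OF c assms(5) W])
    have 1: "smooth_on (\<phi> ` W) (\<psi> \<circ> f \<circ> inv_into U \<phi>)"
      using assms(3) U V unfolding smooth_map_def W_def by blast
    have "smooth_on {s \<in> J. c s \<in> U} (\<phi> \<circ> c)"
      by (rule smooth_curve_chart[OF assms(4) U(1)])
    then have 2: "smooth_on K (\<phi> \<circ> c)" by (rule smooth_on_subset) (auto simp: K_def W_def)
    have "open (\<phi> ` W)" by (rule M.chart_open_image_subset[OF U(1) W]) (auto simp: W_def)
    from smooth_on_compose[OF K this 2 1]
    have "smooth_on K (\<lambda>s. (\<psi> \<circ> f \<circ> inv_into U \<phi>) ((\<phi> \<circ> c) s))" by (auto simp: K_def)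
    moreover have "(\<psi> \<circ> f \<circ> inv_into U \<phi>) ((\<phi> \<circ> c) s) = \<psi> (f (c s))" if "s \<in> K" for s
      using that M.chart_inv[OF U(1)] by (simp add: K_def W_def)
    ultimately have "smooth_on K (\<psi> \<circ> (f \<circ> c))"
      using smooth_on_cong[OF K, of "\<lambda>s. (\<psi> \<circ> f \<circ> inv_into U \<phi>) ((\<phi> \<circ> c) s)" "\<psi> \<circ> (f \<circ> c)"] by simp
    moreover have "t \<in> K" using t U V by (simp add: K_def W_def)
    ultimately show "\<exists>K V \<psi> y. open K \<and> t \<in> K \<and> K \<subseteq> J \<and> (V, \<psi>) \<in> B \<and> smooth_on K y \<and>
      y ` K \<subseteq> \<psi> ` V \<and> (\<forall>s\<in>K. (f \<circ> c) s = inv_into V \<psi> (y s))"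
      using K V N.chart_inv[OF V(1)]
      by (intro exI[of _ K] exI[of _ V] exI[of _ \<psi>] exI[of _ "\<psi> \<circ> (f \<circ> c)"]) (auto simp: K_def W_def)
  qed
qed

lemma smooth_map_chart:
  assumes "smooth_map X A Y B f" "(U, \<phi>) \<in> A" "(V, \<psi>) \<in> B"
  shows "smooth_on (\<phi> ` {x \<in> U. f x \<in> V}) (\<psi> \<circ> f \<circ> inv_into U \<phi>)"
  using assms(1,2,3) unfolding smooth_map_def by fast

section \<open>Translations of a Lie group\<close>

context lie_group
begin

lemma chart_carrier: "(U, \<phi>) \<in> A \<Longrightarrow> U \<subseteq> carrier G"
  using chart_subset topspace_carrier by simp

lemma mult_coord_smooth:
  assumes U: "(U, \<phi>) \<in> A" and V: "(V, \<psi>) \<in> A" and W: "(W, \<omega>) \<in> A"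
  defines "D \<equiv> {p. fst p \<in> \<phi> ` U \<and> snd p \<in> \<psi> ` V \<and> inv_into U \<phi> (fst p) \<otimes> inv_into V \<psi> (snd p) \<in> W}"
  shows "open D" "smooth_on D (\<lambda>p. \<omega> (inv_into U \<phi> (fst p) \<otimes> inv_into V \<psi> (snd p)))"
proof -
  let ?m = "\<lambda>(x, y). x \<otimes> y"
  have cont: "continuous_map (prod_topology T T) T ?m"
    using smooth_mult by (simp add: smooth_map_def)
  have inj: "inj_on (map_prod \<phi> \<psi>) (U \<times> V)"
    using map_prod_inj_on chart_inj[OF U] chart_inj[OF V] by blast
  have invp: "inv_into (U \<times> V) (map_prod \<phi> \<psi>) p = (inv_into U \<phi> (fst p), inv_into V \<psi> (snd p))"
    if p: "fst p \<in> \<phi> ` U" "snd p \<in> \<psi> ` V" for p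
  proof -
    obtain x y where "x \<in> U" "y \<in> V" "fst p = \<phi> x" "snd p = \<psi> y"
      using p by blast
    moreover from this have "p = map_prod \<phi> \<psi> (x, y)" by (simp add: prod_eq_iff)
    ultimately have "x \<in> U" "y \<in> V" "p = map_prod \<phi> \<psi> (x, y)" by auto
    then show ?thesis
      using inv_into_f_f[OF inj, of "(x, y)"] chart_inv[OF U] chart_inv[OF V] by simp
  qed
  have D: "D = map_prod \<phi> \<psi> ` {p \<in> U \<times> V. ?m p \<in> W}"
  proof (intro Set.set_eqI iffI)
    fix p assume p: "p \<in> D"
    then have "(inv_into U \<phi> (fst p), inv_into V \<psi> (snd p)) \<in> {p \<in> U \<times> V. ?m p \<in> W}"
      by (auto simp: D_def inv_into_into)
    moreover have "p = map_prod \<phi> \<psi> (inv_into U \<phi> (fst p), inv_into V \<psi> (snd p))"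
      using p by (simp add: D_def f_inv_into_f)
    ultimately show "p \<in> map_prod \<phi> \<psi> ` {p \<in> U \<times> V. ?m p \<in> W}" by (rule rev_image_eqI)
  next
    fix p assume "p \<in> map_prod \<phi> \<psi> ` {p \<in> U \<times> V. ?m p \<in> W}"
    then show "p \<in> D" using chart_inv[OF U] chart_inv[OF V] by (auto simp: D_def)
  qed
  show oD: "open D"
  proof (subst open_subopen, rule ballI)
    fix p assume p: "p \<in> D"
    let ?x = "inv_into U \<phi> (fst p)" and ?y = "inv_into V \<psi> (snd p)"
    let ?P = "{q \<in> topspace (prod_topology T T). ?m q \<in> W}"
    have "openin (prod_topology T T) ?P"
      using cont chart_openin[OF W] openin_continuous_map_preimage by blast
    moreover have "(?x, ?y) \<in> ?P"
      using p chart_subset[OF U] chart_subset[OF V] by (auto simp: D_def inv_into_into subset_iff)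
    ultimately obtain N M where NM: "openin T N" "openin T M" "?x \<in> N" "?y \<in> M" "N \<times> M \<subseteq> ?P"
      using openin_prod_topology_alt[THEN iffD1, rule_format, of T T ?P ?x ?y] by blast
    have "open (\<phi> ` (U \<inter> N) \<times> \<psi> ` (V \<inter> M))"
      using NM chart_openin[OF U] chart_openin[OF V]
      by (intro open_Times chart_open_image_subset[OF U] chart_open_image_subset[OF V]) auto
    moreover have "p \<in> \<phi> ` (U \<inter> N) \<times> \<psi> ` (V \<inter> M)"
    proof -
      have "fst p = \<phi> ?x" "snd p = \<psi> ?y" "?x \<in> U" "?y \<in> V"
        using p by (auto simp: D_def f_inv_into_f inv_into_into)
      then show ?thesis using NM(3,4) by (metis IntI imageI mem_Times_iff)
    qed
    moreover have "\<phi> ` (U \<inter> N) \<times> \<psi> ` (V \<inter> M) \<subseteq> D"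
      using NM(5) chart_inv[OF U] chart_inv[OF V] by (auto simp: D_def)
    ultimately show "\<exists>S. open S \<and> p \<in> S \<and> S \<subseteq> D" by blast
  qed
  have "(U \<times> V, map_prod \<phi> \<psi>) \<in> product_atlas A A" using U V by (auto simp: product_atlas_def)
  then have "smooth_on D (\<omega> \<circ> ?m \<circ> inv_into (U \<times> V) (map_prod \<phi> \<psi>))"
    unfolding D by (rule smooth_map_chart[OF smooth_mult _ W])
  moreover have "(\<omega> \<circ> ?m \<circ> inv_into (U \<times> V) (map_prod \<phi> \<psi>)) p = \<omega> (inv_into U \<phi> (fst p) \<otimes> inv_into V \<psi> (snd p))"
    if "p \<in> D" for p
    using invp[of p] that by (simp add: D_def)
  ultimately show "smooth_on D (\<lambda>p. \<omega> (inv_into U \<phi> (fst p) \<otimes> inv_into V \<psi> (snd p)))"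
    using smooth_on_cong[OF oD, of "\<omega> \<circ> ?m \<circ> inv_into (U \<times> V) (map_prod \<phi> \<psi>)"] by fastforce
qed

lemma continuous_mult:
  assumes "continuous_map Z T f" "continuous_map Z T g"
  shows "continuous_map Z T (\<lambda>x. f x \<otimes> g x)"
proof -
  have "continuous_map (prod_topology T T) T (\<lambda>(x, y). x \<otimes> y)"
    using smooth_mult by (simp add: smooth_map_def)
  from continuous_map_compose[OF continuous_map_pairedI[OF assms] this]
  show ?thesis by (simp add: o_def)
qed

text \<open>A translation is the restriction of the multiplication to a slice.\<close>

lemma smooth_left_translation:
  assumes g: "g \<in> carrier G"
  shows "smooth_map T A T A (\<lambda>x. g \<otimes> x)"
proof -
  have cont: "continuous_map T T (\<lambda>x. g \<otimes> x)"
    using continuous_mult[of T "\<lambda>x. g" "\<lambda>x. x"] g topspace_carrier by (simp add: continuous_map_const)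
  have "smooth_on (\<psi> ` {x \<in> V. g \<otimes> x \<in> W}) (\<omega> \<circ> (\<lambda>x. g \<otimes> x) \<circ> inv_into V \<psi>)"
    if V: "(V, \<psi>) \<in> A" and W: "(W, \<omega>) \<in> A" for V \<psi> W \<omega>
  proof -
    obtain U \<phi> where U: "(U, \<phi>) \<in> A" "g \<in> U" using chart_ex g topspace_carrier by metis
    let ?S = "\<psi> ` {x \<in> V. g \<otimes> x \<in> W}"
    have "{x \<in> V. g \<otimes> x \<in> W} = V \<inter> {x \<in> topspace T. g \<otimes> x \<in> W}" using chart_subset[OF V] by auto
    moreover have "openin T (V \<inter> {x \<in> topspace T. g \<otimes> x \<in> W})"
      by (intro openin_Int chart_openin[OF V] openin_continuous_map_preimage[OF cont chart_openin[OF W]])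
    ultimately have S: "open ?S" using chart_open_image_subset[OF V] by simp
    have g': "inv_into U \<phi> (\<phi> g) = g" by (rule chart_inv[OF U])
    have "smooth_on ?S (\<lambda>z. (\<phi> g, z))"
      using smooth_on_bounded_linear[OF S bounded_linear_ident]
      by (intro smooth_on_Pair[OF S] smooth_on_const[OF S]) (simp add: id_def)
    then have "smooth_on ?S (\<lambda>z. \<omega> (inv_into U \<phi> (fst (\<phi> g, z)) \<otimes> inv_into V \<psi> (snd (\<phi> g, z))))"
      by (rule smooth_on_compose[OF S mult_coord_smooth(1)[OF U(1) V W] _ mult_coord_smooth(2)[OF U(1) V W]])
        (use U g' chart_inv[OF V] in auto)
    then show ?thesis by (simp add: g' o_def)
  qed
  then show ?thesis using cont unfolding smooth_map_def by auto
qed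

lemma smooth_right_translation:
  assumes g: "g \<in> carrier G"
  shows "smooth_map T A T A (\<lambda>x. x \<otimes> g)"
proof -
  have cont: "continuous_map T T (\<lambda>x. x \<otimes> g)"
    using continuous_mult[of T "\<lambda>x. x" "\<lambda>x. g"] g topspace_carrier by (simp add: continuous_map_const)
  have "smooth_on (\<psi> ` {x \<in> V. x \<otimes> g \<in> W}) (\<omega> \<circ> (\<lambda>x. x \<otimes> g) \<circ> inv_into V \<psi>)"
    if V: "(V, \<psi>) \<in> A" and W: "(W, \<omega>) \<in> A" for V \<psi> W \<omega>
  proof -
    obtain U \<phi> where U: "(U, \<phi>) \<in> A" "g \<in> U" using chart_ex g topspace_carrier by metis
    let ?S = "\<psi> ` {x \<in> V. x \<otimes> g \<in> W}"
    have "{x \<in> V. x \<otimes> g \<in> W} = V \<inter> {x \<in> topspace T. x \<otimes> g \<in> W}" using chart_subset[OF V] by auto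
    moreover have "openin T (V \<inter> {x \<in> topspace T. x \<otimes> g \<in> W})"
      by (intro openin_Int chart_openin[OF V] openin_continuous_map_preimage[OF cont chart_openin[OF W]])
    ultimately have S: "open ?S" using chart_open_image_subset[OF V] by simp
    have g': "inv_into U \<phi> (\<phi> g) = g" by (rule chart_inv[OF U])
    have "smooth_on ?S (\<lambda>z. (z, \<phi> g))"
      using smooth_on_bounded_linear[OF S bounded_linear_ident]
      by (intro smooth_on_Pair[OF S] smooth_on_const[OF S]) (simp add: id_def)
    then have "smooth_on ?S (\<lambda>z. \<omega> (inv_into V \<psi> (fst (z, \<phi> g)) \<otimes> inv_into U \<phi> (snd (z, \<phi> g))))"
      by (rule smooth_on_compose[OF S mult_coord_smooth(1)[OF V U(1) W] _ mult_coord_smooth(2)[OF V U(1) W]])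
        (use U g' chart_inv[OF V] in auto)
    then show ?thesis by (simp add: g' o_def)
  qed
  then show ?thesis using cont unfolding smooth_map_def by auto
qed

lemma mdiff_left_translation: "g \<in> carrier G \<Longrightarrow> x \<in> carrier G \<Longrightarrow> mdiff T A T A (\<lambda>x. g \<otimes> x) x"
  using smooth_map_mdiff[OF smooth_left_translation] topspace_carrier by simp

lemma mdiff_right_translation: "g \<in> carrier G \<Longrightarrow> x \<in> carrier G \<Longrightarrow> mdiff T A T A (\<lambda>x. x \<otimes> g) x"
  using smooth_map_mdiff[OF smooth_right_translation] topspace_carrier by simp

lemma mdiff_conjugation:
  assumes "g \<in> carrier G" "x \<in> carrier G"
  shows "mdiff T A T A (\<lambda>x. g \<otimes> x \<otimes> inv g) x"
proof -
  have "mdiff T A T A ((\<lambda>x. x \<otimes> inv g) \<circ> (\<lambda>x. g \<otimes> x)) x"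
    by (rule mdiff_compose[OF smooth_manifold_axioms smooth_manifold_axioms mdiff_left_translation
          mdiff_right_translation]) (use assms in auto)
  then show ?thesis by (simp add: o_def)
qed

text \<open>The differential at the identity of the left translation by \<open>x\<close>, in coordinates, is a partial
  derivative of the multiplication and so depends smoothly on \<open>x\<close>.\<close>

lemma left_translation_coord:
  assumes U: "(U, \<phi>) \<in> A" and V: "(V, \<psi>) \<in> A" "\<one> \<in> V"
  obtains \<Lambda> where "\<And>y. y \<in> \<phi> ` U \<Longrightarrow> linear (\<Lambda> y)" "\<And>w. smooth_on (\<phi> ` U) (\<lambda>y. \<Lambda> y w)"
    "\<And>x u. x \<in> U \<Longrightarrow> u \<in> tangent_space A \<one> \<Longrightarrow>
      tangent_map A A (\<lambda>z. x \<otimes> z) \<one> u (U, \<phi>) = \<Lambda> (\<phi> x) (u (V, \<psi>))"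
proof -
  define f where "f = (\<lambda>p. \<phi> (inv_into U \<phi> (fst p) \<otimes> inv_into V \<psi> (snd p)))"
  define D where "D = {p. fst p \<in> \<phi> ` U \<and> snd p \<in> \<psi> ` V \<and> inv_into U \<phi> (fst p) \<otimes> inv_into V \<psi> (snd p) \<in> U}"
  note f = mult_coord_smooth[OF U V(1) U, folded f_def D_def]
  define \<Lambda> where "\<Lambda> = (\<lambda>y w. frechet_derivative f (at (y, \<psi> \<one>)) (0, w))"
  have oU: "open (\<phi> ` U)" by (rule chart_open_image[OF U])
  have e: "inv_into V \<psi> (\<psi> \<one>) = \<one>" by (rule chart_inv[OF V])
  have inD: "(y, \<psi> \<one>) \<in> D" if y: "y \<in> \<phi> ` U" for y
  proof -
    have "inv_into U \<phi> y \<in> U" by (rule inv_into_into[OF y])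
    moreover from this have "inv_into U \<phi> y \<in> carrier G" using chart_carrier[OF U] by blast
    ultimately show ?thesis using y V(2) e by (simp add: D_def)
  qed
  have fd: "(f has_derivative frechet_derivative f (at (y, \<psi> \<one>))) (at (y, \<psi> \<one>))" if "y \<in> \<phi> ` U" for y
    by (rule smooth_on_has_derivative[OF f(2) inD[OF that]])
  have \<Lambda>d: "((\<lambda>z. f (y, z)) has_derivative \<Lambda> y) (at (\<psi> \<one>))" if "y \<in> \<phi> ` U" for y
    unfolding \<Lambda>_def
    by (rule has_derivative_compose[of "\<lambda>z. (y, z)" "\<lambda>w. (0, w)", OF _ fd[OF that]])
      (intro has_derivative_Pair has_derivative_const has_derivative_ident)
  show ?thesis
  proof (rule that)
    show "linear (\<Lambda> y)" if "y \<in> \<phi> ` U" for y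
      using \<Lambda>d[OF that] has_derivative_linear by blast
    show "smooth_on (\<phi> ` U) (\<lambda>y. \<Lambda> y w)" for w
    proof -
      have p: "smooth_on (\<phi> ` U) (\<lambda>y. (y, \<psi> \<one>))"
        using smooth_on_bounded_linear[OF oU bounded_linear_ident]
        by (intro smooth_on_Pair[OF oU] smooth_on_const[OF oU]) (simp add: id_def)
      show ?thesis unfolding \<Lambda>_def
        by (rule smooth_on_compose[OF oU f(1) p smooth_on_derivative[OF f(2)]]) (use inD in auto)
    qed
    show "tangent_map A A (\<lambda>z. x \<otimes> z) \<one> u (U, \<phi>) = \<Lambda> (\<phi> x) (u (V, \<psi>))"
      if x: "x \<in> U" and u: "u \<in> tangent_space A \<one>" for x u
    proof -
      have xG: "x \<in> carrier G" using x chart_carrier[OF U] by blast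
      have eq: "\<phi> \<circ> (\<lambda>z. x \<otimes> z) \<circ> inv_into V \<psi> = (\<lambda>z. f (\<phi> x, z))"
        using chart_inv[OF U x] by (simp add: f_def o_def)
      have "x \<otimes> \<one> \<in> U" using x xG by simp
      from tangent_map_coord[OF smooth_manifold_axioms mdiff_left_translation[OF xG one_closed] u V U this]
      show ?thesis
        using frechet_derivative_at[OF \<Lambda>d, of "\<phi> x"] x by (simp add: eq)
    qed
  qed
qed

end

section \<open>The projection onto the coset space\<close>

text \<open>Other charts differ from the given ones by smooth transition maps.\<close>

lemma mdiff_one_chart:
  assumes "smooth_manifold X A" "smooth_manifold Y B" "p \<in> topspace X" "f p \<in> topspace Y"
    and nbhd: "\<And>W. openin Y W \<Longrightarrow> f p \<in> W \<Longrightarrow> \<exists>N. openin X N \<and> p \<in> N \<and> f ` N \<subseteq> W"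
    and U: "(U, \<phi>) \<in> A" "p \<in> U" and V: "(V, \<psi>) \<in> B" "f p \<in> V"
    and d: "(\<psi> \<circ> f \<circ> inv_into U \<phi>) differentiable at (\<phi> p)"
  shows "mdiff X A Y B f p"
proof (rule mdiffI[OF assms(3,4) nbhd])
  interpret M: smooth_manifold X A by fact
  interpret N: smooth_manifold Y B by fact
  fix U1 \<phi>1 V1 \<psi>1
  assume U1: "(U1, \<phi>1) \<in> A" "p \<in> U1" and V1: "(V1, \<psi>1) \<in> B" "f p \<in> V1"
  obtain N where N: "openin X N" "p \<in> N" "f ` N \<subseteq> V" using nbhd[OF N.chart_openin[OF V(1)] V(2)] by blast
  have 1: "(\<phi> \<circ> inv_into U1 \<phi>1) differentiable at (\<phi>1 p)" by (rule M.transition_differentiable[OF U1 U])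
  have 2: "(\<psi>1 \<circ> inv_into V \<psi>) differentiable at (\<psi> (f p))" by (rule N.transition_differentiable[OF V V1])
  have "(\<psi> \<circ> f \<circ> inv_into U \<phi> \<circ> (\<phi> \<circ> inv_into U1 \<phi>1)) differentiable at (\<phi>1 p)"
    by (rule differentiable_chain_at[OF 1]) (simp add: M.chart_inv[OF U1] d)
  then have "(\<psi>1 \<circ> inv_into V \<psi> \<circ> (\<psi> \<circ> f \<circ> inv_into U \<phi> \<circ> (\<phi> \<circ> inv_into U1 \<phi>1))) differentiable at (\<phi>1 p)"
    by (rule differentiable_chain_at) (simp add: M.chart_inv[OF U1] M.chart_inv[OF U] 2)
  then obtain D where D: "(\<psi>1 \<circ> inv_into V \<psi> \<circ> (\<psi> \<circ> f \<circ> inv_into U \<phi> \<circ> (\<phi> \<circ> inv_into U1 \<phi>1)) has_derivative D) (at (\<phi>1 p))"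
    unfolding differentiable_def by blast
  have "openin X (U \<inter> N)" using M.chart_openin[OF U(1)] N(1) by blast
  then have "(\<psi>1 \<circ> f \<circ> inv_into U1 \<phi>1 has_derivative D) (at (\<phi>1 p))"
    by (rule has_derivative_transform_within_open[OF D M.chart_open_vimage_inv[OF U1(1)]])
      (use U1 U N M.chart_inv[OF U1(1)] M.chart_inv[OF U(1)] N.chart_inv[OF V(1)] in auto)
  then show "(\<psi>1 \<circ> f \<circ> inv_into U1 \<phi>1) differentiable at (\<phi>1 p)" by (rule differentiableI)
qed auto

context smooth_coset_space
begin

abbreviation proj :: "'g \<Rightarrow> 'g set" where "proj \<equiv> (\<lambda>g. g <# H)"

lemma is_subgroup: "subgroup H G" by (rule subgroup_axioms)

lemma H_subset: "H \<subseteq> carrier G" by (rule subset)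

lemma act_origin: "x \<in> carrier G \<Longrightarrow> act G x (origin G H) = proj x"
  using lcos_mult_one[OF H_subset] by (simp add: act_def origin_def)

lemma act_proj: "g \<in> carrier G \<Longrightarrow> x \<in> carrier G \<Longrightarrow> act G g (proj x) = proj (g \<otimes> x)"
  using lcos_m_assoc[OF H_subset] by (simp add: act_def)

lemma proj_mult_H:
  assumes "x \<in> carrier G" "h \<in> H"
  shows "proj (x \<otimes> h) = proj x"
proof -
  have "x \<otimes> h \<in> x <# H" using assms by (auto simp: l_coset_def)
  then show ?thesis using l_repr_independence[OF _ assms(1) is_subgroup] by simp
qed

lemma proj_eqD:
  assumes "x \<in> carrier G" "y \<in> carrier G" "proj x = proj y"
  shows "inv x \<otimes> y \<in> H"
proof -
  have "y \<otimes> \<one> \<in> y <# H" unfolding l_coset_def using one_closed by blast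
  then have "y \<in> x <# H" using assms by simp
  then obtain h where h: "h \<in> H" "y = x \<otimes> h" by (auto simp: l_coset_def)
  then have "inv x \<otimes> y = h" using assms(1) mem_carrier by (simp add: m_assoc[symmetric])
  then show ?thesis using h by simp
qed

lemma topspace_proj: "topspace Y = proj ` carrier G"
  using quotient_imp_surjective_map[OF quotient_topology] topspace_carrier by simp

lemma proj_topspace: "x \<in> carrier G \<Longrightarrow> proj x \<in> topspace Y"
  using topspace_proj by simp

lemma mdiff_proj: "x \<in> carrier G \<Longrightarrow> mdiff T A Y B proj x"
  using smooth_map_mdiff[OF smooth_projection] topspace_carrier by simp

lemma proj_coord_smooth:
  assumes "(U, \<phi>) \<in> A" "(V, \<psi>) \<in> B"
  shows "open (\<phi> ` {x \<in> U. proj x \<in> V})"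
    "smooth_on (\<phi> ` {x \<in> U. proj x \<in> V}) (\<psi> \<circ> proj \<circ> inv_into U \<phi>)"
proof -
  have "continuous_map T Y proj" using smooth_projection by (simp add: smooth_map_def)
  then have "openin T {x \<in> topspace T. proj x \<in> V}"
    using coset.chart_openin[OF assms(2)] openin_continuous_map_preimage by blast
  moreover have "{x \<in> U. proj x \<in> V} = U \<inter> {x \<in> topspace T. proj x \<in> V}" using chart_subset[OF assms(1)] by auto
  ultimately have "openin T {x \<in> U. proj x \<in> V}" using chart_openin[OF assms(1)] by auto
  then show "open (\<phi> ` {x \<in> U. proj x \<in> V})"
    by (rule chart_open_image_subset[OF assms(1)]) auto
  show "smooth_on (\<phi> ` {x \<in> U. proj x \<in> V}) (\<psi> \<circ> proj \<circ> inv_into U \<phi>)"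
    by (rule smooth_map_chart[OF smooth_projection assms])
qed

text \<open>The submersion property, as a splitting of the differential in coordinates.\<close>

lemma proj_coord_right_inverse:
  assumes U: "(U, \<phi>) \<in> A" "p \<in> U" and V: "(V, \<psi>) \<in> B" "proj p \<in> V"
  obtains E where "linear E" "\<And>w. frechet_derivative (\<psi> \<circ> proj \<circ> inv_into U \<phi>) (at (\<phi> p)) (E w) = w"
proof -
  let ?D = "frechet_derivative (\<psi> \<circ> proj \<circ> inv_into U \<phi>) (at (\<phi> p))"
  have p: "p \<in> carrier G" using U chart_carrier by blast
  have lin: "linear ?D" by (rule linear_frechet_derivative[OF mdiffD(3)[OF mdiff_proj[OF p] U V]])
  have "surj ?D"
    unfolding surj_def
  proof
    fix e
    obtain w where w: "w \<in> tangent_space B (proj p)" "w (V, \<psi>) = e"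
      using coset.tangent_vector_ex[OF V] by blast
    then obtain v where v: "v \<in> tangent_space A p" "w = tangent_map A B proj p v"
      using submersion[OF p] by blast
    have "?D (v (U, \<phi>)) = e"
      using tangent_map_coord[OF smooth_manifold_axioms mdiff_proj[OF p] v(1) U V] w v by simp
    then show "\<exists>v. e = ?D v" by blast
  qed
  then obtain E where "linear E" "?D \<circ> E = id" using linear_surjective_right_inverse[OF lin] by blast
  then show ?thesis using that by (metis comp_apply id_apply)
qed

text \<open>A submersion has local sections that are differentiable at a given point: restrict the
  projection to a slice in a complement of the kernel of its differential, and invert it there.\<close>

lemma local_section:
  assumes p: "p \<in> carrier G"
  obtains V' \<sigma> where "openin Y V'" "proj p \<in> V'" "\<sigma> (proj p) = p" "mdiff Y B T A \<sigma> (proj p)"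
    "\<And>C. C \<in> V' \<Longrightarrow> \<sigma> C \<in> carrier G \<and> proj (\<sigma> C) = C"
proof -
  obtain U \<phi> where U: "(U, \<phi>) \<in> A" "p \<in> U" using chart_ex p topspace_carrier by metis
  obtain V \<psi> where V: "(V, \<psi>) \<in> B" "proj p \<in> V" using coset.chart_ex proj_topspace[OF p] by metis
  define P where "P = \<psi> \<circ> proj \<circ> inv_into U \<phi>"
  define \<Omega> where "\<Omega> = \<phi> ` {x \<in> U. proj x \<in> V}"
  note P = proj_coord_smooth[OF U(1) V(1), folded P_def \<Omega>_def]
  obtain E where E: "linear E" "\<And>w. frechet_derivative P (at (\<phi> p)) (E w) = w"
    using proj_coord_right_inverse[OF U V] unfolding P_def by blast
  have bE: "bounded_linear E" using E(1) linear_conv_bounded_linear by blast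
  \<comment> \<open>the slice, and below the projection \<open>f\<close> restricted to it, with derivative the identity at \<open>0\<close>\<close>
  define s where "s = (\<lambda>z. \<phi> p + E z)"
  have s': "(s has_derivative E) (at z)" for z
    unfolding s_def using bounded_linear_imp_has_derivative[OF bE] by (auto intro!: derivative_eq_intros)
  have s_cont: "continuous_on S s" for S
    using s' by (meson continuous_at_imp_continuous_on has_derivative_continuous)
  have s0: "s 0 = \<phi> p" by (simp add: s_def linear_0[OF E(1)])
  define O1 where "O1 = s -` \<Omega>"
  have O1: "open O1" unfolding O1_def using continuous_open_vimage[OF P(1)] s_cont 
    by (simp add: open_vimage P(1))
  define f where "f = P \<circ> s"
  define F' where "F' = (\<lambda>z w. frechet_derivative P (at (s z)) (E w))"
  have fd: "(f has_derivative F' z) (at z)" if "z \<in> O1" for z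
    using diff_chain_at[OF s'[of z] smooth_on_has_derivative[OF P(2), of "s z"]] that
    unfolding f_def F'_def O1_def o_def by simp
  define f' where "f' = (\<lambda>z. Blinfun (F' z))"
  have f': "blinfun_apply (f' z) = F' z" if "z \<in> O1" for z
    unfolding f'_def using has_derivative_bounded_linear[OF fd[OF that]] by (rule bounded_linear_Blinfun_apply)
  have "0 \<in> O1" using s0 U V by (auto simp: O1_def \<Omega>_def)
  have "continuous_on O1 (\<lambda>z. blinfun_apply (f' z) i)" for i
  proof -
    have "continuous_on O1 (\<lambda>z. F' z i)"
      unfolding F'_def
      by (rule continuous_on_compose2[OF smooth_on_continuous_on[OF smooth_on_derivative[OF P(2)]] s_cont])
        (auto simp: O1_def)
    then show ?thesis using f' by (metis (no_types, lifting) continuous_on_cong)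
  qed
  then have cf': "continuous_on O1 f'" by (intro continuous_on_blinfun_componentwise)
  have "f' 0 = id_blinfun"
    by (rule blinfun_eqI) (simp add: f'[OF \<open>0 \<in> O1\<close>] F'_def s0 E(2))
  then have inv0: "id_blinfun o\<^sub>L f' 0 = id_blinfun" by (auto intro: blinfun_eqI)
  obtain O2 W k k' where k: "open O2" "O2 \<subseteq> O1" "0 \<in> O2" "open W" "f 0 \<in> W" "homeomorphism O2 W f k"
    "\<And>y. y \<in> W \<Longrightarrow> (k has_derivative (k' y)) (at y)"
    using inverse_function_theorem[OF O1 _ cf' \<open>0 \<in> O1\<close> inv0, of f] fd f' by metis
  have kf: "k (f z) = z" if "z \<in> O2" for z using k(6) that by (simp add: homeomorphism_apply1)
  have fk: "f (k y) = y" if "y \<in> W" for y using k(6) that by (simp add: homeomorphism_apply2)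
  have kO2: "k y \<in> O2" if "y \<in> W" for y using k(6) that unfolding homeomorphism_def by blast
  have f0: "f 0 = \<psi> (proj p)" by (simp add: f_def s0 P_def chart_inv[OF U])
  have k0: "k (\<psi> (proj p)) = 0" using kf[OF k(3)] f0 by simp
  define V' where "V' = {C \<in> V. \<psi> C \<in> W}"
  define \<sigma> where "\<sigma> = (\<lambda>C. inv_into U \<phi> (s (k (\<psi> C))))"
  have \<sigma>U: "s (k (\<psi> C)) \<in> \<Omega>" if "C \<in> V'" for C
    using kO2 that k(2) by (auto simp: V'_def O1_def)
  have inv\<Omega>: "inv_into U \<phi> y \<in> U" "proj (inv_into U \<phi> y) \<in> V" "\<phi> (inv_into U \<phi> y) = y" if "y \<in> \<Omega>" for y
    using that chart_inv[OF U(1)] by (auto simp: \<Omega>_def)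
  have sec: "\<sigma> C \<in> carrier G \<and> proj (\<sigma> C) = C" if C: "C \<in> V'" for C
  proof -
    have "\<psi> (proj (\<sigma> C)) = \<psi> C"
      using fk[of "\<psi> C"] C by (simp add: f_def P_def \<sigma>_def V'_def)
    moreover have "proj (\<sigma> C) \<in> V" "C \<in> V" using inv\<Omega>(2)[OF \<sigma>U[OF C]] C by (auto simp: \<sigma>_def V'_def)
    ultimately have "proj (\<sigma> C) = C" using coset.chart_inj[OF V(1)] by (meson inj_onD)
    then show ?thesis using inv\<Omega>(1)[OF \<sigma>U[OF C]] chart_carrier[OF U(1)] by (auto simp: \<sigma>_def)
  qed
  have \<sigma>0: "\<sigma> (proj p) = p" by (simp add: \<sigma>_def k0 s0 chart_inv[OF U])
  have V'0: "proj p \<in> V'" using V f0 k(5) by (simp add: V'_def)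
  have V'o: "openin Y V'" unfolding V'_def by (rule coset.chart_openin_vimage[OF V(1) k(4)])
  have kc: "continuous_on W k" using k(6) by (simp add: homeomorphism_def)
  have "mdiff Y B T A \<sigma> (proj p)"
  proof (rule mdiff_one_chart[OF coset.smooth_manifold_axioms smooth_manifold_axioms proj_topspace[OF p] _ _ V, where V = U and \<psi> = \<phi>])
    show "\<sigma> (proj p) \<in> topspace T" using p \<sigma>0 topspace_carrier by simp
    show "(U, \<phi>) \<in> A" "\<sigma> (proj p) \<in> U" using U \<sigma>0 by auto
    fix N assume N: "openin T N" "\<sigma> (proj p) \<in> N"
    let ?Q = "{y \<in> \<phi> ` U. inv_into U \<phi> y \<in> N}"
    have Q: "open ?Q" by (rule chart_open_vimage_inv[OF U(1) N(1)])
    have "continuous_on W (\<lambda>y. s (k y))"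
      using continuous_on_compose2[OF s_cont[of UNIV] kc] by simp
    then have "open (W \<inter> (\<lambda>y. s (k y)) -` ?Q)"
      using continuous_open_preimage k(4) Q by blast
    then have "openin Y {C \<in> V. \<psi> C \<in> W \<inter> (\<lambda>y. s (k y)) -` ?Q}" by (rule coset.chart_openin_vimage[OF V(1)])
    moreover have "proj p \<in> {C \<in> V. \<psi> C \<in> W \<inter> (\<lambda>y. s (k y)) -` ?Q}"
      using V'0 N(2) \<sigma>0 k0 s0 U chart_inv[OF U] by (auto simp: V'_def)
    moreover have "\<sigma> ` {C \<in> V. \<psi> C \<in> W \<inter> (\<lambda>y. s (k y)) -` ?Q} \<subseteq> N" by (auto simp: \<sigma>_def)
    ultimately show "\<exists>M. openin Y M \<and> proj p \<in> M \<and> \<sigma> ` M \<subseteq> N" by blast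
  next
    have d: "((\<lambda>y. s (k y)) has_derivative (\<lambda>v. E (k' (\<psi> (proj p)) v))) (at (\<psi> (proj p)))"
      using has_derivative_compose[OF k(7) s'] k(5) f0 by simp
    have "(\<phi> \<circ> \<sigma> \<circ> inv_into V \<psi> has_derivative (\<lambda>v. E (k' (\<psi> (proj p)) v))) (at (\<psi> (proj p)))"
    proof (rule has_derivative_transform_within_open[OF d coset.chart_open_vimage_inv[OF V(1) V'o]])
      show "\<psi> (proj p) \<in> {y \<in> \<psi> ` V. inv_into V \<psi> y \<in> V'}"
        using V V'0 coset.chart_inv[OF V] by auto
      fix y assume y: "y \<in> {y \<in> \<psi> ` V. inv_into V \<psi> y \<in> V'}"
      then have "\<psi> (inv_into V \<psi> y) = y" by (simp add: f_inv_into_f)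
      then show "s (k y) = (\<phi> \<circ> \<sigma> \<circ> inv_into V \<psi>) y"
        using inv\<Omega>(3)[OF \<sigma>U, of "inv_into V \<psi> y"] y by (simp add: \<sigma>_def)
    qed
    then show "(\<phi> \<circ> \<sigma> \<circ> inv_into V \<psi>) differentiable at (\<psi> (proj p))" by (rule differentiableI)
  qed
  then show ?thesis using that[OF V'o V'0 \<sigma>0 _ sec] by blast
qed

text \<open>Locally the action of \<open>g\<close> is \<open>proj \<circ> L\<^sub>g \<circ> \<sigma>\<close> for a local section \<open>\<sigma>\<close>.\<close>

lemma mdiff_act:
  assumes g: "g \<in> carrier G" and x: "x \<in> carrier G"
  shows "mdiff Y B Y B (act G g) (proj x)"
proof -
  obtain V' \<sigma> where V': "openin Y V'" "proj x \<in> V'" "\<sigma> (proj x) = x" "mdiff Y B T A \<sigma> (proj x)"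
    "\<And>C. C \<in> V' \<Longrightarrow> \<sigma> C \<in> carrier G \<and> proj (\<sigma> C) = C" using local_section[OF x] by blast
  have "mdiff Y B T A ((\<lambda>x. g \<otimes> x) \<circ> \<sigma>) (proj x)"
    by (rule mdiff_compose[OF coset.smooth_manifold_axioms smooth_manifold_axioms V'(4)])
      (simp add: V'(3) mdiff_left_translation g x)
  then have "mdiff Y B Y B (proj \<circ> ((\<lambda>x. g \<otimes> x) \<circ> \<sigma>)) (proj x)"
    by (rule mdiff_compose[OF coset.smooth_manifold_axioms smooth_manifold_axioms])
      (simp add: V'(3) mdiff_proj g x)
  then show ?thesis
    by (rule coset.mdiff_cong[OF _ V'(1,2)]) (use V'(5) act_proj[OF g] in fastforce)
qed

text \<open>Differentiate \<open>act g \<circ> proj = proj \<circ> L\<^sub>g\<close>.\<close>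

lemma tangent_map_act_proj:
  assumes g: "g \<in> carrier G" and x: "x \<in> carrier G" and v: "v \<in> tangent_space A x"
  shows "tangent_map B B (act G g) (proj x) (tangent_map A B proj x v) =
    tangent_map A B proj (g \<otimes> x) (tangent_map A A (\<lambda>x. g \<otimes> x) x v)"
proof -
  have gx: "g \<otimes> x \<in> carrier G" using g x by simp
  have m: "mdiff T A Y B (proj \<circ> (\<lambda>x. g \<otimes> x)) x"
    by (rule mdiff_compose[OF smooth_manifold_axioms smooth_manifold_axioms mdiff_left_translation[OF g x] mdiff_proj[OF gx]])
  have "tangent_map A B (act G g \<circ> proj) x v = tangent_map A B (proj \<circ> (\<lambda>x. g \<otimes> x)) x v"
    by (rule tangent_map_cong[OF smooth_manifold_axioms m v openin_topspace, symmetric])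
      (use x act_proj[OF g] topspace_carrier in auto)
  then show ?thesis
    by (simp add: tangent_map_compose[OF smooth_manifold_axioms coset.smooth_manifold_axioms coset.smooth_manifold_axioms mdiff_proj[OF x] mdiff_act[OF g x] v]
      tangent_map_compose[OF smooth_manifold_axioms smooth_manifold_axioms coset.smooth_manifold_axioms mdiff_left_translation[OF g x] mdiff_proj[OF gx] v])
qed

end

section \<open>The kernel of the differential of the projection\<close>

lemma eq_on_interval_of_derivative:
  fixes f g :: "real \<Rightarrow> 'a::euclidean_space"
  assumes "\<And>t. t \<in> {a<..<b} \<Longrightarrow> (f has_vector_derivative D t) (at t)"
    and "\<And>t. t \<in> {a<..<b} \<Longrightarrow> (g has_vector_derivative D t) (at t)"
    and "s \<in> {a<..<b}" "f s = g s" "t \<in> {a<..<b}"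
  shows "f t = g t"
proof -
  have "((\<lambda>t. f t - g t) has_vector_derivative 0) (at t within {a<..<b})" if "t \<in> {a<..<b}" for t
    using has_vector_derivative_diff[OF assms(1,2)[OF that]] by (simp add: has_vector_derivative_at_within)
  then obtain k where "\<And>t. t \<in> {a<..<b} \<Longrightarrow> f t - g t = k"
    using has_vector_derivative_zero_constant[of "{a<..<b}" "\<lambda>t. f t - g t"] by auto
  then have "f t - g t = f s - g s" using assms(3,5) by metis
  then show ?thesis using assms(4) by simp
qed

lemma (in smooth_manifold) tangent_map_id:
  assumes "v \<in> tangent_space A p" "p \<in> topspace X"
  shows "tangent_map A A id p v = v"
proof -
  obtain U \<phi> where U: "(U, \<phi>) \<in> A" "p \<in> U" using chart_ex assms(2) by metis
  have "tangent_map A A id p v \<in> tangent_space A p"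
    using tangent_map_in[OF smooth_manifold_axioms smooth_manifold_axioms mdiff_id assms(1)] assms(2) by simp
  then show ?thesis
    by (rule tangent_space_eqI[OF _ assms(1) U])
      (use tangent_map_coord[OF smooth_manifold_axioms mdiff_id assms(1) U U(1)] U(2) assms(2)
        chart_transition_self[OF U] in simp)
qed

lemma (in lie_group) tangent_map_left_translation_inv:
  assumes g: "g \<in> carrier G" and x: "x \<in> carrier G" and v: "v \<in> tangent_space A x"
  shows "tangent_map A A (\<lambda>z. inv g \<otimes> z) (g \<otimes> x) (tangent_map A A (\<lambda>z. g \<otimes> z) x v) = v"
proof -
  have gx: "g \<otimes> x \<in> carrier G" and g': "inv g \<in> carrier G" using g x by auto
  have "tangent_map A A (\<lambda>z. inv g \<otimes> z) (g \<otimes> x) (tangent_map A A (\<lambda>z. g \<otimes> z) x v) =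
      tangent_map A A ((\<lambda>z. inv g \<otimes> z) \<circ> (\<lambda>z. g \<otimes> z)) x v"
    by (rule tangent_map_compose[OF smooth_manifold_axioms smooth_manifold_axioms smooth_manifold_axioms
          mdiff_left_translation[OF g x] mdiff_left_translation[OF g' gx] v, symmetric])
  also have "\<dots> = tangent_map A A id x v"
    by (rule tangent_map_cong[OF smooth_manifold_axioms mdiff_id v openin_topspace, symmetric])
      (use g x topspace_carrier in \<open>auto simp: m_assoc[symmetric]\<close>)
  also have "\<dots> = v" using tangent_map_id[OF v] x topspace_carrier by simp
  finally show ?thesis .
qed

context smooth_coset_space
begin

lemma one_carrier: "\<one> \<in> carrier G" by simp

lemma velocity_const: "velocity B (\<lambda>t. C) t = 0"
  by (auto simp: velocity_def o_def)

text \<open>A curve in \<open>H\<close> has constant projection.\<close>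

lemma Lie_sub_in_kernel:
  assumes "v \<in> Lie_sub G T A H"
  shows "v \<in> tangent_space A \<one>" "tangent_map A B proj \<one> v = 0"
proof -
  obtain \<gamma> e where \<gamma>: "v = velocity A \<gamma> 0" "e > 0" "smooth_curve T A {-e<..<e} \<gamma>" "\<gamma> 0 = \<one>"
    "\<gamma> ` {-e<..<e} \<subseteq> H"
    using assms unfolding Lie_sub_def by blast
  have 0: "0 \<in> {-e<..<e}" using \<gamma>(2) by simp
  have m: "curve_mdiff T A \<gamma> 0" by (rule smooth_curve_mdiff[OF \<gamma>(3) open_greaterThanLessThan 0])
  show "v \<in> tangent_space A \<one>"
    using velocity_in_tangent_space[OF smooth_manifold_axioms m] \<gamma>(1,4) by simp
  have p: "mdiff T A Y B proj (\<gamma> 0)" using mdiff_proj \<gamma>(4) by simp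
  note vc = velocity_compose[OF smooth_manifold_axioms coset.smooth_manifold_axioms m p]
  have "(proj \<circ> \<gamma>) s = proj \<one>" if "s \<in> {-e<..<e}" for s
    using proj_mult_H[OF one_carrier, of "\<gamma> s"] \<gamma>(5) that mem_carrier by (auto simp: image_subset_iff)
  then have "velocity B (proj \<circ> \<gamma>) 0 = velocity B (\<lambda>t. proj \<one>) 0"
    by (intro velocity_cong(2)[OF vc(1) open_greaterThanLessThan 0]) auto
  then show "tangent_map A B proj \<one> v = 0" using vc(2) \<gamma>(1,4) velocity_const by simp
qed

text \<open>The curve in \<open>H\<close> is an integral curve. In coordinates \<open>P\<close> of the
  projection choose a right inverse \<open>E\<close> of \<open>DP\<close> at the identity; then
  \<open>F y = v - E ((DP y \<circ> E)\<^sup>-\<^sup>1 (DP y v))\<close> is a vector field tangent to the fibres of \<open>P\<close> that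
  takes the value \<open>v\<close> at the identity, and its integral curve stays in the fibre \<open>H\<close>.\<close>

lemma kernel_in_Lie_sub:
  assumes v: "v \<in> tangent_space A \<one>" and ker: "tangent_map A B proj \<one> v = 0"
  shows "v \<in> Lie_sub G T A H"
proof -
  obtain U \<phi> where U: "(U, \<phi>) \<in> A" "\<one> \<in> U" using chart_ex topspace_carrier one_carrier by metis
  obtain V \<psi> where V: "(V, \<psi>) \<in> B" "proj \<one> \<in> V" using coset.chart_ex proj_topspace[OF one_carrier] by metis
  define P where "P = \<psi> \<circ> proj \<circ> inv_into U \<phi>"
  define \<Omega> where "\<Omega> = \<phi> ` {x \<in> U. proj x \<in> V}"
  define D where "D = (\<lambda>y. frechet_derivative P (at y))"
  note P = proj_coord_smooth[OF U(1) V(1), folded P_def \<Omega>_def]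
  obtain E where E: "linear E" "\<And>w. D (\<phi> \<one>) (E w) = w"
    using proj_coord_right_inverse[OF U V] unfolding P_def D_def by blast
  define v0 where "v0 = v (U, \<phi>)"
  have Dlin: "linear (D y)" if "y \<in> \<Omega>" for y
    unfolding D_def by (rule smooth_on_linear_derivative[OF P(2) that])
  have Dsm: "smooth_on \<Omega> (\<lambda>y. D y w)" for w unfolding D_def by (rule smooth_on_derivative[OF P(2)])
  define Z where "Z = (\<lambda>y w. D y (E w))"
  have Zlin: "linear (Z y)" if "y \<in> \<Omega>" for y
    unfolding Z_def using linear_compose[OF E(1) Dlin[OF that]] by (simp add: o_def)
  have y0: "\<phi> \<one> \<in> \<Omega>" using U V by (auto simp: \<Omega>_def)
  have inj0: "inj (Z (\<phi> \<one>))" using E(2) by (auto simp: Z_def inj_def)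
  have Zcont: "continuous_on \<Omega> (\<lambda>y. Z y w)" for w
    unfolding Z_def by (rule smooth_on_continuous_on[OF Dsm])
  obtain S m where S: "open S" "\<phi> \<one> \<in> S" "S \<subseteq> \<Omega>" "m > 0" "\<And>y w. y \<in> S \<Longrightarrow> m * norm w \<le> norm (Z y w)"
    using injective_family_lower_bound[of \<Omega> "\<phi> \<one>" Z, OF P(1) y0 Zlin Zcont inj0] by blast
  have Zinj: "inj (Z y)" if y: "y \<in> S" for y
  proof -
    have "linear (Z y)" using Zlin y S(3) by blast
    moreover have "w = 0" if "Z y w = 0" for w
    proof -
      have "m * norm w \<le> 0" using S(5)[OF y, of w] that by simp
      then show ?thesis using S(4) by (simp add: mult_le_0_iff)
    qed
    ultimately show ?thesis using linear_injective_0 by blast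
  qed
  define F where "F = (\<lambda>y. v0 - E (linv (Z y) (D y v0)))"
  have sub: "smooth_on S f" if "smooth_on \<Omega> f" for f :: "'e \<Rightarrow> 'f"
    by (rule smooth_on_subset[OF that S(3)])
  have ZlinS: "linear (Z y)" if "y \<in> S" for y using Zlin S(3) that by blast
  have Zinv: "smooth_on S (\<lambda>y. linv (Z y) (D y v0))"
    by (rule smooth_on_inverse_family[OF S(1) ZlinS Zinj _ sub[OF Dsm]])
      (auto simp: Z_def intro: sub[OF Dsm])
  have bE: "bounded_linear E" using E(1) linear_conv_bounded_linear by blast
  have F: "smooth_on S F"
    unfolding F_def
    by (rule smooth_on_diff[OF S(1) smooth_on_const[OF S(1)] smooth_on_linear_compose[OF S(1) bE Zinv]])
  obtain e d where ed: "e > 0" "d > 0" "\<And>x1. x1 \<in> ball (\<phi> \<one>) d \<Longrightarrow> \<exists>x. x 0 = x1 \<and>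
       (\<forall>t\<in>{-e<..<e}. x t \<in> S \<and> (x has_vector_derivative F (x t)) (at t))"
    using ode_existence[OF S(1) F S(2)] by blast
  obtain y where y: "y 0 = \<phi> \<one>" "\<And>t. t \<in> {-e<..<e} \<Longrightarrow> y t \<in> S \<and> (y has_vector_derivative F (y t)) (at t)"
    using ed(3)[of "\<phi> \<one>"] ed(2) by auto
  let ?J = "{-e<..<e}"
  have 0: "0 \<in> ?J" using ed(1) by simp
  have ysm: "smooth_on ?J y" by (rule ode_solution_smooth[OF S(1) F open_greaterThanLessThan y(2)])
  have y\<Omega>: "y t \<in> \<Omega>" if "t \<in> ?J" for t using y(2)[OF that] S(3) by blast
  then have yU: "y ` ?J \<subseteq> \<phi> ` U" unfolding \<Omega>_def by blast
  define \<gamma> where "\<gamma> = inv_into U \<phi> \<circ> y"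
  have \<gamma>: "smooth_curve T A ?J \<gamma>"
    unfolding \<gamma>_def by (rule smooth_curve_in_chart[OF open_greaterThanLessThan U(1) ysm yU])
  have \<gamma>0: "\<gamma> 0 = \<one>" by (simp add: \<gamma>_def y(1) chart_inv[OF U])
  have \<phi>\<gamma>: "\<phi> (\<gamma> t) = y t" "\<gamma> t \<in> U" "proj (\<gamma> t) \<in> V" if "t \<in> ?J" for t
    using y\<Omega>[OF that] chart_inv[OF U(1)] by (auto simp: \<gamma>_def \<Omega>_def)
  have Pconst: "P (y t) = P (\<phi> \<one>)" if t: "t \<in> ?J" for t
  proof (rule eq_on_interval_of_derivative[of "-e" e "\<lambda>t. P (y t)" "\<lambda>_. 0" "\<lambda>_. P (\<phi> \<one>)" 0 t])
    fix s assume s: "s \<in> {-e<..<e}"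
    have "((\<lambda>t. P (y t)) has_vector_derivative D (y s) (F (y s))) (at s)"
      using vector_derivative_diff_chain_within[of y "F (y s)" s UNIV P "D (y s)"]
        y(2)[OF s] smooth_on_has_derivative[OF P(2) y\<Omega>[OF s]] has_derivative_at_withinI
      unfolding D_def o_def by auto
    moreover have "D (y s) (F (y s)) = 0"
      using linear_inj_imp_inv(2)[OF ZlinS Zinj, of "y s"] y(2)[OF s] linear_diff[OF Dlin[OF y\<Omega>[OF s]]]
      by (simp add: F_def Z_def)
    ultimately show "((\<lambda>t. P (y t)) has_vector_derivative 0) (at s)" by simp
  qed (use 0 t y(1) in auto)
  have "\<gamma> t \<in> H" if t: "t \<in> ?J" for t
  proof -
    have "\<psi> (proj (\<gamma> t)) = \<psi> (proj \<one>)"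
      using Pconst[OF t] by (simp add: P_def \<gamma>_def chart_inv[OF U])
    then have "proj (\<gamma> t) = proj \<one>"
      using coset.chart_inj[OF V(1)] \<phi>\<gamma>(3)[OF t] V(2) by (meson inj_onD)
    moreover have "\<gamma> t \<in> carrier G" using \<phi>\<gamma>(2)[OF t] chart_carrier[OF U(1)] by blast
    ultimately show ?thesis using proj_eqD[OF one_carrier, of "\<gamma> t"] by simp
  qed
  moreover have "velocity A \<gamma> 0 = v"
  proof (rule tangent_space_eqI[OF _ v U])
    have m: "curve_mdiff T A \<gamma> 0" by (rule smooth_curve_mdiff[OF \<gamma> open_greaterThanLessThan 0])
    show "velocity A \<gamma> 0 \<in> tangent_space A \<one>"
      using velocity_in_tangent_space[OF smooth_manifold_axioms m] \<gamma>0 by simp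
    have "(\<phi> \<circ> \<gamma> has_vector_derivative F (y 0)) (at 0)"
      by (rule has_vector_derivative_transform_within_open[OF conjunct2[OF y(2)[OF 0]] open_greaterThanLessThan 0])
        (use \<phi>\<gamma>(1) in auto)
    then have "velocity A \<gamma> 0 (U, \<phi>) = F (\<phi> \<one>)"
      using curve_mdiff_vector_derivative[OF m U(1)] U(2) \<gamma>0 y(1) vector_derivative_unique_at by metis
    also have "D (\<phi> \<one>) v0 = 0"
      using tangent_map_coord[OF smooth_manifold_axioms mdiff_proj[OF one_carrier] v U V] ker
      by (simp add: D_def P_def v0_def)
    then have "F (\<phi> \<one>) = v (U, \<phi>)"
      using linear_0[OF linear_inj_imp_inv(1)[OF Zlin[OF y0] inj0]] linear_0[OF E(1)]
      by (simp add: F_def v0_def)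
    finally show "velocity A \<gamma> 0 (U, \<phi>) = v (U, \<phi>)" .
  qed
  ultimately show ?thesis
    unfolding Lie_sub_def using ed(1) \<gamma> \<gamma>0 by (intro CollectI exI[of _ \<gamma>]) (auto intro!: exI[of _ e])
qed

context
  fixes \<mm> :: "('g, 'e) tangent_vector set"
  assumes dec: "linear_decomposition G T A H \<mm>"
begin

lemma complement_tangent: "u \<in> \<mm> \<Longrightarrow> u \<in> tangent_space A \<one>"
proof -
  assume u: "u \<in> \<mm>"
  have "0 \<in> Lie_sub G T A H" using dec unfolding linear_decomposition_def by blast
  then have "0 + u \<in> Lie_sub G T A H + \<mm>" using u by (rule set_plus_intro)
  then show ?thesis using dec unfolding linear_decomposition_def Lie_def by simp
qed

lemma complement_kernel:
  assumes "u \<in> \<mm>" "tangent_map A B proj \<one> u = 0"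
  shows "u = 0"
  using kernel_in_Lie_sub[OF complement_tangent assms(2)] assms(1) dec
  unfolding linear_decomposition_def by blast

text \<open>In coordinates, the complement is the image of a linear injection of the model space of the
  quotient: the inverse of the restriction of the differential of the projection.\<close>

lemma complement_coordinates:
  assumes U: "(U, \<phi>) \<in> A" "\<one> \<in> U"
  obtains E :: "'f \<Rightarrow> 'e" where "linear E" "\<And>w. E w = 0 \<Longrightarrow> w = 0"
    "\<And>w. \<exists>u\<in>\<mm>. u (U, \<phi>) = E w" "\<And>u. u \<in> \<mm> \<Longrightarrow> \<exists>w. u (U, \<phi>) = E w"
proof -
  obtain V \<psi> where V: "(V, \<psi>) \<in> B" "proj \<one> \<in> V" using coset.chart_ex proj_topspace[OF one_carrier] by metis
  define D where "D = frechet_derivative (\<psi> \<circ> proj \<circ> inv_into U \<phi>) (at (\<phi> \<one>))"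
  have Dlin: "linear D"
    unfolding D_def by (rule linear_frechet_derivative[OF mdiffD(3)[OF mdiff_proj[OF one_carrier] U V]])
  have D: "D (u (U, \<phi>)) = tangent_map A B proj \<one> u (V, \<psi>)" if "u \<in> tangent_space A \<one>" for u
    unfolding D_def
    by (rule tangent_map_coord[OF smooth_manifold_axioms mdiff_proj[OF one_carrier] that U V, symmetric])
  have ker0: "u = 0" if u: "u \<in> \<mm>" "D (u (U, \<phi>)) = 0" for u
  proof (rule complement_kernel[OF u(1)])
    have uT: "u \<in> tangent_space A \<one>" by (rule complement_tangent[OF u(1)])
    show "tangent_map A B proj \<one> u = 0"
      by (rule tangent_space_eqI[OF tangent_map_in[OF smooth_manifold_axioms coset.smooth_manifold_axioms
              mdiff_proj[OF one_carrier] uT] coset.tangent_space_zero[OF proj_topspace[OF one_carrier]] V])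
        (use D[OF uT] u(2) in simp)
  qed
  define M where "M = (\<lambda>u. u (U, \<phi>)) ` \<mm>"
  have sm: "subspace \<mm>" using dec by (simp add: linear_decomposition_def)
  have M: "subspace M"
  proof (rule subspaceI)
    show "0 \<in> M" using subspace_0[OF sm] by (auto simp: M_def intro!: image_eqI[of _ _ 0])
    show "x + y \<in> M" if xy: "x \<in> M" "y \<in> M" for x y
    proof -
      obtain u w where "u \<in> \<mm>" "w \<in> \<mm>" "x = u (U, \<phi>)" "y = w (U, \<phi>)" using xy by (auto simp: M_def)
      then show ?thesis
        using subspace_add[OF sm, of u w] by (auto simp: M_def intro!: image_eqI[of _ _ "u + w"])
    qed
    show "c *\<^sub>R x \<in> M" if x: "x \<in> M" for c x
    proof -
      obtain u where "u \<in> \<mm>" "x = u (U, \<phi>)" using x by (auto simp: M_def)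
      then show ?thesis
        using subspace_scale[OF sm, of u c]
        by (auto simp: M_def scaleR_fun_def intro!: image_eqI[of _ _ "c *\<^sub>R u"])
    qed
  qed
  have onto: "D ` M = UNIV"
  proof (rule UNIV_eq_I[symmetric])
    fix e
    obtain w where w: "w \<in> tangent_space B (proj \<one>)" "w (V, \<psi>) = e"
      using coset.tangent_vector_ex[OF V] by blast
    then obtain v where v: "v \<in> tangent_space A \<one>" "w = tangent_map A B proj \<one> v"
      using submersion[OF one_carrier] by blast
    then obtain k u where ku: "k \<in> Lie_sub G T A H" "u \<in> \<mm>" "v = k + u"
      using dec unfolding linear_decomposition_def Lie_def by (metis set_plus_elim)
    have "D (k (U, \<phi>)) = 0" using D Lie_sub_in_kernel[OF ku(1)] by simp
    then have "D (u (U, \<phi>)) = D (v (U, \<phi>))" using ku(3) linear_add[OF Dlin] by simp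
    also have "\<dots> = e" using D[OF v(1)] v(2) w(2) by simp
    finally show "e \<in> D ` M" using ku(2) by (auto simp: M_def)
  qed
  obtain E where E: "range E \<subseteq> M" "linear E" "\<And>w. D (E w) = w"
    using linear_exists_right_inverse_on[OF Dlin M] onto by auto
  show ?thesis
  proof (rule that[OF E(2)])
    show "w = 0" if "E w = 0" for w using E(3)[of w] that linear_0[OF Dlin] by simp
    show ex: "\<exists>u\<in>\<mm>. u (U, \<phi>) = E w" for w
    proof -
      have "E w \<in> M" using E(1) by blast
      then show ?thesis by (auto simp: M_def)
    qed
    show "\<exists>w. u (U, \<phi>) = E w" if u: "u \<in> \<mm>" for u
    proof -
      obtain u' where u': "u' \<in> \<mm>" "u' (U, \<phi>) = E (D (u (U, \<phi>)))" using ex by blast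
      have "D ((u - u') (U, \<phi>)) = 0" using E(3) u'(2) linear_diff[OF Dlin] by simp
      then have "u - u' = 0" using ker0[OF subspace_diff[OF sm u u'(1)]] by blast
      then show ?thesis using u'(2) by auto
    qed
  qed
qed

end

end

section \<open>Horizontal lifts as solutions of a differential equation\<close>

locale horizontal_lifting = smooth_coset_space G T A H Y B
  for G :: "('g, 'z) monoid_scheme" (structure)
    and T :: "'g topology" and A :: "('g, 'e::euclidean_space) chart set"
    and H :: "'g set"
    and Y :: "'g set topology" and B :: "('g set, 'f::euclidean_space) chart set" +
  fixes \<mm> :: "('g, 'e) tangent_vector set" and c :: "real \<Rightarrow> 'g set" and I :: "real set"
  assumes dec: "linear_decomposition G T A H \<mm>"
    and open_I: "open I"
    and smooth_c: "smooth_curve Y B I c"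
begin

definition hlift :: "real set \<Rightarrow> (real \<Rightarrow> 'g) \<Rightarrow> bool"
  where "hlift J x \<longleftrightarrow> smooth_curve T A J x \<and>
    (\<forall>t\<in>J. proj (x t) = c t \<and>
      tangent_map A A (\<lambda>z. inv (x t) \<otimes> z) (x t) (velocity A x t) \<in> \<mm>)"

lemma smooth_curve_carrier: "smooth_curve T A J x \<Longrightarrow> t \<in> J \<Longrightarrow> x t \<in> carrier G"
  using topspace_carrier by (auto simp: smooth_curve_def continuous_map_def)

lemma hlift_smooth: "hlift J x \<Longrightarrow> smooth_curve T A J x"
  by (simp add: hlift_def)

lemma hlift_carrier: "hlift J x \<Longrightarrow> t \<in> J \<Longrightarrow> x t \<in> carrier G"
  by (rule smooth_curve_carrier[OF hlift_smooth])

lemma hliftD: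
  assumes "hlift J x" "t \<in> J"
  shows "proj (x t) = c t" "tangent_map A A (\<lambda>z. inv (x t) \<otimes> z) (x t) (velocity A x t) \<in> \<mm>"
  using assms by (auto simp: hlift_def)

lemma hlift_mdiff: "hlift J x \<Longrightarrow> open J \<Longrightarrow> t \<in> J \<Longrightarrow> curve_mdiff T A x t"
  by (rule smooth_curve_mdiff[OF hlift_smooth])

lemma hlift_velocity:
  assumes "hlift J x" "open J" "t \<in> J"
  shows "tangent_map A B proj (x t) (velocity A x t) = velocity B c t"
proof -
  have m: "curve_mdiff T A x t" by (rule hlift_mdiff[OF assms])
  note v = velocity_compose[OF smooth_manifold_axioms coset.smooth_manifold_axioms m mdiff_proj[OF hlift_carrier[OF assms(1,3)]]]
  show ?thesis
    unfolding v(2)[symmetric]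
    by (rule velocity_cong(2)[OF v(1) assms(2,3)]) (use hliftD(1)[OF assms(1)] in simp)
qed

lemma left_trivialized_velocity:
  assumes x: "x \<in> carrier G" and v: "v \<in> tangent_space A x"
  defines "u \<equiv> tangent_map A A (\<lambda>z. inv x \<otimes> z) x v"
  shows "u \<in> tangent_space A \<one>" "tangent_map A A (\<lambda>z. x \<otimes> z) \<one> u = v"
proof -
  have x': "inv x \<in> carrier G" using x by simp
  show "u \<in> tangent_space A \<one>"
    unfolding u_def
    using tangent_map_in[OF smooth_manifold_axioms smooth_manifold_axioms mdiff_left_translation[OF x' x] v] x by simp
  show "tangent_map A A (\<lambda>z. x \<otimes> z) \<one> u = v"
    unfolding u_def using tangent_map_left_translation_inv[OF x' x v] x by simp
qed

text \<open>Let \<open>\<Lambda> y\<close> be the differential of left translation in coordinates, \<open>E\<close> the parametrisation of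
  \<open>\<mm>\<close>, \<open>P\<close> the projection and \<open>\<gamma>\<close> the curve in coordinates. A curve \<open>y\<close> is horizontal iff
  \<open>y' = \<Lambda> y (E w)\<close> for some \<open>w\<close>, and, if it starts over \<open>\<gamma>\<close>, lifts it iff \<open>DP y y' = \<gamma>'\<close>. Since \<open>Z y = DP y \<circ> \<Lambda> y \<circ> E\<close> is
  invertible, both together say \<open>y' = \<Lambda> y (E ((Z y)\<^sup>-\<^sup>1 \<gamma>'))\<close>.\<close>

lemma lift_ode:
  assumes t0: "t0 \<in> I" and p0: "p0 \<in> carrier G" "proj p0 = c t0"
  obtains U \<phi> S F where "(U, \<phi>) \<in> A" "p0 \<in> U" "open S" "(t0, \<phi> p0) \<in> S" "smooth_on S F"
    "\<And>t y. (t, y) \<in> S \<Longrightarrow> t \<in> I \<and> y \<in> \<phi> ` U"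
    "\<And>J x t. open J \<Longrightarrow> t \<in> J \<Longrightarrow> hlift J x \<Longrightarrow> x t \<in> U \<Longrightarrow> (t, \<phi> (x t)) \<in> S \<Longrightarrow>
      (\<phi> \<circ> x has_vector_derivative F (t, \<phi> (x t))) (at t)"
    "\<And>a b t1 y. t1 \<in> {a<..<b} \<Longrightarrow>
      (\<And>t. t \<in> {a<..<b} \<Longrightarrow> (t, y t) \<in> S \<and> (y has_vector_derivative F (t, y t)) (at t)) \<Longrightarrow>
      proj (inv_into U \<phi> (y t1)) = c t1 \<Longrightarrow> hlift {a<..<b} (inv_into U \<phi> \<circ> y)"
proof -
  obtain U \<phi> where U: "(U, \<phi>) \<in> A" "p0 \<in> U" using chart_ex p0(1) topspace_carrier by metis
  obtain U0 \<phi>0 where U0: "(U0, \<phi>0) \<in> A" "\<one> \<in> U0" using chart_ex one_carrier topspace_carrier by metis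
  obtain V \<psi> where V: "(V, \<psi>) \<in> B" "proj p0 \<in> V" using coset.chart_ex proj_topspace[OF p0(1)] by metis
  obtain \<Lambda> where \<Lambda>: "\<And>y. y \<in> \<phi> ` U \<Longrightarrow> linear (\<Lambda> y)" "\<And>w. smooth_on (\<phi> ` U) (\<lambda>y. \<Lambda> y w)"
    "\<And>x u. x \<in> U \<Longrightarrow> u \<in> tangent_space A \<one> \<Longrightarrow>
      tangent_map A A (\<lambda>z. x \<otimes> z) \<one> u (U, \<phi>) = \<Lambda> (\<phi> x) (u (U0, \<phi>0))"
    using left_translation_coord[OF U(1) U0] by blast
  obtain E :: "'f \<Rightarrow> 'e" where E: "linear E" "\<And>w. E w = 0 \<Longrightarrow> w = 0"
    "\<And>w. \<exists>u\<in>\<mm>. u (U0, \<phi>0) = E w" "\<And>u. u \<in> \<mm> \<Longrightarrow> \<exists>w. u (U0, \<phi>0) = E w"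
    using complement_coordinates[OF dec U0] by blast
  have bE: "bounded_linear E" using E(1) linear_conv_bounded_linear by blast
  define P where "P = \<psi> \<circ> proj \<circ> inv_into U \<phi>"
  define \<Omega> where "\<Omega> = \<phi> ` {x \<in> U. proj x \<in> V}"
  define D where "D = (\<lambda>y. frechet_derivative P (at y))"
  note P = proj_coord_smooth[OF U(1) V(1), folded P_def \<Omega>_def]
  have \<Omega>U: "\<Omega> \<subseteq> \<phi> ` U" by (auto simp: \<Omega>_def)
  have inv\<Omega>: "inv_into U \<phi> y \<in> U" "proj (inv_into U \<phi> y) \<in> V" "\<phi> (inv_into U \<phi> y) = y"
    "inv_into U \<phi> y \<in> carrier G" if "y \<in> \<Omega>" for y
    using that chart_inv[OF U(1)] chart_carrier[OF U(1)] by (auto simp: \<Omega>_def)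
  have Dlin: "linear (D y)" if "y \<in> \<Omega>" for y
    unfolding D_def by (rule smooth_on_linear_derivative[OF P(2) that])
  have \<Lambda>lin: "linear (\<Lambda> y)" if "y \<in> \<Omega>" for y using \<Lambda>(1) \<Omega>U that by blast
  have \<Lambda>sm: "smooth_on \<Omega> (\<lambda>y. \<Lambda> y w)" for w by (rule smooth_on_subset[OF \<Lambda>(2) \<Omega>U])
  define Z where "Z = (\<lambda>y w. D y (\<Lambda> y (E w)))"
  have Zlin: "linear (Z y)" if "y \<in> \<Omega>" for y
    unfolding Z_def
    using linear_compose[OF linear_compose[OF E(1) \<Lambda>lin[OF that]] Dlin[OF that]] by (simp add: o_def)
  have Zsm: "smooth_on \<Omega> (\<lambda>y. Z y w)" for w
    unfolding Z_def D_def by (rule smooth_on_derivative_apply[OF P \<Lambda>sm])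
  have transl: "tangent_map A A (\<lambda>z. x \<otimes> z) \<one> u \<in> tangent_space A x"
    if "x \<in> carrier G" "u \<in> tangent_space A \<one>" for x u
    using tangent_map_in[OF smooth_manifold_axioms smooth_manifold_axioms mdiff_left_translation[OF that(1) one_carrier] that(2)] that(1)
    by simp
  have projD: "tangent_map A B proj x v (V, \<psi>) = D (\<phi> x) (v (U, \<phi>))"
    if "x \<in> U" "proj x \<in> V" "v \<in> tangent_space A x" for x v
    unfolding D_def P_def
    using tangent_map_coord[OF smooth_manifold_axioms mdiff_proj that(3) U(1) that(1) V(1) that(2)]
      chart_carrier[OF U(1)] that(1) by blast
  \<comment> \<open>If \<open>Z y w = 0\<close>, the vector \<open>u\<close> of \<open>\<mm>\<close> given by \<open>w\<close> is translated by \<open>x\<close> into the kernel of the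
    projection at \<open>x\<close>. By equivariance \<open>u\<close> itself lies in the kernel at the identity, and so is zero.\<close>
  have Zinj: "inj (Z y)" if y: "y \<in> \<Omega>" for y
  proof -
    have "w = 0" if Zw: "Z y w = 0" for w
    proof -
      define x where "x = inv_into U \<phi> y"
      note x = inv\<Omega>[OF y, folded x_def]
      obtain u where u: "u \<in> \<mm>" "u (U0, \<phi>0) = E w" using E(3) by blast
      have uT: "u \<in> tangent_space A \<one>" by (rule complement_tangent[OF dec u(1)])
      let ?v = "tangent_map A A (\<lambda>z. x \<otimes> z) \<one> u"
      have vT: "?v \<in> tangent_space A x" by (rule transl[OF x(4) uT])
      have x': "inv x \<in> carrier G" using x(4) by simp
      have "tangent_map A B proj x ?v = 0"
      proof (rule tangent_space_eqI[OF tangent_map_in[OF smooth_manifold_axioms coset.smooth_manifold_axioms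
              mdiff_proj[OF x(4)] vT] coset.tangent_space_zero[OF proj_topspace[OF x(4)]] V(1) x(2)])
        show "tangent_map A B proj x ?v (V, \<psi>) = 0 (V, \<psi>)"
          using projD[OF x(1,2) vT] \<Lambda>(3)[OF x(1) uT] u(2) x(3) Zw by (simp add: Z_def)
      qed
      then have "tangent_map A B proj \<one> u = tangent_map B B (act G (inv x)) (proj x) 0"
        using tangent_map_act_proj[OF x' x(4) vT] tangent_map_left_translation_inv[OF x(4) one_carrier uT] x(4)
        by simp
      also have "\<dots> = 0"
        by (rule tangent_map_zero[OF coset.smooth_manifold_axioms coset.smooth_manifold_axioms
              mdiff_act[OF x' x(4)] coset.tangent_space_zero[OF proj_topspace[OF x(4)]]])
      finally have "u = 0" by (rule complement_kernel[OF dec u(1)])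
      then show ?thesis using E(2) u(2) by simp
    qed
    then show ?thesis using linear_injective_0[OF Zlin[OF y]] by blast
  qed
  define J0 where "J0 = {t \<in> I. c t \<in> V}"
  have J0: "open J0" unfolding J0_def
    by (rule coset.smooth_curve_open_vimage[OF smooth_curve_continuous[OF smooth_c] open_I coset.chart_openin[OF V(1)]])
  define \<gamma>' where "\<gamma>' = (\<lambda>t. frechet_derivative (\<psi> \<circ> c) (at t) 1)"
  have \<gamma>: "smooth_on J0 (\<psi> \<circ> c)" unfolding J0_def by (rule smooth_curve_chart[OF smooth_c V(1)])
  have \<gamma>'sm: "smooth_on J0 \<gamma>'" unfolding \<gamma>'_def by (rule smooth_on_derivative[OF \<gamma>])
  have \<gamma>': "(\<psi> \<circ> c has_vector_derivative \<gamma>' t) (at t)" if "t \<in> J0" for t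
    using frechet_derivative_eq_vector_derivative[OF smooth_on_differentiable[OF \<gamma> that]]
      smooth_on_differentiable[OF \<gamma> that]
    by (simp add: \<gamma>'_def vector_derivative_works)
  define S where "S = J0 \<times> \<Omega>"
  define F where "F = (\<lambda>p. \<Lambda> (snd p) (E (linv (Z (snd p)) (\<gamma>' (fst p)))))"
  have S: "open S" unfolding S_def by (rule open_Times[OF J0 P(1)])
  have sndS: "smooth_on S (\<lambda>p. f (snd p))" if "smooth_on \<Omega> f" for f :: "'e \<Rightarrow> 'b::euclidean_space"
    by (rule smooth_on_compose[OF S P(1) smooth_on_bounded_linear[OF S bounded_linear_snd] that]) (auto simp: S_def)
  have fstS: "smooth_on S (\<lambda>p. \<gamma>' (fst p))"
    by (rule smooth_on_compose[OF S J0 smooth_on_bounded_linear[OF S bounded_linear_fst] \<gamma>'sm]) (auto simp: S_def)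
  have sS: "snd p \<in> \<Omega>" if "p \<in> S" for p using that by (auto simp: S_def)
  have "smooth_on S (\<lambda>p. linv (Z (snd p)) (\<gamma>' (fst p)))"
    by (rule smooth_on_inverse_family[where Z = "\<lambda>p. Z (snd p)", OF S Zlin[OF sS] Zinj[OF sS] sndS[OF Zsm] fstS])
  then have w: "smooth_on S (\<lambda>p. E (linv (Z (snd p)) (\<gamma>' (fst p))))"
    by (rule smooth_on_linear_compose[OF S bE])
  have F: "smooth_on S F"
    unfolding F_def by (rule smooth_on_apply_linear[where L = "\<lambda>p. \<Lambda> (snd p)", OF S \<Lambda>lin[OF sS] sndS[OF \<Lambda>sm] w])
  have S0: "(t0, \<phi> p0) \<in> S" using t0 p0 U V by (auto simp: S_def J0_def \<Omega>_def)
  have SI: "t \<in> I \<and> y \<in> \<phi> ` U" if "(t, y) \<in> S" for t y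
    using that \<Omega>U by (auto simp: S_def J0_def)
  have nec: "(\<phi> \<circ> x has_vector_derivative F (t, \<phi> (x t))) (at t)"
    if J: "open J" "t \<in> J" "hlift J x" "x t \<in> U" "(t, \<phi> (x t)) \<in> S" for J x t
  proof -
    have xG: "x t \<in> carrier G" by (rule hlift_carrier[OF J(3,2)])
    have m: "curve_mdiff T A x t" by (rule hlift_mdiff[OF J(3,1,2)])
    let ?v = "velocity A x t"
    have vT: "?v \<in> tangent_space A (x t)" by (rule velocity_in_tangent_space[OF smooth_manifold_axioms m])
    define u where "u = tangent_map A A (\<lambda>z. inv (x t) \<otimes> z) (x t) ?v"
    note uv = left_trivialized_velocity[OF xG vT, folded u_def]
    have "u \<in> \<mm>" using hliftD(2)[OF J(3,2)] by (simp add: u_def)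
    then obtain w where w: "u (U0, \<phi>0) = E w" using E(4) by blast
    have v: "?v (U, \<phi>) = \<Lambda> (\<phi> (x t)) (E w)" using \<Lambda>(3)[OF J(4) uv(1)] uv(2) w by simp
    have t: "t \<in> J0" "\<phi> (x t) \<in> \<Omega>" using J(5) by (auto simp: S_def)
    have ct: "c t \<in> V" "proj (x t) \<in> V" using t(1) hliftD(1)[OF J(3,2)] by (auto simp: J0_def)
    have "Z (\<phi> (x t)) w = D (\<phi> (x t)) (?v (U, \<phi>))" by (simp add: Z_def v)
    also have "\<dots> = velocity B c t (V, \<psi>)"
      using projD[OF J(4) ct(2) vT] hlift_velocity[OF J(3,1,2)] by simp
    also have "\<dots> = \<gamma>' t"
      using \<gamma>'[OF t(1)] V(1) ct(1) by (simp add: velocity_def vector_derivative_at)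
    finally have "linv (Z (\<phi> (x t))) (\<gamma>' t) = w"
      using linear_inj_imp_inv(3)[OF Zlin Zinj] t(2) by metis
    then have "F (t, \<phi> (x t)) = ?v (U, \<phi>)" by (simp add: F_def v)
    then show ?thesis using curve_mdiff_vector_derivative[OF m U(1) J(4)] by simp
  qed
  have suff: "hlift {a<..<b} (inv_into U \<phi> \<circ> y)"
    if t1: "t1 \<in> {a<..<b}"
      and y: "\<And>t. t \<in> {a<..<b} \<Longrightarrow> (t, y t) \<in> S \<and> (y has_vector_derivative F (t, y t)) (at t)"
      and start: "proj (inv_into U \<phi> (y t1)) = c t1" for a b t1 y
  proof -
    let ?J = "{a<..<b}"
    have tJ: "t \<in> J0" "y t \<in> \<Omega>" if "t \<in> ?J" for t using y[OF that] by (auto simp: S_def)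
    have "smooth_on ?J (\<lambda>t. (t, y t))"
    proof (rule ode_solution_smooth[OF S _ open_greaterThanLessThan])
      show "smooth_on S (\<lambda>p. (1 :: real, F p))" by (rule smooth_on_Pair[OF S smooth_on_const[OF S] F])
      show "(t, y t) \<in> S \<and> ((\<lambda>t. (t, y t)) has_vector_derivative (1, F (t, y t))) (at t)" if "t \<in> ?J" for t
        using y[OF that] by (auto intro!: has_vector_derivative_Pair)
    qed
    from smooth_on_linear_compose[OF open_greaterThanLessThan bounded_linear_snd this]
    have ysm: "smooth_on ?J y" by simp
    define x where "x = inv_into U \<phi> \<circ> y"
    have x: "smooth_curve T A ?J x"
      unfolding x_def by (rule smooth_curve_in_chart[OF open_greaterThanLessThan U(1) ysm]) (use tJ(2) \<Omega>U in blast)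
    have xt: "x t \<in> U" "proj (x t) \<in> V" "\<phi> (x t) = y t" "x t \<in> carrier G" if "t \<in> ?J" for t
      using inv\<Omega>[OF tJ(2)[OF that]] by (auto simp: x_def)
    have eq: "P (y t) = (\<psi> \<circ> c) t" if t: "t \<in> ?J" for t
    proof (rule eq_on_interval_of_derivative[of a b "\<lambda>t. P (y t)" \<gamma>' "\<psi> \<circ> c" t1 t])
      fix s assume s: "s \<in> ?J"
      have "((\<lambda>t. P (y t)) has_vector_derivative D (y s) (F (s, y s))) (at s)"
        using vector_derivative_diff_chain_within[of y "F (s, y s)" s UNIV P "D (y s)"]
          y[OF s] smooth_on_has_derivative[OF P(2) tJ(2)[OF s]] has_derivative_at_withinI
        unfolding D_def o_def by auto
      moreover have "D (y s) (F (s, y s)) = \<gamma>' s"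
        using linear_inj_imp_inv(2)[OF Zlin Zinj, of "y s"] tJ(2)[OF s] by (simp add: F_def Z_def)
      ultimately show "((\<lambda>t. P (y t)) has_vector_derivative \<gamma>' s) (at s)" by simp
      show "(\<psi> \<circ> c has_vector_derivative \<gamma>' s) (at s)" by (rule \<gamma>'[OF tJ(1)[OF s]])
    qed (use t1 t start in \<open>auto simp: P_def\<close>)
    have pc: "proj (x t) = c t" if t: "t \<in> ?J" for t
    proof -
      have "\<psi> (proj (x t)) = \<psi> (c t)" using eq[OF t] by (simp add: P_def x_def)
      moreover have "c t \<in> V" using tJ(1)[OF t] by (simp add: J0_def)
      ultimately show ?thesis using coset.chart_inj[OF V(1)] xt(2)[OF t] by (meson inj_onD)
    qed
    have "tangent_map A A (\<lambda>z. inv (x t) \<otimes> z) (x t) (velocity A x t) \<in> \<mm>" if t: "t \<in> ?J" for t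
    proof -
      have m: "curve_mdiff T A x t" by (rule smooth_curve_mdiff[OF x open_greaterThanLessThan t])
      obtain u where u: "u \<in> \<mm>" "u (U0, \<phi>0) = E (linv (Z (y t)) (\<gamma>' t))" using E(3) by blast
      have uT: "u \<in> tangent_space A \<one>" by (rule complement_tangent[OF dec u(1)])
      have "velocity A x t = tangent_map A A (\<lambda>z. x t \<otimes> z) \<one> u"
      proof (rule tangent_space_eqI[OF velocity_in_tangent_space[OF smooth_manifold_axioms m] transl[OF xt(4)[OF t] uT] U(1) xt(1)[OF t]])
        have "(\<phi> \<circ> x has_vector_derivative F (t, y t)) (at t)"
          by (rule has_vector_derivative_transform_within_open[OF conjunct2[OF y[OF t]] open_greaterThanLessThan t])
            (use xt(3) in auto)
        then have "velocity A x t (U, \<phi>) = F (t, y t)"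
          using curve_mdiff_vector_derivative[OF m U(1) xt(1)[OF t]] vector_derivative_unique_at by metis
        then show "velocity A x t (U, \<phi>) = tangent_map A A (\<lambda>z. x t \<otimes> z) \<one> u (U, \<phi>)"
          using \<Lambda>(3)[OF xt(1)[OF t] uT] u(2) xt(3)[OF t] by (simp add: F_def)
      qed
      then show ?thesis
        using tangent_map_left_translation_inv[OF xt(4)[OF t] one_carrier uT] u(1) xt(4)[OF t] by simp
    qed
    then show ?thesis unfolding hlift_def x_def[symmetric] using x pc by blast
  qed
  show ?thesis by (rule that[OF U S S0 F SI nec suff])
qed

section \<open>Local existence and uniqueness of lifts\<close>

text \<open>The differential equation becomes autonomous with time as a further coordinate; varying the
  starting point there varies the starting time as well. That one interval serves all starting points
  near \<open>p0\<close> is what the compact case relies on.\<close>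

lemma lift_local_existence:
  assumes t0: "t0 \<in> I" and p0: "p0 \<in> carrier G" "proj p0 = c t0"
  obtains e N where "e > 0" "openin T N" "p0 \<in> N" "{t0-e<..<t0+e} \<subseteq> I"
    "\<And>t1 x1. t1 \<in> {t0-e<..<t0+e} \<Longrightarrow> x1 \<in> N \<Longrightarrow> proj x1 = c t1 \<Longrightarrow>
      \<exists>x. hlift {t0-e<..<t0+e} x \<and> x t1 = x1"
proof (rule lift_ode[OF assms])
  fix U \<phi> S F
  assume U: "(U, \<phi>) \<in> A" "p0 \<in> U" and S: "open S" "(t0, \<phi> p0) \<in> S" and F: "smooth_on S F"
    and SI: "\<And>t y. (t, y) \<in> S \<Longrightarrow> t \<in> I \<and> y \<in> \<phi> ` U"
    and suff: "\<And>a b t1 y. t1 \<in> {a<..<b} \<Longrightarrow>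
      (\<And>t. t \<in> {a<..<b} \<Longrightarrow> (t, y t) \<in> S \<and> (y has_vector_derivative F (t, y t)) (at t)) \<Longrightarrow>
      proj (inv_into U \<phi> (y t1)) = c t1 \<Longrightarrow> hlift {a<..<b} (inv_into U \<phi> \<circ> y)"
  have F1: "smooth_on S (\<lambda>p. (1 :: real, F p))" by (rule smooth_on_Pair[OF S(1) smooth_on_const[OF S(1)] F])
  obtain e0 d where ed: "e0 > 0" "d > 0" "\<And>q. q \<in> ball (t0, \<phi> p0) d \<Longrightarrow> \<exists>X. X 0 = q \<and>
       (\<forall>t\<in>{-e0<..<e0}. X t \<in> S \<and> (X has_vector_derivative (1, F (X t))) (at t))"
    using ode_existence[OF S(1) F1 S(2)] by blast
  define e where "e = min (e0/2) (d/2)"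
  define N where "N = {x \<in> U. \<phi> x \<in> ball (\<phi> p0) (d/2)}"
  have e: "e > 0" "2 * e \<le> e0" "2 * e \<le> d" using ed(1,2) by (auto simp: e_def)
  have N: "openin T N" "p0 \<in> N"
    unfolding N_def by (rule chart_openin_vimage[OF U(1) open_ball]) (use U(2) ed(2) in auto)
  have ysol: "\<exists>y. y t1 = \<phi> x1 \<and> (\<forall>t\<in>{t0-e<..<t0+e}. (t, y t) \<in> S \<and> (y has_vector_derivative F (t, y t)) (at t))"
    if t1: "t1 \<in> {t0-e<..<t0+e}" and x1: "x1 \<in> N" for t1 x1
  proof -
    have "dist (t0, \<phi> p0) (t1, \<phi> x1) \<le> dist t0 t1 + dist (\<phi> p0) (\<phi> x1)"
      unfolding dist_Pair_Pair by (rule sqrt_sum_squares_le_sum) auto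
    also have "\<dots> < d" using t1 x1 e(3) by (auto simp: N_def dist_real_def)
    finally have "(t1, \<phi> x1) \<in> ball (t0, \<phi> p0) d" by simp
    then obtain X where X: "X 0 = (t1, \<phi> x1)"
      "\<And>t. t \<in> {-e0<..<e0} \<Longrightarrow> X t \<in> S \<and> (X has_vector_derivative (1, F (X t))) (at t)"
      using ed(3) by blast
    have X': "(X has_vector_derivative (1, F (X s))) (at s)" if "s \<in> {-e0<..<e0}" for s
      using X(2)[OF that] by blast
    have fstX: "fst (X s) = t1 + s" if s: "s \<in> {-e0<..<e0}" for s
    proof (rule eq_on_interval_of_derivative[of "-e0" e0 "\<lambda>s. fst (X s)" "\<lambda>_. 1" "\<lambda>s. t1 + s" 0 s])
      show "((\<lambda>s. fst (X s)) has_vector_derivative 1) (at r)" if "r \<in> {-e0<..<e0}" for r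
        using bounded_linear.has_vector_derivative[OF bounded_linear_fst X'[OF that]] by simp
      show "((\<lambda>s. t1 + s) has_vector_derivative 1) (at r)" for r
        by (auto intro!: derivative_eq_intros)
    qed (use s ed(1) X(1) in auto)
    define y where "y = (\<lambda>t. snd (X (t - t1)))"
    have "(t, y t) \<in> S \<and> (y has_vector_derivative F (t, y t)) (at t)" if t: "t \<in> {t0-e<..<t0+e}" for t
    proof -
      have s: "t - t1 \<in> {-e0<..<e0}" using t t1 e(2) by auto
      have Xt: "X (t - t1) = (t, y t)" using fstX[OF s] by (simp add: y_def prod_eq_iff)
      have "((\<lambda>s. snd (X s)) has_vector_derivative F (t, y t)) (at (t - t1))"
        using bounded_linear.has_vector_derivative[OF bounded_linear_snd X'[OF s]] Xt by simp
      moreover have "((\<lambda>t. t - t1) has_vector_derivative 1) (at t)"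
        by (auto intro!: derivative_eq_intros)
      ultimately have "((\<lambda>s. snd (X s)) \<circ> (\<lambda>t. t - t1) has_vector_derivative 1 *\<^sub>R F (t, y t)) (at t)"
        by (rule vector_diff_chain_at[rotated])
      moreover have "(\<lambda>s. snd (X s)) \<circ> (\<lambda>t. t - t1) = y" by (simp add: y_def o_def)
      ultimately show ?thesis using conjunct1[OF X(2)[OF s]] unfolding Xt by simp
    qed
    moreover have "y t1 = \<phi> x1" by (simp add: y_def X(1))
    ultimately show ?thesis by blast
  qed
  have t00: "t0 \<in> {t0-e<..<t0+e}" using e(1) by simp
  have "{t0-e<..<t0+e} \<subseteq> I" using ysol[OF t00 N(2)] SI by blast
  moreover have "\<exists>x. hlift {t0-e<..<t0+e} x \<and> x t1 = x1"
    if q: "t1 \<in> {t0-e<..<t0+e}" "x1 \<in> N" "proj x1 = c t1" for t1 x1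
  proof -
    obtain y where y: "y t1 = \<phi> x1"
      "\<And>t. t \<in> {t0-e<..<t0+e} \<Longrightarrow> (t, y t) \<in> S \<and> (y has_vector_derivative F (t, y t)) (at t)"
      using ysol[OF q(1,2)] by blast
    have x1: "inv_into U \<phi> (y t1) = x1" using q(2) y(1) chart_inv[OF U(1)] by (simp add: N_def)
    have "hlift {t0-e<..<t0+e} (inv_into U \<phi> \<circ> y)"
      by (rule suff[OF q(1) y(2)]) (use x1 q(3) in auto)
    then show ?thesis using x1 by (intro exI[of _ "inv_into U \<phi> \<circ> y"]) simp
  qed
  ultimately show ?thesis using that[OF e(1) N] by blast
qed

text \<open>The times of agreement are open by local uniqueness for the differential equation, and those of
  disagreement by the Hausdorff property.\<close>

lemma lift_unique:
  assumes J: "open J1" "open J2" and l1: "hlift J1 x1" and l2: "hlift J2 x2"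
    and sub: "J1 \<subseteq> I" and conn: "connected (J1 \<inter> J2)" and s: "s \<in> J1 \<inter> J2" "x1 s = x2 s" and t: "t \<in> J1 \<inter> J2"
  shows "x1 t = x2 t"
proof -
  let ?J = "J1 \<inter> J2"
  have oJ: "open ?J" using J by blast
  have cont: "continuous_map (top_of_set ?J) T x1" "continuous_map (top_of_set ?J) T x2"
    using l1 l2 smooth_curve_continuous smooth_curve_subset unfolding hlift_def by (metis inf_le1, metis inf_le2)
  let ?E = "{t \<in> ?J. x1 t = x2 t}" and ?N = "{t \<in> ?J. x1 t \<noteq> x2 t}"
  have "open ?N"
  proof (subst open_subopen, rule ballI)
    fix t assume t: "t \<in> ?N"
    have "x1 t \<in> topspace T" "x2 t \<in> topspace T"
      using t hlift_carrier[OF l1] hlift_carrier[OF l2] topspace_carrier by auto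
    then obtain M1 M2 where M: "openin T M1" "openin T M2" "x1 t \<in> M1" "x2 t \<in> M2" "disjnt M1 M2"
      using Hausdorff t unfolding Hausdorff_space_def by (metis (mono_tags, lifting) mem_Collect_eq)
    have "open ({t \<in> ?J. x1 t \<in> M1} \<inter> {t \<in> ?J. x2 t \<in> M2})"
      by (intro open_Int smooth_curve_open_vimage[OF _ oJ] cont M)
    moreover have "{t \<in> ?J. x1 t \<in> M1} \<inter> {t \<in> ?J. x2 t \<in> M2} \<subseteq> ?N"
      using M(5) by (auto simp: disjnt_def)
    ultimately show "\<exists>T. open T \<and> t \<in> T \<and> T \<subseteq> ?N" using t M(3,4) by blast
  qed
  moreover have "open ?E"
  proof (subst open_subopen, rule ballI)
    fix t1 assume t1: "t1 \<in> ?E"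
    then have tI: "t1 \<in> I" and tJ: "t1 \<in> J1" "t1 \<in> J2" using sub by auto
    show "\<exists>T. open T \<and> t1 \<in> T \<and> T \<subseteq> ?E"
    proof (rule lift_ode[OF tI hlift_carrier[OF l1 tJ(1)] hliftD(1)[OF l1 tJ(1)]])
      fix U \<phi> S F
      assume U: "(U, \<phi>) \<in> A" "x1 t1 \<in> U" and S: "open S" "(t1, \<phi> (x1 t1)) \<in> S" and F: "smooth_on S F"
        and nec: "\<And>J x t. open J \<Longrightarrow> t \<in> J \<Longrightarrow> hlift J x \<Longrightarrow> x t \<in> U \<Longrightarrow> (t, \<phi> (x t)) \<in> S \<Longrightarrow>
          (\<phi> \<circ> x has_vector_derivative F (t, \<phi> (x t))) (at t)"
      have F1: "smooth_on S (\<lambda>p. (1 :: real, F p))" by (rule smooth_on_Pair[OF S(1) smooth_on_const[OF S(1)] F])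
      obtain L O1 where LO: "open L" "open O1" "t1 \<in> L" "\<phi> (x1 t1) \<in> O1" "L \<times> O1 \<subseteq> S"
        using open_prod_elim[OF S] by (metis mem_Sigma_iff)
      let ?W = "{q \<in> U. \<phi> q \<in> O1}"
      have W: "openin T ?W" by (rule chart_openin_vimage[OF U(1) LO(2)])
      define K where "K = L \<inter> ({t \<in> ?J. x1 t \<in> ?W} \<inter> {t \<in> ?J. x2 t \<in> ?W})"
      have K: "open K"
        unfolding K_def by (intro open_Int LO(1) smooth_curve_open_vimage[OF _ oJ W] cont)
      have t1K: "t1 \<in> K" using LO U t1 by (simp add: K_def)
      have sol: "(t, \<phi> (x t)) \<in> S \<and> ((\<lambda>t. (t, \<phi> (x t))) has_vector_derivative (1, F (t, \<phi> (x t)))) (at t)"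
        if "hlift J x" "open J" "t \<in> J" "t \<in> L" "x t \<in> ?W" for J x t
      proof -
        have 1: "(t, \<phi> (x t)) \<in> S" using that LO(5) by auto
        moreover have "(\<phi> \<circ> x has_vector_derivative F (t, \<phi> (x t))) (at t)"
          using nec[OF that(2,3,1) _ 1] that(5) by simp
        ultimately show ?thesis by (auto intro!: has_vector_derivative_Pair simp: o_def)
      qed
      obtain d where d: "d > 0" "\<And>t. \<bar>t - t1\<bar> < d \<Longrightarrow> t \<in> K \<and> (t, \<phi> (x1 t)) = (t, \<phi> (x2 t))"
      proof (rule ode_local_uniqueness[OF S(1) F1 K t1K])
        show "(t, \<phi> (x1 t)) \<in> S \<and> ((\<lambda>t. (t, \<phi> (x1 t))) has_vector_derivative (1, F (t, \<phi> (x1 t)))) (at t)" if "t \<in> K" for t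
          using sol[OF l1 J(1)] that by (simp add: K_def)
        show "(t, \<phi> (x2 t)) \<in> S \<and> ((\<lambda>t. (t, \<phi> (x2 t))) has_vector_derivative (1, F (t, \<phi> (x2 t)))) (at t)" if "t \<in> K" for t
          using sol[OF l2 J(2)] that by (simp add: K_def)
      qed (use t1 in auto)
      have "ball t1 d \<subseteq> ?E"
      proof
        fix t assume "t \<in> ball t1 d"
        then have "\<bar>t - t1\<bar> < d" by (simp add: dist_real_def abs_minus_commute)
        from d(2)[OF this] have tK: "t \<in> K" "\<phi> (x1 t) = \<phi> (x2 t)" by auto
        then have "x1 t = x2 t" using chart_inj[OF U(1)] by (auto simp: K_def inj_on_def)
        then show "t \<in> ?E" using tK(1) by (simp add: K_def)
      qed
      then show "\<exists>T. open T \<and> t1 \<in> T \<and> T \<subseteq> ?E" using d(1) by (intro exI[of _ "ball t1 d"]) auto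
    qed
  qed
  ultimately have "?E \<inter> ?J = {} \<or> ?N \<inter> ?J = {}"
    by (intro connectedD[OF conn]) auto
  then show ?thesis using s t by auto
qed

end

section \<open>Global lifts\<close>

context horizontal_lifting
begin

lemma hlift_locally:
  assumes "open J"
    and loc: "\<And>t. t \<in> J \<Longrightarrow> \<exists>K y. open K \<and> t \<in> K \<and> hlift K y \<and> (\<forall>s\<in>K. x s = y s)"
  shows "hlift J x"
  unfolding hlift_def
proof (intro conjI ballI)
  show "smooth_curve T A J x"
    using loc hlift_smooth by (intro smooth_curve_Union[OF assms(1)]) meson
  fix t assume "t \<in> J"
  then obtain K y where K: "open K" "t \<in> K" "hlift K y" "\<forall>s\<in>K. x s = y s" using loc by blast
  have "velocity A y t = velocity A x t"
    by (rule velocity_cong(2)[OF hlift_mdiff[OF K(3,1,2)] K(1,2)]) (use K(4) in simp)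
  then show "proj (x t) = c t" "tangent_map A A (\<lambda>z. inv (x t) \<otimes> z) (x t) (velocity A x t) \<in> \<mm>"
    using hliftD[OF K(3,2)] K(2,4) by auto
qed

lemma hlift_glue:
  assumes J: "open J1" "open J2" and l: "hlift J1 x1" "hlift J2 x2"
    and eq: "\<And>t. t \<in> J1 \<inter> J2 \<Longrightarrow> x1 t = x2 t"
  shows "hlift (J1 \<union> J2) (\<lambda>t. if t \<in> J1 then x1 t else x2 t)"
proof (rule hlift_locally)
  show "open (J1 \<union> J2)" using J by blast
  fix t assume "t \<in> J1 \<union> J2"
  then show "\<exists>K y. open K \<and> t \<in> K \<and> hlift K y \<and> (\<forall>s\<in>K. (if s \<in> J1 then x1 s else x2 s) = y s)"
    using J l eq by (metis IntI UnE)
qed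

text \<open>Right translation by \<open>h\<close> changes the left trivialised velocity by \<open>Ad (inv h)\<close>.\<close>

lemma hlift_right_translation:
  assumes red: "reductive G T A H \<mm>" and h: "h \<in> H" and J: "open J" and l: "hlift J x"
  shows "hlift J (\<lambda>t. x t \<otimes> h)"
  unfolding hlift_def
proof (intro conjI ballI)
  have hG: "h \<in> carrier G" by (rule mem_carrier[OF h])
  have "smooth_curve T A J ((\<lambda>x. x \<otimes> h) \<circ> x)"
    by (rule smooth_curve_compose[OF smooth_manifold_axioms smooth_manifold_axioms
          smooth_right_translation[OF hG] hlift_smooth[OF l] J])
  then show "smooth_curve T A J (\<lambda>t. x t \<otimes> h)" by (simp add: o_def)
  fix t assume t: "t \<in> J"
  have xG: "x t \<in> carrier G" by (rule hlift_carrier[OF l t])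
  show "proj (x t \<otimes> h) = c t" using proj_mult_H[OF xG h] hliftD(1)[OF l t] by simp
  let ?v = "velocity A x t"
  define u where "u = tangent_map A A (\<lambda>z. inv (x t) \<otimes> z) (x t) ?v"
  have m: "curve_mdiff T A x t" by (rule hlift_mdiff[OF l J t])
  have vT: "?v \<in> tangent_space A (x t)" by (rule velocity_in_tangent_space[OF smooth_manifold_axioms m])
  have x': "inv (x t) \<in> carrier G" and xh: "x t \<otimes> h \<in> carrier G" and xh': "inv (x t \<otimes> h) \<in> carrier G"
    and h': "inv h \<in> carrier G" using xG hG by auto
  have e: "inv (x t) \<otimes> x t = \<one>" using xG by simp
  note M = smooth_manifold_axioms
  have mL: "mdiff T A T A (\<lambda>z. inv (x t) \<otimes> z) (x t)" by (rule mdiff_left_translation[OF x' xG])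
  have mC: "mdiff T A T A (\<lambda>z. inv h \<otimes> z \<otimes> inv (inv h)) (inv (x t) \<otimes> x t)"
    by (rule mdiff_conjugation[OF h']) (simp add: xG)
  have mR: "mdiff T A T A (\<lambda>z. z \<otimes> h) (x t)" by (rule mdiff_right_translation[OF hG xG])
  have mL': "mdiff T A T A (\<lambda>z. inv (x t \<otimes> h) \<otimes> z) (x t \<otimes> h)" by (rule mdiff_left_translation[OF xh' xh])
  have "velocity A (\<lambda>t. x t \<otimes> h) t = tangent_map A A (\<lambda>z. z \<otimes> h) (x t) ?v"
    using velocity_compose(2)[OF M M m mR] by (simp add: o_def)
  then have "tangent_map A A (\<lambda>z. inv (x t \<otimes> h) \<otimes> z) (x t \<otimes> h) (velocity A (\<lambda>t. x t \<otimes> h) t) =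
      tangent_map A A ((\<lambda>z. inv (x t \<otimes> h) \<otimes> z) \<circ> (\<lambda>z. z \<otimes> h)) (x t) ?v"
    using tangent_map_compose[OF M M M mR mL' vT] by simp
  also have "\<dots> = tangent_map A A ((\<lambda>z. inv h \<otimes> z \<otimes> inv (inv h)) \<circ> (\<lambda>z. inv (x t) \<otimes> z)) (x t) ?v"
  proof (rule tangent_map_cong[OF M mdiff_compose[OF M M mR mL'] vT openin_topspace])
    show "x t \<in> topspace T" using xG topspace_carrier by simp
    fix z assume "z \<in> topspace T"
    then have "z \<in> carrier G" using topspace_carrier by simp
    then show "((\<lambda>z. inv (x t \<otimes> h) \<otimes> z) \<circ> (\<lambda>z. z \<otimes> h)) z =
        ((\<lambda>z. inv h \<otimes> z \<otimes> inv (inv h)) \<circ> (\<lambda>z. inv (x t) \<otimes> z)) z"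
      using xG hG by (simp add: inv_mult_group m_assoc)
  qed
  also have "\<dots> = Ad G A (inv h) u"
    using tangent_map_compose[OF M M M mL mC vT] e by (simp add: Ad_def u_def)
  also have "\<dots> \<in> \<mm>"
    using red m_inv_closed[OF h] hliftD(2)[OF l t] unfolding reductive_def u_def by blast
  finally show "tangent_map A A (\<lambda>z. inv (x t \<otimes> h) \<otimes> z) (x t \<otimes> h) (velocity A (\<lambda>t. x t \<otimes> h) t) \<in> \<mm>" .
qed

text \<open>By uniqueness, the times reached by a lift from \<open>g\<close> carry a well defined curve \<open>X\<close>. They form
  an open set; it is closed, hence all of \<open>I\<close>, as soon as near each limit point \<open>t0\<close> some lift
  meets \<open>X\<close> and extends over \<open>t0\<close>.\<close>

lemma global_lift:
  assumes conn: "connected I" and zero: "0 \<in> I" and g: "g \<in> carrier G" "proj g = c 0"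
    and ext: "\<And>t0 S X. t0 \<in> I \<Longrightarrow> S \<subseteq> I \<Longrightarrow> (\<And>\<delta>. \<delta> > 0 \<Longrightarrow> \<exists>t\<in>S. \<bar>t - t0\<bar> < \<delta>) \<Longrightarrow>
      (\<And>t. t \<in> S \<Longrightarrow> X t \<in> carrier G \<and> proj (X t) = c t) \<Longrightarrow>
      \<exists>K x t1. open K \<and> connected K \<and> t0 \<in> K \<and> K \<subseteq> I \<and> t1 \<in> K \<inter> S \<and> hlift K x \<and> x t1 = X t1"
  obtains x where "hlift I x" "x 0 = g"
proof -
  define R where "R = (\<lambda>J x. open J \<and> connected J \<and> 0 \<in> J \<and> J \<subseteq> I \<and> hlift J x \<and> x 0 = g)"
  define S where "S = {t. \<exists>J x. R J x \<and> t \<in> J}"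
  define X where "X = (\<lambda>t. SOME p. \<exists>J x. R J x \<and> t \<in> J \<and> p = x t)"
  have conn_Int: "connected (J \<inter> K)" if "connected J" "connected K" for J K :: "real set"
    using that by (metis is_interval_Int is_interval_connected_1)
  have X: "X t = x t" if r: "R J x" "t \<in> J" for J x t
  proof -
    have "\<exists>p J x. R J x \<and> t \<in> J \<and> p = x t" using r by blast
    from someI_ex[OF this] obtain J' x' where r': "R J' x'" "t \<in> J'" "X t = x' t" unfolding X_def by blast
    have "x' t = x t"
      by (rule lift_unique[of J' J x' x 0 t]) (use r r' conn_Int in \<open>auto simp: R_def\<close>)
    then show ?thesis using r' by simp
  qed
  have SI: "S \<subseteq> I" by (auto simp: S_def R_def)
  have openS: "open S"
  proof -
    have "S = \<Union>{J. \<exists>x. R J x}" by (auto simp: S_def)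
    moreover have "open \<dots>" by (rule open_Union) (auto simp: R_def)
    ultimately show ?thesis by simp
  qed
  have S0: "0 \<in> S"
  proof -
    obtain e N where eN: "e > 0" "openin T N" "g \<in> N" "{0-e<..<0+e} \<subseteq> I"
      "\<And>t1 x1. t1 \<in> {0-e<..<0+e} \<Longrightarrow> x1 \<in> N \<Longrightarrow> proj x1 = c t1 \<Longrightarrow> \<exists>x. hlift {0-e<..<0+e} x \<and> x t1 = x1"
      using lift_local_existence[OF zero g] by blast
    have "0 \<in> {0-e<..<0+e}" using eN(1) by simp
    moreover from eN(5)[OF this eN(3) g(2)] obtain x where "hlift {0-e<..<0+e} x" "x 0 = g" by blast
    ultimately have "R {0-e<..<0+e} x" using eN(4) by (simp add: R_def)
    then show ?thesis using eN(1) by (auto simp: S_def)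
  qed
  have XS: "X t \<in> carrier G \<and> proj (X t) = c t" if t: "t \<in> S" for t
  proof -
    obtain J x where r: "R J x" "t \<in> J" using t by (auto simp: S_def)
    then have "hlift J x" by (simp add: R_def)
    then show ?thesis using hlift_carrier hliftD(1) X[OF r] r(2) by simp
  qed
  have closedS: "t0 \<in> S" if t0: "t0 \<in> I" and lim: "\<And>\<delta>. \<delta> > 0 \<Longrightarrow> \<exists>t\<in>S. \<bar>t - t0\<bar> < \<delta>" for t0
  proof -
    obtain K y t1 where K: "open K" "connected K" "t0 \<in> K" "K \<subseteq> I" "t1 \<in> K" "t1 \<in> S" "hlift K y" "y t1 = X t1"
      using ext[OF t0 SI lim XS] by blast
    obtain J x where r: "R J x" "t1 \<in> J" using K(6) by (auto simp: S_def)
    then have J: "open J" "connected J" "0 \<in> J" "J \<subseteq> I" "hlift J x" "x 0 = g" by (auto simp: R_def)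
    have start: "x t1 = y t1" using X[OF r] K(8) by simp
    have eq: "x t = y t" if t: "t \<in> J \<inter> K" for t
      by (rule lift_unique[OF J(1) K(1) J(5) K(7) J(4) conn_Int[OF J(2) K(2)] _ start t]) (use r(2) K(5) in simp)
    have "connected (J \<union> K)" using connected_Un[OF J(2) K(2)] r(2) K(5) by blast
    then have "R (J \<union> K) (\<lambda>t. if t \<in> J then x t else y t)"
      using J K hlift_glue[OF J(1) K(1) J(5) K(7) eq] by (simp add: R_def open_Un)
    then show ?thesis using K(3) by (auto simp: S_def)
  qed
  have "open (I - S)"
  proof (subst open_subopen, rule ballI)
    fix t0 assume t0: "t0 \<in> I - S"
    then obtain \<delta> where \<delta>: "\<delta> > 0" "\<And>t. t \<in> S \<Longrightarrow> \<not> \<bar>t - t0\<bar> < \<delta>" using closedS[of t0] by blast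
    have "open (I \<inter> ball t0 \<delta>)" using open_I by blast
    moreover have "I \<inter> ball t0 \<delta> \<subseteq> I - S" using \<delta>(2) by (auto simp: dist_real_def abs_minus_commute)
    ultimately show "\<exists>U. open U \<and> t0 \<in> U \<and> U \<subseteq> I - S" using t0 \<delta>(1) by (intro exI[of _ "I \<inter> ball t0 \<delta>"]) auto
  qed
  then have "S \<inter> I = {} \<or> (I - S) \<inter> I = {}"
    by (intro connectedD[OF conn openS]) auto
  then have SeqI: "S = I" using S0 zero SI by blast
  have "hlift I X"
  proof (rule hlift_locally[OF open_I])
    fix t assume "t \<in> I"
    then obtain J x where r: "R J x" "t \<in> J" using SeqI by (auto simp: S_def)
    then show "\<exists>K y. open K \<and> t \<in> K \<and> hlift K y \<and> (\<forall>s\<in>K. X s = y s)"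
      using X[OF r(1)] by (intro exI[of _ J] exI[of _ x]) (auto simp: R_def)
  qed
  moreover have "X 0 = g"
  proof -
    obtain J x where "R J x" using S0 by (auto simp: S_def)
    then show ?thesis using X[of J x 0] by (simp add: R_def)
  qed
  ultimately show ?thesis by (rule that)
qed

lemma local_lift_ex:
  assumes t0: "t0 \<in> I"
  obtains e s where "e > 0" "{t0-e<..<t0+e} \<subseteq> I" "hlift {t0-e<..<t0+e} s"
proof -
  have "c t0 \<in> topspace Y"
    using smooth_curve_continuous[OF smooth_c] t0 by (auto simp: continuous_map_def)
  then obtain p where p: "p \<in> carrier G" "proj p = c t0" using topspace_proj by auto
  obtain e N where eN: "e > 0" "openin T N" "p \<in> N" "{t0-e<..<t0+e} \<subseteq> I"
    "\<And>t1 x1. t1 \<in> {t0-e<..<t0+e} \<Longrightarrow> x1 \<in> N \<Longrightarrow> proj x1 = c t1 \<Longrightarrow> \<exists>x. hlift {t0-e<..<t0+e} x \<and> x t1 = x1"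
    using lift_local_existence[OF t0 p] by blast
  have "t0 \<in> {t0-e<..<t0+e}" using eN(1) by simp
  then show ?thesis using that[OF eN(1,4)] eN(5) eN(3) p(2) by blast
qed

text \<open>In the reductive case a local lift over \<open>t0\<close> can be moved by an element of \<open>H\<close> to meet \<open>X\<close>.\<close>

lemma extension_reductive:
  assumes red: "reductive G T A H \<mm>"
    and t0: "t0 \<in> I" and lim: "\<And>\<delta>. \<delta> > 0 \<Longrightarrow> \<exists>t\<in>S. \<bar>t - t0\<bar> < \<delta>"
    and X: "\<And>t. t \<in> S \<Longrightarrow> X t \<in> carrier G \<and> proj (X t) = c t"
  shows "\<exists>K x t1. open K \<and> connected K \<and> t0 \<in> K \<and> K \<subseteq> I \<and> t1 \<in> K \<inter> S \<and> hlift K x \<and> x t1 = X t1"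
proof -
  obtain e s where es: "e > 0" "{t0-e<..<t0+e} \<subseteq> I" "hlift {t0-e<..<t0+e} s"
    using local_lift_ex[OF t0] by blast
  let ?K = "{t0-e<..<t0+e}"
  obtain t1 where t1: "t1 \<in> S" "\<bar>t1 - t0\<bar> < e" using lim[OF es(1)] by blast
  then have t1K: "t1 \<in> ?K" by auto
  have sG: "s t1 \<in> carrier G" by (rule hlift_carrier[OF es(3) t1K])
  have XG: "X t1 \<in> carrier G" "proj (X t1) = c t1" using X[OF t1(1)] by auto
  define h where "h = inv (s t1) \<otimes> X t1"
  have "h \<in> H" unfolding h_def by (rule proj_eqD[OF sG XG(1)]) (simp add: hliftD(1)[OF es(3) t1K] XG)
  then have "hlift ?K (\<lambda>t. s t \<otimes> h)" by (rule hlift_right_translation[OF red _ open_greaterThanLessThan es(3)])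
  moreover have "s t1 \<otimes> h = X t1" using sG XG by (simp add: h_def m_assoc[symmetric])
  moreover have "t0 \<in> ?K" using es(1) by simp
  moreover have "open ?K" "connected ?K" by auto
  ultimately show ?thesis using es(2) t1(1) t1K by blast
qed

text \<open>If \<open>H\<close> is compact, the difference in \<open>H\<close> between \<open>X\<close> and a local lift \<open>s\<close> over \<open>t0\<close> has a
  cluster point \<open>h\<close> as the time tends to \<open>t0\<close>, so \<open>X\<close> comes close to \<open>s t0 \<otimes> h\<close>. There all lifts
  live on a common interval around \<open>t0\<close>.\<close>

lemma extension_compact:
  assumes comp: "compactin T H"
    and t0: "t0 \<in> I" and lim: "\<And>\<delta>. \<delta> > 0 \<Longrightarrow> \<exists>t\<in>S. \<bar>t - t0\<bar> < \<delta>"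
    and X: "\<And>t. t \<in> S \<Longrightarrow> X t \<in> carrier G \<and> proj (X t) = c t"
  shows "\<exists>K x t1. open K \<and> connected K \<and> t0 \<in> K \<and> K \<subseteq> I \<and> t1 \<in> K \<inter> S \<and> hlift K x \<and> x t1 = X t1"
proof -
  obtain e s where es: "e > 0" "{t0-e<..<t0+e} \<subseteq> I" "hlift {t0-e<..<t0+e} s"
    using local_lift_ex[OF t0] by blast
  let ?K = "{t0-e<..<t0+e}"
  have t0K: "t0 \<in> ?K" using es(1) by simp
  define k where "k = (\<lambda>t. inv (s t) \<otimes> X t)"
  have k: "k t \<in> H" "s t \<otimes> k t = X t" if t: "t \<in> ?K" "t \<in> S" for t
  proof -
    have sG: "s t \<in> carrier G" by (rule hlift_carrier[OF es(3) t(1)])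
    have XG: "X t \<in> carrier G" "proj (X t) = c t" using X[OF t(2)] by auto
    show "k t \<in> H" unfolding k_def by (rule proj_eqD[OF sG XG(1)]) (simp add: hliftD(1)[OF es(3) t(1)] XG)
    show "s t \<otimes> k t = X t" using sG XG by (simp add: k_def m_assoc[symmetric])
  qed
  have "\<exists>h\<in>H. \<forall>V \<delta>. openin T V \<and> h \<in> V \<and> \<delta> > 0 \<longrightarrow> (\<exists>t\<in>?K \<inter> S. \<bar>t - t0\<bar> < \<delta> \<and> k t \<in> V)"
  proof (rule ccontr)
    assume "\<not> ?thesis"
    then have "\<forall>h\<in>H. \<exists>V \<delta>. openin T V \<and> h \<in> V \<and> \<delta> > 0 \<and> (\<forall>t\<in>?K \<inter> S. \<bar>t - t0\<bar> < \<delta> \<longrightarrow> k t \<notin> V)"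
      by meson
    then obtain V \<delta> where V: "\<And>h. h \<in> H \<Longrightarrow> openin T (V h) \<and> h \<in> V h \<and> \<delta> h > 0 \<and>
        (\<forall>t\<in>?K \<inter> S. \<bar>t - t0\<bar> < \<delta> h \<longrightarrow> k t \<notin> V h)"
      by metis
    have "H \<subseteq> \<Union>(V ` H)" using V by blast
    moreover have "\<forall>C\<in>V ` H. openin T C" using V by blast
    ultimately have "\<exists>\<F>. finite \<F> \<and> \<F> \<subseteq> V ` H \<and> H \<subseteq> \<Union>\<F>"
      using comp[unfolded compactin_def, THEN conjunct2, rule_format, of "V ` H"] by blast
    then obtain \<F> where \<F>: "finite \<F>" "\<F> \<subseteq> V ` H" "H \<subseteq> \<Union>\<F>" by blast
    obtain H0 where H0: "finite H0" "H0 \<subseteq> H" "\<F> = V ` H0" using finite_subset_image[OF \<F>(1,2)] by blast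
    define d where "d = Min (insert e (\<delta> ` H0))"
    have d: "d > 0" "d \<le> e" "\<And>h. h \<in> H0 \<Longrightarrow> d \<le> \<delta> h"
      using H0(1,2) V es(1) by (auto simp: d_def)
    obtain t where t: "t \<in> S" "\<bar>t - t0\<bar> < d" using lim[OF d(1)] by blast
    then have tK: "t \<in> ?K" using d(2) by auto
    then obtain h where h: "h \<in> H0" "k t \<in> V h" using k(1)[OF tK t(1)] \<F>(3) H0(3) by blast
    have "\<bar>t - t0\<bar> < \<delta> h" using t(2) d(3)[OF h(1)] by linarith
    then show False using V[of h] h H0(2) tK t(1) by blast
  qed
  then obtain h where h: "h \<in> H"
    and cluster: "\<And>V \<delta>. openin T V \<Longrightarrow> h \<in> V \<Longrightarrow> \<delta> > 0 \<Longrightarrow> \<exists>t\<in>?K \<inter> S. \<bar>t - t0\<bar> < \<delta> \<and> k t \<in> V"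
    by metis
  have hG: "h \<in> carrier G" by (rule mem_carrier[OF h])
  have s0: "s t0 \<in> carrier G" by (rule hlift_carrier[OF es(3) t0K])
  define p where "p = s t0 \<otimes> h"
  have p: "p \<in> carrier G" "proj p = c t0"
    using s0 hG proj_mult_H[OF s0 h] hliftD(1)[OF es(3) t0K] by (auto simp: p_def)
  obtain e' N where eN: "e' > 0" "openin T N" "p \<in> N" "{t0-e'<..<t0+e'} \<subseteq> I"
    "\<And>t1 x1. t1 \<in> {t0-e'<..<t0+e'} \<Longrightarrow> x1 \<in> N \<Longrightarrow> proj x1 = c t1 \<Longrightarrow>
      \<exists>x. hlift {t0-e'<..<t0+e'} x \<and> x t1 = x1"
    using lift_local_existence[OF t0 p] by blast
  let ?Z = "prod_topology (top_of_set ?K) T"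
  have sc: "continuous_map (top_of_set ?K) T s"
    by (rule smooth_curve_continuous[OF hlift_smooth[OF es(3)]])
  have "continuous_map ?Z T (\<lambda>q. s (fst q))"
    using continuous_map_compose[OF continuous_map_fst sc] by (simp add: o_def)
  then have "continuous_map ?Z T (\<lambda>q. s (fst q) \<otimes> snd q)"
    by (rule continuous_mult[OF _ continuous_map_snd])
  then have oQ: "openin ?Z {q \<in> topspace ?Z. s (fst q) \<otimes> snd q \<in> N}" (is "openin _ ?Q")
    using eN(2) by (rule openin_continuous_map_preimage)
  have "(t0, h) \<in> ?Q" using t0K hG eN(3) topspace_carrier by (simp add: p_def)
  from openin_prod_topology_alt[THEN iffD1, OF oQ, rule_format, OF this]
  obtain L V where LV: "openin (top_of_set ?K) L" "openin T V" "t0 \<in> L" "h \<in> V"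
    "L \<times> V \<subseteq> ?Q" by blast
  have "open L" using LV(1) openin_open_trans open_greaterThanLessThan by blast
  then obtain d where d: "d > 0" "ball t0 d \<subseteq> L" using LV(3) open_contains_ball by blast
  obtain t where t: "t \<in> ?K" "t \<in> S" "\<bar>t - t0\<bar> < min d e'" "k t \<in> V"
    using cluster[OF LV(2,4), of "min d e'"] d(1) eN(1) by auto
  have "t \<in> L" using t(3) d(2) by (auto simp: dist_real_def abs_minus_commute subset_iff)
  then have "s t \<otimes> k t \<in> N" using LV(5) t(4) by auto
  then have "X t \<in> N" using k(2)[OF t(1,2)] by simp
  moreover have tK': "t \<in> {t0-e'<..<t0+e'}" using t(3) by auto
  ultimately obtain x where "hlift {t0-e'<..<t0+e'} x" "x t = X t" using eN(5) X[OF t(2)] by blast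
  moreover have "t0 \<in> {t0-e'<..<t0+e'}" using eN(1) by simp
  moreover have "open {t0-e'<..<t0+e'}" "connected {t0-e'<..<t0+e'}" by auto
  ultimately show ?thesis using eN(4) t(2) tK' by blast
qed

text \<open>The condition on the image in the quotient follows from equivariance of the projection, and the
  left trivialised velocity vanishes only if the velocity of \<open>c\<close> does.\<close>

lemma m_lift_iff_hlift:
  assumes J: "open J" "J \<subseteq> I" and nz: "\<And>t. t \<in> I \<Longrightarrow> velocity B c t \<noteq> 0"
  shows "m_lift G T A H B \<mm> c g J x \<longleftrightarrow> hlift J x \<and> x 0 = g"
proof
  assume m: "m_lift G T A H B \<mm> c g J x"
  then have sm: "smooth_curve T A J x" by (simp add: m_lift_def)
  have "proj (x t) = c t \<and> tangent_map A A (\<lambda>z. inv (x t) \<otimes> z) (x t) (velocity A x t) \<in> \<mm>" if t: "t \<in> J" for t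
    using m t act_origin[OF smooth_curve_carrier[OF sm t]]
    by (auto simp: m_lift_def Let_def left_translation_def)
  then show "hlift J x \<and> x 0 = g" using m sm by (auto simp: hlift_def m_lift_def)
next
  assume l: "hlift J x \<and> x 0 = g"
  then have h: "hlift J x" by simp
  have "c t = act G (x t) (origin G H) \<and>
      tangent_map A A (left_translation G (inv (x t))) (x t) (velocity A x t) \<in> \<mm> - {0} \<and>
      tangent_map A B (\<lambda>x. act G x (origin G H)) \<one>
        (tangent_map A A (left_translation G (inv (x t))) (x t) (velocity A x t)) =
      tangent_map B B (act G (inv (x t))) (c t) (velocity B c t)" if t: "t \<in> J" for t
  proof -
    have xG: "x t \<in> carrier G" by (rule hlift_carrier[OF h t])
    then have x': "inv (x t) \<in> carrier G" by simp
    have m: "curve_mdiff T A x t" by (rule hlift_mdiff[OF h J(1) t])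
    let ?v = "velocity A x t"
    have vT: "?v \<in> tangent_space A (x t)" by (rule velocity_in_tangent_space[OF smooth_manifold_axioms m])
    define u where "u = tangent_map A A (\<lambda>z. inv (x t) \<otimes> z) (x t) ?v"
    note u = left_trivialized_velocity[OF xG vT, folded u_def]
    have um: "u \<in> \<mm>" using hliftD(2)[OF h t] by (simp add: u_def)
    have vc: "tangent_map A B proj (x t) ?v = velocity B c t" by (rule hlift_velocity[OF h J(1) t])
    have "u \<noteq> 0"
    proof
      assume "u = 0"
      have e: "\<one> \<in> topspace T" "x t \<in> topspace T" using topspace_carrier xG one_carrier by auto
      have "?v = 0"
        using u(2) tangent_map_zero[OF smooth_manifold_axioms smooth_manifold_axioms
            mdiff_left_translation[OF xG one_carrier] tangent_space_zero[OF e(1)]] \<open>u = 0\<close> by simp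
      then have "velocity B c t = 0"
        using vc tangent_map_zero[OF smooth_manifold_axioms coset.smooth_manifold_axioms
            mdiff_proj[OF xG] tangent_space_zero[OF e(2)]] by simp
      then show False using nz t J(2) by blast
    qed
    moreover have "tangent_map A B (\<lambda>x. act G x (origin G H)) \<one> u = tangent_map A B proj \<one> u"
      by (rule tangent_map_cong[OF smooth_manifold_axioms mdiff_proj[OF one_carrier] u(1) openin_topspace, symmetric])
        (use act_origin topspace_carrier in auto)
    moreover have "tangent_map B B (act G (inv (x t))) (c t) (velocity B c t) = tangent_map A B proj \<one> u"
      using tangent_map_act_proj[OF x' xG vT] vc hliftD(1)[OF h t] xG by (simp add: u_def)
    ultimately show ?thesis
      using um act_origin[OF xG] hliftD(1)[OF h t] by (simp add: left_translation_def u_def)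
  qed
  then show "m_lift G T A H B \<mm> c g J x"
    using l hlift_smooth[OF h] by (auto simp: m_lift_def Let_def)
qed

end

lemma connected_einterval: "connected (einterval a b)"
proof -
  have "is_interval (einterval a b)"
    unfolding is_interval_1 einterval_def
    by clarsimp (metis ereal_less_eq(3) le_less_trans less_le_trans)
  then show ?thesis by (simp add: is_interval_connected_1)
qed

theorem lemma5p1:
  fixes G :: "('g, 'z) monoid_scheme"
    and T :: "'g topology" and A :: "('g, 'e::euclidean_space) chart set"
    and H :: "'g set"
    and Y :: "'g set topology" and B :: "('g set, 'f::euclidean_space) chart set"
    and \<mm> :: "('g, 'e) tangent_vector set"
    and a b :: ereal and c :: "real \<Rightarrow> 'g set" and g :: 'g
  assumes "smooth_coset_space G T A H Y B"
    and "linear_decomposition G T A H \<mm>"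
    and "a < 0" and "0 < b"
    and "smooth_curve Y B (einterval a b) c"
    and "g \<in> carrier G" and "c 0 = act G g (origin G H)"
    and "\<forall>t\<in>einterval a b. velocity B c t \<noteq> 0"
  shows "(\<exists>J cb. open J \<and> is_interval J \<and> 0 \<in> J \<and> J \<subseteq> einterval a b \<and>
            m_lift G T A H B \<mm> c g J cb) \<and>
         (\<forall>J1 J2 cb1 cb2.
            open J1 \<and> is_interval J1 \<and> 0 \<in> J1 \<and> J1 \<subseteq> einterval a b \<and>
              m_lift G T A H B \<mm> c g J1 cb1 \<and>
            open J2 \<and> is_interval J2 \<and> 0 \<in> J2 \<and> J2 \<subseteq> einterval a b \<and>
              m_lift G T A H B \<mm> c g J2 cb2 \<longrightarrow>
            (\<forall>t\<in>J1 \<inter> J2. cb1 t = cb2 t)) \<and>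
         (reductive G T A H \<mm> \<or> compactin T H \<longrightarrow>
            (\<exists>cb. m_lift G T A H B \<mm> c g (einterval a b) cb))"
proof -
  define I where "I = einterval a b"
  interpret horizontal_lifting G T A H Y B \<mm> c I
    unfolding horizontal_lifting_def horizontal_lifting_axioms_def I_def
    using assms(1,2,5) by simp
  have zero: "0 \<in> I" using assms(3,4) by (simp add: I_def einterval_def zero_ereal_def[symmetric])
  have conn: "connected I" unfolding I_def by (rule connected_einterval)
  have g: "g \<in> carrier G" "proj g = c 0" using assms(6,7) act_origin by auto
  have iff: "m_lift G T A H B \<mm> c g J x \<longleftrightarrow> hlift J x \<and> x 0 = g" if "open J" "J \<subseteq> I" for J x
    by (rule m_lift_iff_hlift[OF that]) (use assms(8) in \<open>simp add: I_def\<close>)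
  have local: "\<exists>J cb. open J \<and> is_interval J \<and> 0 \<in> J \<and> J \<subseteq> I \<and> m_lift G T A H B \<mm> c g J cb"
  proof -
    obtain e N where eN: "e > 0" "openin T N" "g \<in> N" "{0-e<..<0+e} \<subseteq> I"
      "\<And>t1 x1. t1 \<in> {0-e<..<0+e} \<Longrightarrow> x1 \<in> N \<Longrightarrow> proj x1 = c t1 \<Longrightarrow> \<exists>x. hlift {0-e<..<0+e} x \<and> x t1 = x1"
      using lift_local_existence[OF zero g] by blast
    let ?J = "{0-e<..<0+e}"
    have 0: "0 \<in> ?J" using eN(1) by simp
    obtain x where "hlift ?J x" "x 0 = g" using eN(5)[OF 0 eN(3) g(2)] by blast
    then have "m_lift G T A H B \<mm> c g ?J x" using iff[OF open_greaterThanLessThan eN(4)] by blast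
    moreover have "open ?J" "is_interval ?J" by (auto simp: is_interval_connected_1)
    ultimately show ?thesis using 0 eN(4) by blast
  qed
  have unique: "cb1 t = cb2 t"
    if J1: "open J1" "is_interval J1" "0 \<in> J1" "J1 \<subseteq> I" "m_lift G T A H B \<mm> c g J1 cb1"
      and J2: "open J2" "is_interval J2" "0 \<in> J2" "J2 \<subseteq> I" "m_lift G T A H B \<mm> c g J2 cb2"
      and t: "t \<in> J1 \<inter> J2" for J1 J2 cb1 cb2 t
  proof (rule lift_unique[OF J1(1) J2(1) _ _ J1(4) _ _ _ t])
    show "hlift J1 cb1" "hlift J2 cb2" using iff J1 J2 by auto
    show "connected (J1 \<inter> J2)" using is_interval_Int[OF J1(2) J2(2)] is_interval_connected_1 by blast
    show "0 \<in> J1 \<inter> J2" using J1 J2 by simp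
    show "cb1 0 = cb2 0" using iff J1 J2 by metis
  qed
  have global: "\<exists>cb. m_lift G T A H B \<mm> c g I cb" if "reductive G T A H \<mm> \<or> compactin T H"
  proof (rule global_lift[OF conn zero g])
    fix t0 S and X :: "real \<Rightarrow> 'g"
    assume "t0 \<in> I" "\<And>\<delta>. \<delta> > 0 \<Longrightarrow> \<exists>t\<in>S. \<bar>t - t0\<bar> < \<delta>" "\<And>t. t \<in> S \<Longrightarrow> X t \<in> carrier G \<and> proj (X t) = c t"
    then show "\<exists>K x t1. open K \<and> connected K \<and> t0 \<in> K \<and> K \<subseteq> I \<and> t1 \<in> K \<inter> S \<and> hlift K x \<and> x t1 = X t1"
      using that extension_reductive[of t0 S X] extension_compact[of t0 S X] by blast
  next
    fix x assume "hlift I x" "x 0 = g"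
    then show ?thesis using iff[OF open_I] by blast
  qed
  show ?thesis
    using local unique global unfolding I_def by blast
qed

end
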